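(* Let $P$ be a computable probability distribution on Cantor space $\Omega$, and let $F\subseteq\Omega\times\Omega$ satisfy: (i) $F$ is an effectively closed subset of $\Omega\times\Omega$; (ii) for every $\alpha\in\Omega$ there is $\beta$ with $(\alpha,\beta)\in F$; (iii) for every binary string $y$, the set $\{\alpha\mid\exists\beta\,((\alpha,\beta)\in F$ and $\beta$ starts with $y)\}$ is a clopen set computable from $y$. Let $\mathcal L$ be the class of probability distributions $Q$ on $\Omega$ that are $F$-couplable with $P$ (a non-empty effectively closed class). Then, with $O(1)$ precision (an additive constant independent of $\beta$), for all $\beta\in\Omega$ $$d_{\mathcal L}(\beta)=\inf_\alpha\{d_P(\alpha)\mid (\alpha,\beta)\in F\},$$ and this holds both when $d_{\mathcal L},d_P$ are the expectation-bounded deficiencies and when they are the probability-bounded deficiencies. In particular, $\beta$ is random with respect to the class $\mathcal L$ if and only if $(\alpha,\beta)\in F$ for some Martin-L\"of $P$-random $\alpha$.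
   Context: $\Omega=\{0,1\}^{\mathbb N}$; $x\Omega$ is the set of sequences with prefix $x$; $P$ is computable if $x\mapsto P(x\Omega)$ is computable. Effectively open subset of $\Omega$: union of $x\Omega$ over a computably enumerable set of strings; a subset of $\Omega\times\Omega$ is effectively closed if its complement is a union of a computably enumerable sequence of products of intervals. $Q$ is $F$-couplable with $P$ if there is a distribution $S$ on $\Omega\times\Omega$ with $S$-null complement of $F$, first marginal $P$ and second marginal $Q$. A function $t:\Omega\to[0,+\infty]$ is lower semicomputable if $\{t>r\}$ is effectively open uniformly in rational $r$. For an effectively closed class $\mathcal L$ of distributions (a computable distribution $\mu$ is the case $\mathcal L=\{\mu\}$): an expectation-bounded $\mathcal L$-test is a lower semicomputable $t\ge0$ with $\int t\,dQ\le1$ for all $Q\in\mathcal L$; there is a maximal one $t_{\mathcal L}$ up to a multiplicative constant, and the expectation-bounded deficiency is $d_{\mathcal L}=\log t_{\mathcal L}$. A Martin-L\"of $\mathcal L$-test is a decreasing sequence $U_1\supset U_2\supset\ldots$ of uniformly effectively open sets with $Q(U_i)\le2^{-i}$ for all $Q\in\mathcal L$, with deficiency $\sup\{i\mid\omega\in U_i\}$; the probability-bounded deficiency $d_{\mathcal L}$ is the maximal such deficiency (up to an additive constant), given by a universal test. A sequence is random with respect to $\mathcal L$ if its deficiency is finite; for $\mathcal L=\{P\}$ this is Martin-L\"of $P$-randomness. *)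

theory Defs
  imports "HOL-Probability.Probability" "HOL-Library.Nat_Bijection"
begin

section \<open>Computability\<close>

text \<open>
  \<open>recursive n f\<close>: the values of \<open>f\<close> on lists of length \<open>n\<close> form a total recursive function of
  \<open>n\<close> arguments (its values on other lists are irrelevant).  Minimization is only
  applied in the regular case, so that all functions stay total; by Kleene's normal form theorem
  this yields exactly the total computable functions.
\<close>

inductive recursive :: "nat \<Rightarrow> (nat list \<Rightarrow> nat) \<Rightarrow> bool" where
  zero: "recursive n (\<lambda>_. 0)"
| succ: "recursive 1 (\<lambda>xs. Suc (xs ! 0))"
| proj: "i < n \<Longrightarrow> recursive n (\<lambda>xs. xs ! i)"
| comp: "recursive (length gs) f \<Longrightarrow> \<forall>g\<in>set gs. recursive n g
    \<Longrightarrow> recursive n (\<lambda>xs. f (map (\<lambda>g. g xs) gs))"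
| prim_rec: "recursive n f \<Longrightarrow> recursive (n + 2) g
    \<Longrightarrow> recursive (n + 1) (\<lambda>xs. rec_nat (f (tl xs)) (\<lambda>k r. g (k # r # tl xs)) (hd xs))"
| minim: "recursive (n + 1) f \<Longrightarrow> \<forall>xs. length xs = n \<longrightarrow> (\<exists>y. f (y # xs) = 0)
    \<Longrightarrow> recursive n (\<lambda>xs. LEAST y. f (y # xs) = 0)"

text \<open>
  Computability for other objects is expressed through the injective codings below, all of them
  built from the effective codings of \<open>Nat_Bijection\<close>.
\<close>

definition computable :: "('a \<Rightarrow> nat) \<Rightarrow> ('b \<Rightarrow> nat) \<Rightarrow> ('a \<Rightarrow> 'b) \<Rightarrow> bool" where
  "computable ca cb f \<longleftrightarrow> (\<exists>g. recursive 1 g \<and> (\<forall>x. g [ca x] = cb (f x)))"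

definition comp_enumerable :: "('a \<Rightarrow> nat) \<Rightarrow> 'a set \<Rightarrow> bool" where
  "comp_enumerable ca A \<longleftrightarrow> A = {} \<or> (\<exists>g. recursive 1 g \<and> ca ` A = range (\<lambda>n. g [n]))"

definition pair_code :: "('a \<Rightarrow> nat) \<Rightarrow> ('b \<Rightarrow> nat) \<Rightarrow> 'a \<times> 'b \<Rightarrow> nat" where
  "pair_code ca cb p = prod_encode (ca (fst p), cb (snd p))"

definition list_code :: "('a \<Rightarrow> nat) \<Rightarrow> 'a list \<Rightarrow> nat" where
  "list_code ca xs = list_encode (map ca xs)"

definition string_code :: "bool list \<Rightarrow> nat" where
  "string_code = list_code of_bool"

definition rat_code :: "rat \<Rightarrow> nat" where
  "rat_code r = pair_code int_encode int_encode (quotient_of r)"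


section \<open>Cantor space\<close>

type_synonym cantor = "nat \<Rightarrow> bool"

definition starts_with :: "cantor \<Rightarrow> bool list \<Rightarrow> bool" where
  "starts_with \<omega> x \<longleftrightarrow> (\<forall>i<length x. \<omega> i = x ! i)"

definition cyl :: "bool list \<Rightarrow> cantor set" where
  "cyl x = {\<omega>. starts_with \<omega> x}"

definition unif_effectively_open :: "('i \<Rightarrow> nat) \<Rightarrow> 'i set \<Rightarrow> ('i \<Rightarrow> cantor set) \<Rightarrow> bool" where
  "unif_effectively_open ci I U \<longleftrightarrow>
     (\<exists>A. comp_enumerable (pair_code ci string_code) A \<and>
          (\<forall>i\<in>I. U i = (\<Union>x\<in>{x. (i, x) \<in> A}. cyl x)))"

definition effectively_closed :: "(cantor \<times> cantor) set \<Rightarrow> bool" where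
  "effectively_closed F \<longleftrightarrow>
     (\<exists>A. comp_enumerable (pair_code string_code string_code) A \<and>
          - F = (\<Union>(x, y)\<in>A. cyl x \<times> cyl y))"

text \<open>A clopen subset of Cantor space is given effectively by a finite list of strings whose
  cylinders have it as their union.\<close>

definition computable_clopen :: "(bool list \<Rightarrow> cantor set) \<Rightarrow> bool" where
  "computable_clopen C \<longleftrightarrow>
     (\<exists>D. computable string_code (list_code string_code) D \<and>
          (\<forall>y. C y = (\<Union>x\<in>set (D y). cyl x)))"


section \<open>Probability distributions\<close>

definition cantor_algebra :: "cantor measure" where
  "cantor_algebra = Pi\<^sub>M UNIV (\<lambda>_. count_space UNIV)"

definition distributions :: "cantor measure set" where
  "distributions = {Q. prob_space Q \<and> sets Q = sets cantor_algebra}"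

definition computable_distribution :: "cantor measure \<Rightarrow> bool" where
  "computable_distribution P \<longleftrightarrow> P \<in> distributions \<and>
     (\<exists>g. recursive 2 g \<and>
        (\<forall>x k. \<bar>measure P (cyl x) - real (g [string_code x, k]) / 2 ^ k\<bar> \<le> 1 / 2 ^ k))"

definition couplable ::
    "(cantor \<times> cantor) set \<Rightarrow> cantor measure \<Rightarrow> cantor measure \<Rightarrow> bool" where
  "couplable F P Q \<longleftrightarrow>
     (\<exists>S. prob_space S \<and> sets S = sets (cantor_algebra \<Otimes>\<^sub>M cantor_algebra) \<and>
          - F \<in> null_sets S \<and>
          distr S cantor_algebra fst = P \<and> distr S cantor_algebra snd = Q)"

definition couplable_class :: "(cantor \<times> cantor) set \<Rightarrow> cantor measure \<Rightarrow> cantor measure set" where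
  "couplable_class F P = {Q \<in> distributions. couplable F P Q}"

text \<open>Basic open sets of the weak topology on distributions: finitely many conditions
  \<open>a < Q(x\<Omega>) < b\<close> with rational \<open>a\<close>, \<open>b\<close>.\<close>

definition basic_open :: "(bool list \<times> rat \<times> rat) list \<Rightarrow> cantor measure set" where
  "basic_open l = {Q \<in> distributions. \<forall>(x, a, b)\<in>set l.
     of_rat a < measure Q (cyl x) \<and> measure Q (cyl x) < of_rat b}"

definition effectively_closed_class :: "cantor measure set \<Rightarrow> bool" where
  "effectively_closed_class \<L> \<longleftrightarrow> \<L> \<subseteq> distributions \<and>
     (\<exists>A. comp_enumerable (list_code (pair_code string_code (pair_code rat_code rat_code))) A \<and>
          distributions - \<L> = (\<Union>l\<in>A. basic_open l))"


section \<open>Randomness tests and deficiencies\<close>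

text \<open>The comparison with \<open>r\<close> takes place in \<^typ>\<open>ereal\<close> because \<^const>\<open>ennreal\<close> would
  truncate negative rationals.\<close>

definition lower_semicomputable :: "(cantor \<Rightarrow> ennreal) \<Rightarrow> bool" where
  "lower_semicomputable t \<longleftrightarrow>
     unif_effectively_open rat_code UNIV (\<lambda>r. {\<omega>. ereal (of_rat r) < enn2ereal (t \<omega>)})"

definition expectation_test :: "cantor measure set \<Rightarrow> (cantor \<Rightarrow> ennreal) \<Rightarrow> bool" where
  "expectation_test \<L> t \<longleftrightarrow> lower_semicomputable t \<and> (\<forall>Q\<in>\<L>. (\<integral>\<^sup>+\<omega>. t \<omega> \<partial>Q) \<le> 1)"

definition maximal_expectation_test :: "cantor measure set \<Rightarrow> (cantor \<Rightarrow> ennreal) \<Rightarrow> bool" where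
  "maximal_expectation_test \<L> t \<longleftrightarrow> expectation_test \<L> t \<and>
     (\<forall>t'. expectation_test \<L> t' \<longrightarrow> (\<exists>c::real. \<forall>\<omega>. t' \<omega> \<le> ennreal c * t \<omega>))"

definition log_ennreal :: "ennreal \<Rightarrow> ereal" where
  "log_ennreal x =
     (if x = 0 then - \<infinity> else if x = \<infinity> then \<infinity> else ereal (log 2 (enn2real x)))"

text \<open>Maximal tests, hence deficiencies, are only determined up to a constant; so
  ``\<open>d\<close> is a deficiency of \<open>\<L>\<close>'' is a relation.\<close>

definition expectation_deficiency :: "cantor measure set \<Rightarrow> (cantor \<Rightarrow> ereal) \<Rightarrow> bool" where
  "expectation_deficiency \<L> d \<longleftrightarrow>
     (\<exists>t. maximal_expectation_test \<L> t \<and> d = (\<lambda>\<omega>. log_ennreal (t \<omega>)))"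

text \<open>Tests are indexed by \<open>i \<ge> 1\<close>; the value of \<open>U 0\<close> is irrelevant throughout.\<close>

definition ml_test :: "cantor measure set \<Rightarrow> (nat \<Rightarrow> cantor set) \<Rightarrow> bool" where
  "ml_test \<L> U \<longleftrightarrow> unif_effectively_open id {1..} U \<and>
     (\<forall>i\<ge>1. U (Suc i) \<subseteq> U i) \<and>
     (\<forall>Q\<in>\<L>. \<forall>i\<ge>1. measure Q (U i) \<le> 1 / 2 ^ i)"

text \<open>The supremum of the empty set is read as 0.\<close>

definition ml_test_deficiency :: "(nat \<Rightarrow> cantor set) \<Rightarrow> cantor \<Rightarrow> ereal" where
  "ml_test_deficiency U \<omega> = (SUP i\<in>insert 0 {i. 1 \<le> i \<and> \<omega> \<in> U i}. ereal (real i))"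

definition universal_ml_test :: "cantor measure set \<Rightarrow> (nat \<Rightarrow> cantor set) \<Rightarrow> bool" where
  "universal_ml_test \<L> U \<longleftrightarrow> ml_test \<L> U \<and>
     (\<forall>V. ml_test \<L> V \<longrightarrow>
        (\<exists>c::real. \<forall>\<omega>. ml_test_deficiency V \<omega> \<le> ml_test_deficiency U \<omega> + ereal c))"

definition probability_deficiency :: "cantor measure set \<Rightarrow> (cantor \<Rightarrow> ereal) \<Rightarrow> bool" where
  "probability_deficiency \<L> d \<longleftrightarrow>
     (\<exists>U. universal_ml_test \<L> U \<and> d = ml_test_deficiency U)"

definition equal_up_to_const :: "('a \<Rightarrow> ereal) \<Rightarrow> ('a \<Rightarrow> ereal) \<Rightarrow> bool" where
  "equal_up_to_const f g \<longleftrightarrow>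
     (\<exists>c::real. \<forall>x. f x \<le> g x + ereal c \<and> g x \<le> f x + ereal c)"

end

theory Submission
  imports Defs
begin

text \<open>
  For a coupling of \<open>P\<close> with \<open>Q\<close> on \<open>F\<close>, a function \<open>t\<close> on the first factor dominates its
  infimum \<open>\<beta> \<mapsto> inf {t \<alpha> | (\<alpha>, \<beta>) \<in> F}\<close>, so a \<open>P\<close>-test yields a test for the whole class; the infimum
  is lower semicomputable because the fibres of an effectively closed set are effectively compact.
  Conversely, \<open>\<alpha> \<mapsto> sup {t \<beta> | (\<alpha>, \<beta>) \<in> F}\<close> is lower semicomputable by the clopen projection
  property, and measurable selections of \<open>F\<close>, whose image measures lie in the class, show that it
  is a \<open>P\<close>-test whenever \<open>t\<close> is a class test. For sets this supremum gives the semidecidable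
  obstruction \<open>Q(Y) > P {\<alpha> | \<exists>\<beta> \<in> Y. (\<alpha>, \<beta>) \<in> F}\<close> with \<open>Y\<close> a finite union of cylinders, and by
  Strassen's theorem every \<open>Q\<close> outside the class is excluded by such a \<open>Y\<close>.
\<close>

section \<open>Recursive functions and effective codings\<close>

text \<open>For all U and V, \<open>hits V\<close> is contained in U exactly if V is contained in
  \<open>core F U\<close>; likewise \<open>fibre_Sup t\<close> lies below s exactly if t lies below
  the fibrewise infimum of s. The two inequalities of the theorem are the two sides of this
  adjunction: each operation carries tests for one side to tests for the other, and maximality on
  the receiving side supplies the additive constant. The expectation-bounded and the
  probability-bounded case follow this scheme separately. A lower semicontinuous t need not attain
  its supremum on a fibre, so the P-integral of the supremum is reached by a sequence of improving
  selections, not by one optimal selection. Membership in the class is an existence statement about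
  couplings and has to be refuted by finite information. The obstruction concerns a sum over several
  cylinders, whereas \<open>basic_open\<close> bounds cylinders one at a time; it is therefore split
  into rational lower bounds with a common denominator, and the rounding loss and the approximation
  error for P must together stay below the gap.\<close>

text \<open>\<^const>\<open>recursive\<close> constrains a function also on lists of the wrong length, hence the detour.\<close>

definition rec_fun :: "nat \<Rightarrow> (nat list \<Rightarrow> nat) \<Rightarrow> bool" where
  "rec_fun n f \<longleftrightarrow> (\<exists>g. recursive n g \<and> (\<forall>xs. length xs = n \<longrightarrow> g xs = f xs))"

lemma rec_fun_cong:
  assumes "rec_fun n f" "\<And>xs. length xs = n \<Longrightarrow> f xs = f' xs"
  shows "rec_fun n f'"
  using assms unfolding rec_fun_def by auto

lemma rec_fun_recursive: "recursive n f \<Longrightarrow> rec_fun n f"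
  unfolding rec_fun_def by blast

lemma rec_fun_nth: "i < n \<Longrightarrow> rec_fun n (\<lambda>xs. xs ! i)"
  by (intro rec_fun_recursive recursive.proj)

lemma rec_fun_comp1:
  assumes "rec_fun 1 h" "rec_fun n f"
  shows "rec_fun n (\<lambda>xs. h [f xs])"
proof -
  obtain h' f' where h': "recursive 1 h'" "\<And>xs. length xs = 1 \<Longrightarrow> h' xs = h xs"
    and f': "recursive n f'" "\<And>xs. length xs = n \<Longrightarrow> f' xs = f xs"
    using assms unfolding rec_fun_def by blast
  have "recursive n (\<lambda>xs. h' (map (\<lambda>g. g xs) [f']))"
    using h' f' by (intro recursive.comp) auto
  then have "rec_fun n (\<lambda>xs. h' (map (\<lambda>g. g xs) [f']))"
    by (rule rec_fun_recursive)
  then show ?thesis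
    by (rule rec_fun_cong) (simp add: h' f')
qed

lemma rec_fun_comp2:
  assumes "rec_fun 2 h" "rec_fun n f" "rec_fun n g"
  shows "rec_fun n (\<lambda>xs. h [f xs, g xs])"
proof -
  obtain h' f' g' where h': "recursive 2 h'" "\<And>xs. length xs = 2 \<Longrightarrow> h' xs = h xs"
    and f': "recursive n f'" "\<And>xs. length xs = n \<Longrightarrow> f' xs = f xs"
    and g': "recursive n g'" "\<And>xs. length xs = n \<Longrightarrow> g' xs = g xs"
    using assms unfolding rec_fun_def by metis
  have "recursive n (\<lambda>xs. h' (map (\<lambda>g. g xs) [f', g']))"
    using h' f' g' by (intro recursive.comp) (auto simp: numeral_2_eq_2)
  then have "rec_fun n (\<lambda>xs. h' (map (\<lambda>g. g xs) [f', g']))"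
    by (rule rec_fun_recursive)
  then show ?thesis
    by (rule rec_fun_cong) (simp add: h' f' g')
qed

lemma rec_fun_Suc: "rec_fun n f \<Longrightarrow> rec_fun n (\<lambda>xs. Suc (f xs))"
  using rec_fun_comp1[OF rec_fun_recursive[OF recursive.succ]] by simp

lemma rec_fun_const: "rec_fun n (\<lambda>_. c)"
  by (induction c) (auto intro: rec_fun_Suc rec_fun_recursive recursive.zero)

text \<open>One parameter is enough: several parameters are packed into a single number by
  \<open>prod_encode\<close>, as in \<open>rf1_rec_nat\<close>.\<close>

lemma rec_fun_rec_nat:
  assumes "rec_fun 1 f" "rec_fun 3 g"
  shows "rec_fun 2 (\<lambda>xs. rec_nat (f [xs ! 1]) (\<lambda>k r. g [k, r, xs ! 1]) (xs ! 0))"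
proof -
  obtain f' g' where f': "recursive 1 f'" "\<And>xs. length xs = 1 \<Longrightarrow> f' xs = f xs"
    and g': "recursive 3 g'" "\<And>xs. length xs = 3 \<Longrightarrow> g' xs = g xs"
    using assms unfolding rec_fun_def by metis
  have "recursive (1 + 1) (\<lambda>xs. rec_nat (f' (tl xs)) (\<lambda>k r. g' (k # r # tl xs)) (hd xs))"
    using f' g' by (intro recursive.prim_rec) (simp_all add: numeral_3_eq_3)
  then have "rec_fun 2 (\<lambda>xs. rec_nat (f' (tl xs)) (\<lambda>k r. g' (k # r # tl xs)) (hd xs))"
    unfolding one_add_one by (rule rec_fun_recursive)
  moreover have "rec_nat (f' (tl xs)) (\<lambda>k r. g' (k # r # tl xs)) (hd xs)
      = rec_nat (f [xs ! 1]) (\<lambda>k r. g [k, r, xs ! 1]) (xs ! 0)" if "length xs = 2" for xs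
  proof -
    obtain a b where "xs = [a, b]"
      using \<open>length xs = 2\<close> by (auto simp: numeral_2_eq_2 length_Suc_conv)
    then show ?thesis by (simp add: f' g')
  qed
  ultimately show ?thesis by (rule rec_fun_cong)
qed

section \<open>Unary recursive functions and the decoding of pairs\<close>

definition rf1 :: "(nat \<Rightarrow> nat) \<Rightarrow> bool" where
  "rf1 f \<longleftrightarrow> rec_fun 1 (\<lambda>xs. f (xs ! 0))"

definition rf2 :: "(nat \<Rightarrow> nat \<Rightarrow> nat) \<Rightarrow> bool" where
  "rf2 f \<longleftrightarrow> rec_fun 2 (\<lambda>xs. f (xs ! 0) (xs ! 1))"

lemma rf1_iff: "rf1 f \<longleftrightarrow> (\<exists>g. recursive 1 g \<and> (\<forall>x. g [x] = f x))"
  unfolding rf1_def rec_fun_def by (auto simp: length_Suc_conv)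

lemma rf2_recursive: "recursive 2 g \<Longrightarrow> rf2 (\<lambda>x y. g [x, y])"
  unfolding rf2_def by (erule rec_fun_cong[OF rec_fun_recursive])
    (auto simp: length_Suc_conv numeral_eq_Suc simp del: One_nat_def)

lemma rec_fun_rf1: "rf1 h \<Longrightarrow> rec_fun n f \<Longrightarrow> rec_fun n (\<lambda>xs. h (f xs))"
  unfolding rf1_def by (drule (1) rec_fun_comp1) simp

lemma rec_fun_rf2: "rf2 h \<Longrightarrow> rec_fun n f \<Longrightarrow> rec_fun n g \<Longrightarrow> rec_fun n (\<lambda>xs. h (f xs) (g xs))"
  unfolding rf2_def by (drule (2) rec_fun_comp2) simp

lemma rf1_id: "rf1 (\<lambda>x. x)"
  unfolding rf1_def by (rule rec_fun_nth) simp

lemma rf1_const: "rf1 (\<lambda>x. c)"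
  unfolding rf1_def by (rule rec_fun_const)

lemma rf1_comp: "rf1 h \<Longrightarrow> rf1 f \<Longrightarrow> rf1 (\<lambda>x. h (f x))"
  unfolding rf1_def[of f] rf1_def[of "\<lambda>x. h (f x)"] by (rule rec_fun_rf1)

lemma rf1_comp2: "rf2 h \<Longrightarrow> rf1 f \<Longrightarrow> rf1 g \<Longrightarrow> rf1 (\<lambda>x. h (f x) (g x))"
  unfolding rf1_def by (rule rec_fun_rf2)

lemma rf1_Suc: "rf1 f \<Longrightarrow> rf1 (\<lambda>x. Suc (f x))"
  unfolding rf1_def by (rule rec_fun_Suc)

lemma rf2_rec_nat:
  assumes "rf1 f" "rec_fun 3 (\<lambda>xs. g (xs ! 0) (xs ! 1) (xs ! 2))"
  shows "rf2 (\<lambda>x y. rec_nat (f y) (\<lambda>k r. g k r y) x)"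
  using rec_fun_rec_nat[of "\<lambda>xs. f (xs ! 0)" "\<lambda>xs. g (xs ! 0) (xs ! 1) (xs ! 2)"] assms
  unfolding rf1_def rf2_def by simp

lemma rf2_add: "rf2 (+)"
proof -
  have "rf2 (\<lambda>x y. rec_nat y (\<lambda>k r. Suc r) x)"
    by (intro rf2_rec_nat rf1_id rec_fun_Suc rec_fun_nth) simp
  moreover have "rec_nat y (\<lambda>k r. Suc r) x = x + y" for x y
    by (induction x) auto
  ultimately show ?thesis by simp
qed

lemma rf2_mult: "rf2 (\<lambda>x y. x * y)"
proof -
  have "rf2 (\<lambda>x y. rec_nat 0 (\<lambda>k r. r + y) x)"
    by (intro rf2_rec_nat rf1_const rec_fun_rf2[OF rf2_add] rec_fun_nth) simp_all
  moreover have "rec_nat 0 (\<lambda>k r. r + y) x = x * y" for x y :: nat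
    by (induction x) auto
  ultimately show ?thesis by simp
qed

lemma rf1_pred: "rf1 (\<lambda>x. x - 1)"
proof -
  have "rf2 (\<lambda>x y. rec_nat 0 (\<lambda>k r. k) x)"
    by (intro rf2_rec_nat rf1_const rec_fun_nth) simp
  then have "rf1 (\<lambda>x. rec_nat 0 (\<lambda>k r. k) x)"
    by (rule rf1_comp2[OF _ rf1_id rf1_id])
  moreover have "rec_nat 0 (\<lambda>k r. k) x = x - 1" for x :: nat
    by (induction x) auto
  ultimately show ?thesis by simp
qed

lemma rf2_diff: "rf2 (-)"
proof -
  have "rf2 (\<lambda>x y. rec_nat y (\<lambda>k r. r - 1) x)"
    by (intro rf2_rec_nat rf1_id rec_fun_rf1[OF rf1_pred] rec_fun_nth) simp
  moreover have "rec_nat y (\<lambda>k r. r - 1) x = y - x" for x y :: nat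
    by (induction x) auto
  ultimately have "rf2 (\<lambda>x y. y - x)"
    by simp
  then have "rec_fun 2 (\<lambda>xs. xs ! 0 - xs ! 1)"
    by (intro rec_fun_rf2[of "\<lambda>x y. y - x"] rec_fun_nth) simp_all
  then show ?thesis by (simp add: rf2_def)
qed

lemmas rf1_add = rf1_comp2[OF rf2_add]
  and rf1_mult = rf1_comp2[OF rf2_mult]
  and rf1_diff = rf1_comp2[OF rf2_diff]

lemma rf1_triangle: "rf1 f \<Longrightarrow> rf1 (\<lambda>x. triangle (f x))"
proof -
  have "rf2 (\<lambda>x y. rec_nat 0 (\<lambda>k r. r + Suc k) x)"
    by (intro rf2_rec_nat rf1_const rec_fun_rf2[OF rf2_add] rec_fun_Suc rec_fun_nth) simp_all
  then have "rf1 (\<lambda>x. rec_nat 0 (\<lambda>k r. r + Suc k) x)"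
    by (rule rf1_comp2[OF _ rf1_id rf1_id])
  moreover have "rec_nat 0 (\<lambda>k r. r + Suc k) x = triangle x" for x :: nat
    by (induction x) auto
  ultimately show "rf1 f \<Longrightarrow> rf1 (\<lambda>x. triangle (f x))"
    by (simp add: rf1_comp)
qed

lemma rf1_prod_encode: "rf1 f \<Longrightarrow> rf1 g \<Longrightarrow> rf1 (\<lambda>x. prod_encode (f x, g x))"
  unfolding prod_encode_def prod.case by (intro rf1_add rf1_triangle)

abbreviation pfst :: "nat \<Rightarrow> nat" where "pfst x \<equiv> fst (prod_decode x)"
abbreviation psnd :: "nat \<Rightarrow> nat" where "psnd x \<equiv> snd (prod_decode x)"

lemma triangle_mono: "m \<le> n \<Longrightarrow> triangle m \<le> triangle n"
  unfolding triangle_def by (intro div_le_mono mult_le_mono) auto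

lemma prod_encode_mono: "a \<le> c \<Longrightarrow> b \<le> d \<Longrightarrow> prod_encode (a, b) \<le> prod_encode (c, d)"
  unfolding prod_encode_def prod.case by (intro add_mono triangle_mono)

text \<open>The code of (a, b) is \<open>triangle (a + b) + a\<close>, so its diagonal a + b is the
  first s with x < \<open>triangle (Suc s)\<close>. With truncated subtraction this becomes a
  regular minimization, from which both projections are recovered by arithmetic.\<close>

lemma sum_prod_decode:
  "pfst x + psnd x = (LEAST s. Suc x - triangle (Suc s) = 0)"
proof -
  obtain a b where x: "x = prod_encode (a, b)"
    by (metis prod_decode_inverse surj_pair)
  have "(LEAST s. Suc x - triangle (Suc s) = 0) = a + b"
  proof (rule Least_equality)
    show "Suc x - triangle (Suc (a + b)) = 0"
      by (simp add: x prod_encode_def)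
    show "a + b \<le> s" if "Suc x - triangle (Suc s) = 0" for s
    proof (rule ccontr)
      assume "\<not> a + b \<le> s"
      then have "triangle (Suc s) \<le> triangle (a + b)"
        by (intro triangle_mono) simp
      then show False
        using that by (simp add: x prod_encode_def del: triangle_Suc)
    qed
  qed
  then show ?thesis by (simp add: x)
qed

lemma rf1_Least:
  assumes "rf2 f" "\<And>x. \<exists>y. f y x = 0"
  shows "rf1 (\<lambda>x. LEAST y. f y x = 0)"
proof -
  obtain g where g: "recursive 2 g" "\<And>xs. length xs = 2 \<Longrightarrow> g xs = f (xs ! 0) (xs ! 1)"
    using assms(1) unfolding rf2_def rec_fun_def by metis
  have "recursive 1 (\<lambda>xs. LEAST y. g (y # xs) = 0)"
    using g assms(2) by (intro recursive.minim) (simp_all only: one_add_one, auto)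
  then have "rec_fun 1 (\<lambda>xs. LEAST y. g (y # xs) = 0)"
    by (rule rec_fun_recursive)
  then show ?thesis unfolding rf1_def
    by (rule rec_fun_cong) (simp add: g)
qed

lemma rf1_sum_prod_decode: "rf1 (\<lambda>x. pfst x + psnd x)"
proof -
  have "rf2 (\<lambda>s x. Suc x - triangle (Suc s))"
    unfolding rf2_def
    by (intro rec_fun_rf2[OF rf2_diff] rec_fun_Suc rec_fun_rf1[OF rf1_triangle] rf1_id rec_fun_nth) auto
  moreover have "\<exists>s. Suc x - triangle (Suc s) = 0" for x
    by (rule exI[of _ x]) simp
  ultimately show ?thesis
    unfolding sum_prod_decode by (intro rf1_Least)
qed

lemma rf1_pfst: assumes f: "rf1 f" shows "rf1 (\<lambda>x. pfst (f x))"
proof -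
  have "rf1 (\<lambda>x. x - triangle (pfst x + psnd x))"
    by (intro rf1_diff rf1_triangle rf1_sum_prod_decode rf1_id)
  moreover have "x - triangle (pfst x + psnd x) = pfst x" for x
  proof -
    obtain a b where x: "x = prod_encode (a, b)"
      by (metis prod_decode_inverse surj_pair)
    show ?thesis unfolding x by (simp, simp add: prod_encode_def)
  qed
  ultimately show ?thesis using rf1_comp[OF _ f] by simp
qed

lemma rf1_psnd: assumes f: "rf1 f" shows "rf1 (\<lambda>x. psnd (f x))"
proof -
  have "rf1 (\<lambda>x. (pfst x + psnd x) - pfst x)"
    by (intro rf1_diff rf1_sum_prod_decode rf1_pfst rf1_id)
  then show ?thesis using rf1_comp[OF _ f] by simp
qed

text \<open>The step function reads counter, accumulator and parameter from one nested pair, which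
  turns primitive recursion into a closure rule for unary functions. Sums, powers and the traversal
  of list codes are instances.\<close>

lemma rf1_rec_nat:
  assumes "rf1 n" "rf1 f" "rf1 (\<lambda>x. g (pfst x) (pfst (psnd x)) (psnd (psnd x)))"
  shows "rf1 (\<lambda>x. rec_nat (f x) (\<lambda>k r. g k r x) (n x))"
proof -
  have "rec_fun 3 (\<lambda>xs. prod_encode (xs ! 0, prod_encode (xs ! 1, xs ! 2)))"
    unfolding prod_encode_def prod.case
    by (intro rec_fun_rf2[OF rf2_add] rec_fun_rf1[OF rf1_triangle] rf1_id rec_fun_nth) simp_all
  from rec_fun_rf1[OF assms(3) this]
  have "rf2 (\<lambda>x y. rec_nat (f y) (\<lambda>k r. g k r y) x)"
    by (intro rf2_rec_nat assms) simp
  then show ?thesis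
    by (rule rf1_comp2[OF _ assms(1) rf1_id])
qed

lemma rf1_sum:
  assumes "rf1 n" "rf1 (\<lambda>x. f (pfst x) (psnd x))"
  shows "rf1 (\<lambda>x. \<Sum>k<n x. f k x)"
proof -
  have *: "rf1 (\<lambda>x. f (pfst x) (psnd (psnd x)))"
    using rf1_comp[OF assms(2), of "\<lambda>x. prod_encode (pfst x, psnd (psnd x))"]
    by (simp add: rf1_prod_encode rf1_pfst rf1_psnd rf1_id)
  have "rf1 (\<lambda>x. rec_nat 0 (\<lambda>k r. r + f k x) (n x))"
    by (intro rf1_rec_nat assms rf1_const rf1_add * rf1_pfst rf1_psnd rf1_id)
  moreover have "rec_nat 0 (\<lambda>k r. r + f k x) m = (\<Sum>k<m. f k x)" for x m
    by (induction m) auto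
  ultimately show ?thesis by simp
qed

section \<open>Decidable predicates of natural numbers\<close>

definition dec1 :: "(nat \<Rightarrow> bool) \<Rightarrow> bool" where
  "dec1 A \<longleftrightarrow> rf1 (\<lambda>x. of_bool (A x))"

lemma rf1_of_bool: "dec1 A \<Longrightarrow> rf1 (\<lambda>x. of_bool (A x))"
  unfolding dec1_def .

lemma dec1_not: assumes "dec1 A" shows "dec1 (\<lambda>x. \<not> A x)"
proof -
  have "rf1 (\<lambda>x. 1 - of_bool (A x))"
    using assms by (intro rf1_diff rf1_const rf1_of_bool)
  moreover have "1 - of_bool (A x) = (of_bool (\<not> A x) :: nat)" for x
    by simp
  ultimately show ?thesis unfolding dec1_def by simp
qed

lemma dec1_conj: "dec1 A \<Longrightarrow> dec1 B \<Longrightarrow> dec1 (\<lambda>x. A x \<and> B x)"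
  using rf1_mult unfolding dec1_def by (simp add: of_bool_conj)

lemma disj_conv_conj_not: "A \<or> B \<longleftrightarrow> \<not> (\<not> A \<and> \<not> B)"
  by blast

lemma dec1_disj: "dec1 A \<Longrightarrow> dec1 B \<Longrightarrow> dec1 (\<lambda>x. A x \<or> B x)"
  unfolding disj_conv_conj_not by (intro dec1_conj dec1_not)

lemma dec1_imp: "dec1 A \<Longrightarrow> dec1 B \<Longrightarrow> dec1 (\<lambda>x. A x \<longrightarrow> B x)"
  unfolding imp_conv_disj by (intro dec1_disj dec1_not)

lemma dec1_le: assumes "rf1 f" "rf1 g" shows "dec1 (\<lambda>x. f x \<le> g x)"
proof -
  have "rf1 (\<lambda>x. 1 - (f x - g x))"
    by (intro rf1_diff rf1_const assms)
  moreover have "1 - (f x - g x) = of_bool (f x \<le> g x)" for x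
    by simp
  ultimately show ?thesis unfolding dec1_def by simp
qed

lemma dec1_less: "rf1 f \<Longrightarrow> rf1 g \<Longrightarrow> dec1 (\<lambda>x. f x < g x)"
  unfolding not_le[symmetric] by (intro dec1_not dec1_le)

lemma dec1_eq: "rf1 f \<Longrightarrow> rf1 g \<Longrightarrow> dec1 (\<lambda>x. f x = g x)"
  unfolding order_eq_iff by (intro dec1_conj dec1_le)

lemma dec1_comp: "dec1 A \<Longrightarrow> rf1 f \<Longrightarrow> dec1 (\<lambda>x. A (f x))"
  unfolding dec1_def by (rule rf1_comp)

lemma rf1_if: "dec1 A \<Longrightarrow> rf1 f \<Longrightarrow> rf1 g \<Longrightarrow> rf1 (\<lambda>x. if A x then f x else g x)"
proof -
  assume *: "dec1 A" "rf1 f" "rf1 g"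
  have "rf1 (\<lambda>x. of_bool (A x) * f x + of_bool (\<not> A x) * g x)"
    using * dec1_not[OF *(1)] unfolding dec1_def by (intro rf1_add rf1_mult)
  moreover have "of_bool (A x) * f x + of_bool (\<not> A x) * g x = (if A x then f x else g x)" for x
    by simp
  ultimately show "rf1 (\<lambda>x. if A x then f x else g x)" by simp
qed

lemma dec1_ex_less:
  assumes "rf1 n" "dec1 (\<lambda>x. A (pfst x) (psnd x))"
  shows "dec1 (\<lambda>x. \<exists>k<n x. A k x)"
proof -
  have "dec1 (\<lambda>x. 0 < (\<Sum>k<n x. of_bool (A k x) :: nat))"
    using assms(2) unfolding dec1_def[of "\<lambda>x. A (pfst x) (psnd x)"]
    by (intro dec1_less rf1_sum rf1_const assms)
  moreover have "0 < (\<Sum>k<m. of_bool (B k) :: nat) \<longleftrightarrow> (\<exists>k<m. B k)" for B and m :: nat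
    by (induction m) (auto simp: less_Suc_eq)
  ultimately show ?thesis by simp
qed

lemma dec1_all_less:
  assumes "rf1 n" "dec1 (\<lambda>x. A (pfst x) (psnd x))"
  shows "dec1 (\<lambda>x. \<forall>k<n x. A k x)"
  using dec1_not[OF dec1_ex_less[OF assms(1) dec1_not[OF assms(2)]]] by simp

lemmas rf1_intros = rf1_id rf1_const rf1_Suc rf1_add rf1_mult rf1_diff rf1_prod_encode rf1_pfst
  rf1_psnd rf1_sum rf1_if rf1_of_bool dec1_not dec1_conj dec1_disj dec1_imp dec1_le dec1_less dec1_eq
  dec1_ex_less dec1_all_less

section \<open>Powers and list codes\<close>

lemma rf1_power: assumes f: "rf1 f" shows "rf1 (\<lambda>x. 2 ^ f x)"
proof -
  have "rf1 (\<lambda>x. rec_nat 1 (\<lambda>k r. r + r) (f x))"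
    by (intro rf1_rec_nat rf1_intros f)
  moreover have "rec_nat (1::nat) (\<lambda>k r. r + r) m = 2 ^ m" for m
    by (induction m) auto
  ultimately show ?thesis by simp
qed

text \<open>A nonempty list has the code \<open>Suc (prod_encode (x, list_encode xs))\<close>, so
  \<open>psnd (r - 1)\<close> takes the tail. The code 0 of the empty list is a fixed point because
  \<open>psnd 0 = 0\<close>.\<close>

definition code_drop :: "nat \<Rightarrow> nat \<Rightarrow> nat" where
  "code_drop i c = rec_nat c (\<lambda>k r. psnd (r - 1)) i"

lemma psnd_0 [simp]: "psnd 0 = 0"
  using le_prod_encode_2[of "psnd 0" "pfst 0"] by simp

lemma code_drop_list_encode: "code_drop i (list_encode xs) = list_encode (drop i xs)"
proof (induction i)
  case (Suc i)
  show ?case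
  proof (cases "drop i xs")
    case Nil
    then show ?thesis using Suc by (simp add: code_drop_def)
  next
    case (Cons a as)
    then have "drop (Suc i) xs = as"
      by (metis drop_Suc list.sel(3) tl_drop)
    then show ?thesis using Suc Cons by (simp add: code_drop_def)
  qed
qed (simp add: code_drop_def)

lemma rf1_code_drop: "rf1 f \<Longrightarrow> rf1 g \<Longrightarrow> rf1 (\<lambda>x. code_drop (f x) (g x))"
  unfolding code_drop_def by (intro rf1_rec_nat rf1_intros)

lemma length_le_list_encode: "length xs \<le> list_encode xs"
proof (induction xs)
  case (Cons x xs)
  then show ?case using le_prod_encode_2[of "list_encode xs" x] by simp
qed simp

lemma list_encode_elem_less: "x \<in> set xs \<Longrightarrow> x < list_encode xs"
proof (induction xs)
  case (Cons y xs)
  then show ?case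
    using le_prod_encode_2[of "list_encode xs" y] le_prod_encode_1[of y "list_encode xs"]
    by auto
qed simp

lemma list_encode_eq_0_iff [simp]: "list_encode xs = 0 \<longleftrightarrow> xs = []"
  by (cases xs) auto

lemma code_drop_eq_0_iff: "code_drop i c = 0 \<longleftrightarrow> length (list_decode c) \<le> i"
  using code_drop_list_encode[of i "list_decode c"] by simp

definition code_nth :: "nat \<Rightarrow> nat \<Rightarrow> nat" where
  "code_nth c i = pfst (code_drop i c - 1)"

lemma code_nth: "i < length (list_decode c) \<Longrightarrow> code_nth c i = list_decode c ! i"
  using code_drop_list_encode[of i "list_decode c"]
  by (simp add: code_nth_def flip: Cons_nth_drop_Suc)

lemma rf1_code_nth: "rf1 f \<Longrightarrow> rf1 g \<Longrightarrow> rf1 (\<lambda>x. code_nth (f x) (g x))"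
  unfolding code_nth_def by (intro rf1_code_drop rf1_intros)

lemma rf1_code_length: assumes f: "rf1 f" shows "rf1 (\<lambda>x. length (list_decode (f x)))"
proof -
  \<comment> \<open>The length is the number of indices with a nonempty remainder; the code itself
    bounds these indices, since it is at least the length.\<close>
  have "rf1 (\<lambda>x. \<Sum>i<f x. of_bool (code_drop i (f x) \<noteq> 0) :: nat)"
    by (intro rf1_intros rf1_code_drop rf1_comp[OF f])
  moreover have "(\<Sum>i<c. of_bool (code_drop i c \<noteq> 0)) = length (list_decode c)" for c
  proof -
    have "{..<c} \<inter> {i. i < length (list_decode c)} = {..<length (list_decode c)}"
      using length_le_list_encode[of "list_decode c"] by auto
    then show ?thesis
      by (simp add: code_drop_eq_0_iff not_le Int_def)
  qed
  ultimately show ?thesis by simp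
qed

lemma dec1_code_mem: assumes "rf1 f" "rf1 g" shows "dec1 (\<lambda>x. f x \<in> set (list_decode (g x)))"
proof -
  have "dec1 (\<lambda>x. \<exists>i<length (list_decode (g x)). code_nth (g x) i = f x)"
    by (intro rf1_intros rf1_code_length rf1_code_nth assms rf1_comp[OF assms(1)]
        rf1_comp[OF assms(2)])
  moreover have "(\<exists>i<length (list_decode c). code_nth c i = y) \<longleftrightarrow> y \<in> set (list_decode c)" for c y
    by (auto simp: code_nth in_set_conv_nth)
  ultimately show ?thesis by simp
qed

section \<open>Computable maps and decidable predicates on coded objects\<close>

lemma computable_iff_rf1: "computable ca cb f \<longleftrightarrow> (\<exists>g. rf1 g \<and> (\<forall>x. g (ca x) = cb (f x)))"
proof
  assume "computable ca cb f"
  then obtain g where "recursive 1 g" "\<And>x. g [ca x] = cb (f x)"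
    unfolding computable_def by blast
  then show "\<exists>g. rf1 g \<and> (\<forall>x. g (ca x) = cb (f x))"
    unfolding rf1_iff by (intro exI[of _ "\<lambda>n. g [n]"]) auto
next
  assume "\<exists>g. rf1 g \<and> (\<forall>x. g (ca x) = cb (f x))"
  then show "computable ca cb f"
    unfolding computable_def rf1_iff by force
qed

lemma computable_ident: "computable ca ca (\<lambda>x. x)"
  unfolding computable_iff_rf1 using rf1_id by blast

lemma computable_const: "computable ca cb (\<lambda>_. c)"
  unfolding computable_iff_rf1 using rf1_const by blast

lemma computable_comp:
  "computable cb cc g \<Longrightarrow> computable ca cb f \<Longrightarrow> computable ca cc (\<lambda>x. g (f x))"
proof -
  assume "computable cb cc g" "computable ca cb f"
  then obtain g' f' where "rf1 g'" "\<And>x. g' (cb x) = cc (g x)" "rf1 f'" "\<And>x. f' (ca x) = cb (f x)"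
    unfolding computable_iff_rf1 by blast
  then show ?thesis
    unfolding computable_iff_rf1 by (intro exI[of _ "\<lambda>n. g' (f' n)"]) (simp add: rf1_comp)
qed

lemma computable_fst:
  assumes "computable ca (pair_code cb cc) f" shows "computable ca cb (\<lambda>x. fst (f x))"
proof -
  obtain g where g: "rf1 g" "\<And>x. g (ca x) = pair_code cb cc (f x)"
    using assms unfolding computable_iff_rf1 by blast
  have "rf1 (\<lambda>n. pfst (g n))"
    using g by (intro rf1_intros)
  moreover have "pfst (g (ca x)) = cb (fst (f x))" for x
    by (simp add: g pair_code_def)
  ultimately show ?thesis unfolding computable_iff_rf1 by fast
qed

lemma computable_snd:
  assumes "computable ca (pair_code cb cc) f" shows "computable ca cc (\<lambda>x. snd (f x))"
proof -
  obtain g where g: "rf1 g" "\<And>x. g (ca x) = pair_code cb cc (f x)"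
    using assms unfolding computable_iff_rf1 by blast
  have "rf1 (\<lambda>n. psnd (g n))"
    using g by (intro rf1_intros)
  moreover have "psnd (g (ca x)) = cc (snd (f x))" for x
    by (simp add: g pair_code_def)
  ultimately show ?thesis unfolding computable_iff_rf1 by fast
qed

lemma computable_Pair:
  assumes "computable ca cb f" "computable ca cc g"
  shows "computable ca (pair_code cb cc) (\<lambda>x. (f x, g x))"
proof -
  obtain f' g' where f': "rf1 f'" "\<And>x. f' (ca x) = cb (f x)" and g': "rf1 g'" "\<And>x. g' (ca x) = cc (g x)"
    using assms unfolding computable_iff_rf1 by blast
  have "rf1 (\<lambda>n. prod_encode (f' n, g' n))"
    using f' g' by (intro rf1_intros)
  moreover have "prod_encode (f' (ca x), g' (ca x)) = pair_code cb cc (f x, g x)" for x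
    by (simp add: f' g' pair_code_def)
  ultimately show ?thesis unfolding computable_iff_rf1 by fast
qed

lemma computable_rf1: "rf1 h \<Longrightarrow> computable ca id f \<Longrightarrow> computable ca id (\<lambda>x. h (f x))"
  by (rule computable_comp) (auto simp: computable_iff_rf1)

lemma computable_rf1_pair:
  assumes "rf1 (\<lambda>n. h (pfst n) (psnd n))" "computable ca id f" "computable ca id g"
  shows "computable ca id (\<lambda>x. h (f x) (g x))"
proof -
  have "computable (pair_code id id) id (\<lambda>p. h (fst p) (snd p))"
    unfolding computable_iff_rf1 using assms(1)
    by (intro exI[of _ "\<lambda>n. h (pfst n) (psnd n)"]) (simp add: pair_code_def)
  from computable_comp[OF this computable_Pair[OF assms(2,3)]] show ?thesis
    by simp
qed

lemma computable_Suc: "computable ca id f \<Longrightarrow> computable ca id (\<lambda>x. Suc (f x))"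
  by (rule computable_rf1) (intro rf1_intros)

lemma computable_power: "computable ca id f \<Longrightarrow> computable ca id (\<lambda>x. 2 ^ f x)"
  by (rule computable_rf1) (intro rf1_power rf1_intros)

lemma computable_mult: "computable ca id f \<Longrightarrow> computable ca id g \<Longrightarrow> computable ca id (\<lambda>x. f x * g x)"
  by (rule computable_rf1_pair[of "\<lambda>x y. x * y"]) (intro rf1_intros)

definition decidable :: "('a \<Rightarrow> nat) \<Rightarrow> ('a \<Rightarrow> bool) \<Rightarrow> bool" where
  "decidable ca A \<longleftrightarrow> (\<exists>B. dec1 B \<and> (\<forall>x. B (ca x) \<longleftrightarrow> A x))"

lemma computable_of_bool: "decidable ca A \<Longrightarrow> computable ca id (\<lambda>x. of_bool (A x))"
  unfolding decidable_def computable_iff_rf1 dec1_def by fastforce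

lemma decidable_not: "decidable ca A \<Longrightarrow> decidable ca (\<lambda>x. \<not> A x)"
  unfolding decidable_def using dec1_not by fast

lemma decidable_conj:
  assumes "decidable ca A" "decidable ca B" shows "decidable ca (\<lambda>x. A x \<and> B x)"
proof -
  obtain A' B' where "dec1 A'" "\<And>x. A' (ca x) \<longleftrightarrow> A x" "dec1 B'" "\<And>x. B' (ca x) \<longleftrightarrow> B x"
    using assms unfolding decidable_def by blast
  then show ?thesis unfolding decidable_def
    by (intro exI[of _ "\<lambda>n. A' n \<and> B' n"]) (simp add: dec1_conj)
qed

lemma decidable_disj: "decidable ca A \<Longrightarrow> decidable ca B \<Longrightarrow> decidable ca (\<lambda>x. A x \<or> B x)"
  unfolding disj_conv_conj_not by (intro decidable_not decidable_conj)

lemma decidable_imp: "decidable ca A \<Longrightarrow> decidable ca B \<Longrightarrow> decidable ca (\<lambda>x. A x \<longrightarrow> B x)"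
  unfolding imp_conv_disj by (intro decidable_not decidable_disj)

lemma decidable_dec1_pair:
  assumes "dec1 (\<lambda>n. h (pfst n) (psnd n))" "computable ca cb f" "computable ca cc g"
  shows "decidable ca (\<lambda>x. h (cb (f x)) (cc (g x)))"
proof -
  obtain f' g' where f': "rf1 f'" "\<And>x. f' (ca x) = cb (f x)" and g': "rf1 g'" "\<And>x. g' (ca x) = cc (g x)"
    using assms unfolding computable_iff_rf1 by blast
  have "dec1 (\<lambda>n. h (f' n) (g' n))"
    using dec1_comp[OF assms(1) rf1_prod_encode[OF f'(1) g'(1)]] by simp
  then show ?thesis
    unfolding decidable_def by (intro exI[of _ "\<lambda>n. h (f' n) (g' n)"]) (simp add: f' g')
qed

lemma decidable_le: "computable ca id f \<Longrightarrow> computable ca id g \<Longrightarrow> decidable ca (\<lambda>x. f x \<le> g x)"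
  using decidable_dec1_pair[of "(\<le>)" ca id f id g] dec1_le[OF rf1_pfst[OF rf1_id] rf1_psnd[OF rf1_id]]
  by simp

lemma decidable_less: "computable ca id f \<Longrightarrow> computable ca id g \<Longrightarrow> decidable ca (\<lambda>x. f x < g x)"
  using decidable_dec1_pair[of "(<)" ca id f id g] dec1_less[OF rf1_pfst[OF rf1_id] rf1_psnd[OF rf1_id]]
  by simp

lemma decidable_eq:
  assumes "inj cb" "computable ca cb f" "computable ca cb g" shows "decidable ca (\<lambda>x. f x = g x)"
  using decidable_dec1_pair[of "(=)", OF _ assms(2,3)]
  by (simp add: rf1_intros inj_eq[OF assms(1)])

lemma decidable_mem:
  assumes "inj cb" "computable ca cb f" "computable ca (list_code cb) g"
  shows "decidable ca (\<lambda>x. f x \<in> set (g x))"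
  using decidable_dec1_pair[of "\<lambda>m c. m \<in> set (list_decode c)", OF _ assms(2,3)]
  by (simp add: rf1_intros dec1_code_mem list_code_def inj_image_mem_iff[OF assms(1)])

lemma computable_length:
  assumes "computable ca (list_code cb) g" shows "computable ca id (\<lambda>x. length (g x))"
proof -
  have "computable (list_code cb) id length"
    unfolding computable_iff_rf1 using rf1_code_length[OF rf1_id]
    by (intro exI[of _ "\<lambda>c. length (list_decode c)"]) (simp add: list_code_def)
  then show ?thesis using assms by (rule computable_comp)
qed

text \<open>Bounded searches and enumerations run over all numbers, so numbers that code nothing
  must be recognised and skipped; hence the decidable range.\<close>

definition effective_code :: "('a \<Rightarrow> nat) \<Rightarrow> bool" where
  "effective_code ca \<longleftrightarrow> inj ca \<and> dec1 (\<lambda>n. n \<in> range ca)"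

lemma effective_code_inj: "effective_code ca \<Longrightarrow> inj ca"
  by (simp add: effective_code_def)

lemma effective_code_range: "effective_code ca \<Longrightarrow> rf1 f \<Longrightarrow> dec1 (\<lambda>x. f x \<in> range ca)"
  unfolding effective_code_def using dec1_comp by blast

lemma effective_code_id: "effective_code id"
  unfolding effective_code_def by (simp add: dec1_def rf1_const)

lemma effective_code_pair:
  assumes "effective_code ca" "effective_code cb" shows "effective_code (pair_code ca cb)"
proof -
  have "inj (pair_code ca cb)"
    using assms unfolding effective_code_def pair_code_def
    by (auto intro!: injI simp: inj_eq prod_eq_iff)
  moreover have "n \<in> range (pair_code ca cb) \<longleftrightarrow> pfst n \<in> range ca \<and> psnd n \<in> range cb" for n
  proof
    assume "pfst n \<in> range ca \<and> psnd n \<in> range cb"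
    then obtain x y where "pfst n = ca x" "psnd n = cb y" by blast
    then have "n = pair_code ca cb (x, y)"
      by (metis fst_conv snd_conv pair_code_def prod.collapse prod_decode_inverse)
    then show "n \<in> range (pair_code ca cb)" by blast
  qed (auto simp: pair_code_def)
  moreover have "dec1 (\<lambda>n. pfst n \<in> range ca \<and> psnd n \<in> range cb)"
    by (intro rf1_intros effective_code_range assms)
  ultimately show ?thesis by (simp add: effective_code_def)
qed

lemma effective_code_list:
  assumes "effective_code ca" shows "effective_code (list_code ca)"
proof -
  have "inj (list_code ca)"
    using assms unfolding effective_code_def list_code_def
    by (auto intro!: injI simp: list_encode_eq inj_map_eq_map)
  \<comment> \<open>Entries of a list are smaller than its code, so the condition on all entries is
    a bounded quantification.\<close>
  moreover have "n \<in> range (list_code ca) \<longleftrightarrow> (\<forall>m<n. m \<in> set (list_decode n) \<longrightarrow> m \<in> range ca)" for n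
  proof
    assume "\<forall>m<n. m \<in> set (list_decode n) \<longrightarrow> m \<in> range ca"
    then have "set (list_decode n) \<subseteq> range ca"
      using list_encode_elem_less[of _ "list_decode n"] by auto
    then obtain xs where "list_decode n = map ca xs"
      by (metis ex_map_conv subsetD rangeE)
    then have "n = list_code ca xs"
      by (metis list_code_def list_decode_inverse)
    then show "n \<in> range (list_code ca)" by blast
  qed (auto simp: list_code_def)
  moreover have "dec1 (\<lambda>n. \<forall>m<n. m \<in> set (list_decode n) \<longrightarrow> m \<in> range ca)"
    by (intro rf1_intros dec1_code_mem effective_code_range assms)
  ultimately show ?thesis by (simp add: effective_code_def)
qed

lemma effective_code_of_bool: "effective_code (of_bool :: bool \<Rightarrow> nat)"
proof -
  have "range (of_bool :: bool \<Rightarrow> nat) = {0, 1}"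
    by (auto simp: image_iff)
  moreover have "dec1 (\<lambda>n. n = 0 \<or> n = 1)"
    by (intro rf1_intros)
  ultimately show ?thesis
    unfolding effective_code_def by (auto simp: inj_def)
qed

lemma effective_code_string: "effective_code string_code"
  unfolding string_code_def by (intro effective_code_list effective_code_of_bool)

lemma inj_string_code: "inj string_code"
  using effective_code_string by (simp add: effective_code_def)

lemma finite_code_le: "effective_code cb \<Longrightarrow> finite {y. cb y \<le> n}"
  using finite_vimageI[of "{..n}" cb] by (simp add: effective_code_def vimage_def)

text \<open>A bound on the code leaves finitely many objects. Bounded existential quantifiers,
  quantifiers over the entries of a list, sums over such entries and sums over the strings of a
  given length all reduce to this one sum.\<close>

lemma computable_sum_le:
  assumes cb: "effective_code cb" and "computable ca id b"
    and "computable (pair_code cb ca) id (\<lambda>p. f (fst p) (snd p))"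
  shows "computable ca id (\<lambda>x. \<Sum>y | cb y \<le> b x. f y x)"
proof -
  obtain b' where b': "rf1 b'" "\<And>x. b' (ca x) = b x"
    using assms unfolding computable_iff_rf1 by auto
  obtain f' where f': "rf1 f'" "\<And>y x. f' (prod_encode (cb y, ca x)) = f y x"
    using assms(3) unfolding computable_iff_rf1 by (auto simp: pair_code_def)
  have "rf1 (\<lambda>n. \<Sum>m<Suc (b' n). if m \<in> range cb then f' (prod_encode (m, n)) else 0)"
    by (intro rf1_intros effective_code_range cb rf1_comp[OF f'(1)] b'(1))
  moreover have "(\<Sum>m<Suc (b' (ca x)). if m \<in> range cb then f' (prod_encode (m, ca x)) else 0)
      = (\<Sum>y | cb y \<le> b x. f y x)" for x
  proof -
    have "{..<Suc (b x)} \<inter> {m. m \<in> range cb} = cb ` {y. cb y \<le> b x}"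
      by auto
    then have "(\<Sum>m<Suc (b x). if m \<in> range cb then f' (prod_encode (m, ca x)) else 0)
        = (\<Sum>m\<in>cb ` {y. cb y \<le> b x}. f' (prod_encode (m, ca x)))"
      by (subst sum.inter_filter[symmetric]) (auto intro: sum.cong)
    also have "\<dots> = (\<Sum>y | cb y \<le> b x. f y x)"
      using cb by (subst sum.reindex) (auto simp: effective_code_def f' intro: inj_on_subset)
    finally show ?thesis by (simp add: b')
  qed
  ultimately show ?thesis unfolding computable_iff_rf1 id_def by fast
qed

lemma decidable_ex_le:
  assumes "effective_code cb" "computable ca id b" "decidable (pair_code cb ca) (\<lambda>p. A (fst p) (snd p))"
  shows "decidable ca (\<lambda>x. \<exists>y. cb y \<le> b x \<and> A y x)"
proof -
  have "decidable ca (\<lambda>x. 0 < (\<Sum>y | cb y \<le> b x. of_bool (A y x) :: nat))"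
    by (intro decidable_less computable_const computable_sum_le computable_of_bool assms)
  moreover have "0 < (\<Sum>y | cb y \<le> b x. of_bool (A y x) :: nat) \<longleftrightarrow> (\<exists>y. cb y \<le> b x \<and> A y x)" for x
    using finite_code_le[OF assms(1)] by (auto simp: sum_eq_0_iff simp flip: neq0_conv simp del: sum_of_bool_eq)
  ultimately show ?thesis by simp
qed

lemma list_code_elem_le: "x \<in> set xs \<Longrightarrow> ca x \<le> list_code ca xs"
  unfolding list_code_def by (intro less_imp_le list_encode_elem_less) simp

lemma computable_list_code: "computable ca cb f \<Longrightarrow> computable ca id (\<lambda>x. cb (f x))"
  unfolding computable_iff_rf1 by simp

lemma decidable_bex:
  assumes cb: "effective_code cb" and g: "computable ca (list_code cb) g"
    and A: "decidable (pair_code cb ca) (\<lambda>p. A (fst p) (snd p))"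
  shows "decidable ca (\<lambda>x. \<exists>y\<in>set (g x). A y x)"
proof -
  have "decidable ca (\<lambda>x. \<exists>y. cb y \<le> list_code cb (g x) \<and> (y \<in> set (g x) \<and> A y x))"
    by (intro decidable_ex_le decidable_conj decidable_mem[of cb] A cb effective_code_inj
      computable_list_code[OF g] computable_comp[OF g] computable_fst computable_snd)
      (rule computable_ident)+
  moreover have "(\<exists>y. cb y \<le> list_code cb (g x) \<and> (y \<in> set (g x) \<and> A y x)) \<longleftrightarrow> (\<exists>y\<in>set (g x). A y x)" for x
    using list_code_elem_le[of _ "g x" cb] by blast
  ultimately show ?thesis by simp
qed

lemma decidable_ball:
  assumes "effective_code cb" "computable ca (list_code cb) g"
    and "decidable (pair_code cb ca) (\<lambda>p. A (fst p) (snd p))"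
  shows "decidable ca (\<lambda>x. \<forall>y\<in>set (g x). A y x)"
  using decidable_not[OF decidable_bex[OF assms(1,2) decidable_not[OF assms(3)]]] by simp

lemma computable_sum_set:
  assumes cb: "effective_code cb" and g: "computable ca (list_code cb) g"
    and f: "computable (pair_code cb ca) id (\<lambda>p. f (fst p) (snd p))"
  shows "computable ca id (\<lambda>x. \<Sum>y\<in>set (g x). f y x)"
proof -
  have "computable ca id (\<lambda>x. \<Sum>y | cb y \<le> list_code cb (g x). of_bool (y \<in> set (g x)) * f y x)"
    by (intro computable_sum_le computable_mult computable_of_bool decidable_mem[of cb] f cb
      effective_code_inj computable_list_code[OF g] computable_comp[OF g] computable_fst computable_snd)
      (rule computable_ident)+
  moreover have "(\<Sum>y | cb y \<le> list_code cb (g x). of_bool (y \<in> set (g x)) * f y x) = (\<Sum>y\<in>set (g x). f y x)" for x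
    using finite_code_le[OF cb] list_code_elem_le[of _ "g x" cb]
    by (intro sum.mono_neutral_cong_right) auto
  ultimately show ?thesis by simp
qed

text \<open>\<open>prod_encode\<close> is monotone in both arguments, so among the strings of a
  given length the one consisting of \<open>True\<close> only has the largest code. This turns
  quantification over a length into quantification below a computable bound.\<close>

lemma string_code_le: "length y = n \<Longrightarrow> string_code y \<le> list_encode (replicate n 1)"
proof (induction y arbitrary: n)
  case (Cons a y)
  then show ?case
    by (auto simp: string_code_def list_code_def intro!: prod_encode_mono)
qed (simp add: string_code_def list_code_def)

lemma computable_string_bound:
  assumes n: "computable ca id n" shows "computable ca id (\<lambda>x. list_encode (replicate (n x) 1))"
proof -
  have "rf1 (\<lambda>n. rec_nat 0 (\<lambda>k r. Suc (prod_encode (1, r))) n)"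
    by (intro rf1_rec_nat rf1_intros)
  moreover have "rec_nat 0 (\<lambda>k r. Suc (prod_encode (1, r))) m = list_encode (replicate m 1)" for m
    by (induction m) auto
  ultimately have "rf1 (\<lambda>n. list_encode (replicate n 1))"
    by simp
  then show ?thesis using n by (rule computable_rf1)
qed

lemma finite_strings: "finite {y :: bool list. length y = n}"
  using finite_lists_length_eq[of "UNIV :: bool set" n] by simp

lemma computable_sum_strings:
  assumes n: "computable ca id n" and f: "computable (pair_code string_code ca) id (\<lambda>p. f (fst p) (snd p))"
  shows "computable ca id (\<lambda>x. \<Sum>y | length y = n x. f y x)"
proof -
  have "computable ca id (\<lambda>x. \<Sum>y | string_code y \<le> list_encode (replicate (n x) 1). of_bool (length y = n x) * f y x)"
    by (intro computable_sum_le effective_code_string computable_mult computable_of_bool f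
        computable_string_bound[OF n] decidable_eq[of id] computable_length[of _ of_bool, folded string_code_def]
        computable_comp[OF n] computable_fst computable_snd inj_on_id)
      (rule computable_ident)+
  moreover have "(\<Sum>y | string_code y \<le> list_encode (replicate m 1). of_bool (length y = m) * f y x)
      = (\<Sum>y | length y = m. f y x)" for x m
    using finite_code_le[OF effective_code_string] string_code_le
    by (intro sum.mono_neutral_cong_right) auto
  ultimately show ?thesis by simp
qed

text \<open>One list is a prefix of the other; for binary strings, the two cylinders meet.\<close>

definition compatible :: "'a list \<Rightarrow> 'a list \<Rightarrow> bool" where
  "compatible x y \<longleftrightarrow> (\<forall>i<min (length x) (length y). x ! i = y ! i)"

lemma decidable_compatible:
  assumes "computable ca string_code f" "computable ca string_code g"
  shows "decidable ca (\<lambda>x. compatible (f x) (g x))"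
proof -
  let ?L = "\<lambda>c. length (list_decode c)"
  have "dec1 (\<lambda>n. \<forall>i<?L (pfst n). i < ?L (psnd n) \<longrightarrow> code_nth (pfst n) i = code_nth (psnd n) i)"
    by (intro rf1_intros rf1_code_length rf1_code_nth)
  from decidable_dec1_pair[of "\<lambda>c d. \<forall>i<?L c. i < ?L d \<longrightarrow> code_nth c i = code_nth d i", OF this assms]
  have "decidable ca (\<lambda>x. \<forall>i<?L (string_code (f x)). i < ?L (string_code (g x))
      \<longrightarrow> code_nth (string_code (f x)) i = code_nth (string_code (g x)) i)" .
  moreover have "(\<forall>i<?L (string_code y). i < ?L (string_code z)
      \<longrightarrow> code_nth (string_code y) i = code_nth (string_code z) i) \<longleftrightarrow> compatible y z" for y z
    by (auto simp: string_code_def list_code_def code_nth compatible_def)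
  ultimately show ?thesis by simp
qed

text \<open>The projection form is preferred to enumerations because logical operations act directly
  on the witness k; \<open>semidecidable_mem\<close> and \<open>comp_enumerableI\<close> translate
  from and to enumerations.\<close>

definition semidecidable :: "('a \<Rightarrow> nat) \<Rightarrow> ('a \<Rightarrow> bool) \<Rightarrow> bool" where
  "semidecidable ca A \<longleftrightarrow>
    (\<exists>B. dec1 (\<lambda>n. B (pfst n) (psnd n)) \<and> (\<forall>x. A x \<longleftrightarrow> (\<exists>k. B (ca x) k)))"

lemma decidable_imp_semidecidable: "decidable ca A \<Longrightarrow> semidecidable ca A"
proof -
  assume "decidable ca A"
  then obtain B where "dec1 B" "\<And>x. B (ca x) \<longleftrightarrow> A x"
    unfolding decidable_def by blast
  then show ?thesis
    using dec1_comp[OF _ rf1_pfst[OF rf1_id]] unfolding semidecidable_def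
    by (intro exI[of _ "\<lambda>c k. B c"]) simp
qed

lemma semidecidable_conj:
  assumes "semidecidable ca A" "semidecidable ca B" shows "semidecidable ca (\<lambda>x. A x \<and> B x)"
proof -
  obtain A' B' where A': "dec1 (\<lambda>n. A' (pfst n) (psnd n))" "\<And>x. A x \<longleftrightarrow> (\<exists>k. A' (ca x) k)"
    and B': "dec1 (\<lambda>n. B' (pfst n) (psnd n))" "\<And>x. B x \<longleftrightarrow> (\<exists>k. B' (ca x) k)"
    using assms unfolding semidecidable_def by blast
  define C where "C c k \<longleftrightarrow> A' c (pfst k) \<and> B' c (psnd k)" for c k
  have "dec1 (\<lambda>n. C (pfst n) (psnd n))"
    unfolding C_def
    using dec1_comp[OF A'(1), of "\<lambda>n. prod_encode (pfst n, pfst (psnd n))"]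
      dec1_comp[OF B'(1), of "\<lambda>n. prod_encode (pfst n, psnd (psnd n))"]
    by (intro dec1_conj) (simp_all add: rf1_intros)
  moreover have "A x \<and> B x \<longleftrightarrow> (\<exists>k. C (ca x) k)" for x
  proof
    assume "A x \<and> B x"
    then obtain k l where "A' (ca x) k" "B' (ca x) l"
      unfolding A' B' by blast
    then have "C (ca x) (prod_encode (k, l))"
      by (simp add: C_def)
    then show "\<exists>k. C (ca x) k" ..
  qed (auto simp: C_def A' B')
  ultimately show ?thesis unfolding semidecidable_def by blast
qed

lemma semidecidable_disj:
  assumes "semidecidable ca A" "semidecidable ca B" shows "semidecidable ca (\<lambda>x. A x \<or> B x)"
proof -
  obtain A' B' where A': "dec1 (\<lambda>n. A' (pfst n) (psnd n))" "\<And>x. A x \<longleftrightarrow> (\<exists>k. A' (ca x) k)"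
    and B': "dec1 (\<lambda>n. B' (pfst n) (psnd n))" "\<And>x. B x \<longleftrightarrow> (\<exists>k. B' (ca x) k)"
    using assms unfolding semidecidable_def by blast
  have "dec1 (\<lambda>n. A' (pfst n) (psnd n) \<or> B' (pfst n) (psnd n))"
    by (intro dec1_disj A' B')
  then show ?thesis unfolding semidecidable_def
    by (intro exI[of _ "\<lambda>c k. A' c k \<or> B' c k"]) (auto simp: A' B')
qed

lemma semidecidable_ex:
  assumes cb: "effective_code cb" and "semidecidable (pair_code cb ca) (\<lambda>p. A (fst p) (snd p))"
  shows "semidecidable ca (\<lambda>x. \<exists>y. A y x)"
proof -
  obtain B where B: "dec1 (\<lambda>n. B (pfst n) (psnd n))"
    "\<And>y x. A y x \<longleftrightarrow> (\<exists>k. B (prod_encode (cb y, ca x)) k)"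
    using assms(2) unfolding semidecidable_def by (auto simp: pair_code_def)
  define C where "C c k \<longleftrightarrow> pfst k \<in> range cb \<and> B (prod_encode (pfst k, c)) (psnd k)" for c k
  have "dec1 (\<lambda>n. B (prod_encode (pfst (psnd n), pfst n)) (psnd (psnd n)))"
    using dec1_comp[OF B(1), of "\<lambda>n. prod_encode (prod_encode (pfst (psnd n), pfst n), psnd (psnd n))"]
    by (simp add: rf1_intros)
  then have "dec1 (\<lambda>n. C (pfst n) (psnd n))"
    unfolding C_def by (intro rf1_intros effective_code_range cb)
  moreover have "(\<exists>y. A y x) \<longleftrightarrow> (\<exists>k. C (ca x) k)" for x
  proof
    assume "\<exists>y. A y x"
    then obtain y k where "B (prod_encode (cb y, ca x)) k"
      unfolding B by blast
    then have "C (ca x) (prod_encode (cb y, k))"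
      by (simp add: C_def)
    then show "\<exists>k. C (ca x) k" ..
  next
    assume "\<exists>k. C (ca x) k"
    then show "\<exists>y. A y x"
      unfolding C_def B by auto blast
  qed
  ultimately show ?thesis unfolding semidecidable_def by blast
qed

lemma finite_collection:
  assumes "finite S" "\<And>s. s \<in> S \<Longrightarrow> \<exists>k::nat. B s k"
  shows "\<exists>K. \<forall>s\<in>S. \<exists>k<K. B s k"
proof -
  obtain k where "\<And>s. s \<in> S \<Longrightarrow> B s (k s)"
    using assms(2) by metis
  moreover have "k s < Suc (Max (k ` S))" if "s \<in> S" for s
    using assms(1) that by (simp add: less_Suc_eq_le)
  ultimately show ?thesis by blast
qed

text \<open>Finitely many instances have witnesses below a common K. Searching for K leaves only
  bounded quantifiers in the matrix.\<close>

lemma semidecidable_all_le: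
  assumes cb: "effective_code cb" and b: "computable ca id b"
    and "semidecidable (pair_code cb ca) (\<lambda>p. A (fst p) (snd p))"
  shows "semidecidable ca (\<lambda>x. \<forall>y. cb y \<le> b x \<longrightarrow> A y x)"
proof -
  obtain B where B: "dec1 (\<lambda>n. B (pfst n) (psnd n))"
    "\<And>y x. A y x \<longleftrightarrow> (\<exists>k. B (prod_encode (cb y, ca x)) k)"
    using assms(3) unfolding semidecidable_def by (auto simp: pair_code_def)
  obtain b' where b': "rf1 b'" "\<And>x. b' (ca x) = b x"
    using b unfolding computable_iff_rf1 by auto
  define C where "C c K \<longleftrightarrow>
    (\<forall>m<Suc (b' c). m \<in> range cb \<longrightarrow> (\<exists>k<K. B (prod_encode (m, c)) k))" for c K
  have "dec1 (\<lambda>n. B (prod_encode (pfst (psnd n), pfst (psnd (psnd n)))) (pfst n))"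
    using dec1_comp[OF B(1), of "\<lambda>n. prod_encode (prod_encode (pfst (psnd n), pfst (psnd (psnd n))), pfst n)"]
    by (simp add: rf1_intros)
  then have "dec1 (\<lambda>n. C (pfst n) (psnd n))"
    unfolding C_def by (intro rf1_intros effective_code_range cb rf1_comp[OF b'(1)])
  moreover have "(\<forall>y. cb y \<le> b x \<longrightarrow> A y x) \<longleftrightarrow> (\<exists>K. C (ca x) K)" for x
  proof
    assume "\<forall>y. cb y \<le> b x \<longrightarrow> A y x"
    then have "\<exists>K. \<forall>y\<in>{y. cb y \<le> b x}. \<exists>k<K. B (prod_encode (cb y, ca x)) k"
      by (intro finite_collection finite_code_le[OF cb]) (simp add: B)
    then show "\<exists>K. C (ca x) K"
      by (auto simp: C_def b' less_Suc_eq_le)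
  next
    assume "\<exists>K. C (ca x) K"
    then show "\<forall>y. cb y \<le> b x \<longrightarrow> A y x"
      unfolding C_def B b' less_Suc_eq_le by blast
  qed
  ultimately show ?thesis unfolding semidecidable_def by blast
qed

lemma semidecidable_all_strings:
  assumes n: "computable ca id n" and A: "semidecidable (pair_code string_code ca) (\<lambda>p. A (fst p) (snd p))"
  shows "semidecidable ca (\<lambda>x. \<forall>y. length y = n x \<longrightarrow> A y x)"
proof -
  have "semidecidable ca (\<lambda>x. \<forall>y. string_code y \<le> list_encode (replicate (n x) 1) \<longrightarrow> length y \<noteq> n x \<or> A y x)"
    by (intro semidecidable_all_le effective_code_string semidecidable_disj A
        computable_string_bound[OF n] decidable_imp_semidecidable decidable_not decidable_eq[of id]
        computable_length[of _ of_bool, folded string_code_def]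
        computable_comp[OF n] computable_fst computable_snd inj_on_id)
      (rule computable_ident)+
  moreover have "(\<forall>y. string_code y \<le> list_encode (replicate m 1) \<longrightarrow> length y \<noteq> m \<or> A y x)
      \<longleftrightarrow> (\<forall>y. length y = m \<longrightarrow> A y x)" for x m
    using string_code_le by blast
  ultimately show ?thesis by simp
qed

lemma semidecidable_mem:
  assumes "inj cb" "comp_enumerable cb A" "computable ca cb f"
  shows "semidecidable ca (\<lambda>x. f x \<in> A)"
proof (cases "A = {}")
  case True
  then show ?thesis
    by (intro decidable_imp_semidecidable) (auto simp: decidable_def dec1_def intro!: exI[of _ "\<lambda>_. False"] rf1_const)
next
  case False
  then obtain g where g: "rf1 g" "cb ` A = range g"
    using assms(2) unfolding comp_enumerable_def rf1_iff by force
  obtain f' where f': "rf1 f'" "\<And>x. f' (ca x) = cb (f x)"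
    using assms(3) unfolding computable_iff_rf1 by blast
  have "dec1 (\<lambda>n. g (psnd n) = f' (pfst n))"
    by (intro rf1_intros rf1_comp[OF g(1)] rf1_comp[OF f'(1)])
  moreover have "f x \<in> A \<longleftrightarrow> (\<exists>k. g k = f' (ca x))" for x
    using inj_image_mem_iff[OF assms(1), of "f x" A] unfolding g(2) f' by (metis rangeE rangeI)
  ultimately show ?thesis unfolding semidecidable_def
    by (intro exI[of _ "\<lambda>c k. g k = f' c"]) blast
qed

lemma comp_enumerableI:
  assumes ca: "effective_code ca" and A: "semidecidable ca (\<lambda>x. x \<in> A)"
  shows "comp_enumerable ca A"
proof (cases "A = {}")
  case False
  then obtain a where a: "a \<in> A" by blast
  obtain B where B: "dec1 (\<lambda>n. B (pfst n) (psnd n))" "\<And>x. x \<in> A \<longleftrightarrow> (\<exists>k. B (ca x) k)"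
    using A unfolding semidecidable_def by blast
  \<comment> \<open>Pairs of a candidate code and a witness are dovetailed; a pair that fails falls
    back on a fixed element, because the enumerating function has to be total.\<close>
  define g where "g n = (if pfst n \<in> range ca \<and> B (pfst n) (psnd n) then pfst n else ca a)" for n
  have "rf1 g"
    unfolding g_def by (intro rf1_intros effective_code_range ca B)
  moreover have "ca ` A = range g"
  proof
    show "ca ` A \<subseteq> range g"
    proof
      fix n assume "n \<in> ca ` A"
      then obtain x k where "n = ca x" "B (ca x) k" using B(2) by blast
      then have "g (prod_encode (n, k)) = n" by (simp add: g_def)
      then show "n \<in> range g" by (metis rangeI)
    qed
    show "range g \<subseteq> ca ` A"
    proof
      fix m assume "m \<in> range g"
      then obtain n where m: "m = g n" ..
      show "m \<in> ca ` A"
      proof (cases "pfst n \<in> range ca \<and> B (pfst n) (psnd n)")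
        case True
        then obtain x where "pfst n = ca x" "B (ca x) (psnd n)" by auto
        then have "x \<in> A" using B(2) by blast
        then show ?thesis using True \<open>pfst n = ca x\<close> by (simp add: m g_def)
      next
        case False
        then show ?thesis using a by (simp only: m g_def if_False imageI)
      qed
    qed
  qed
  ultimately show ?thesis unfolding comp_enumerable_def rf1_iff by force
qed (simp add: comp_enumerable_def)

section \<open>Codes of rational numbers\<close>

lemma int_encode_eqs: "int_encode (int n) = 2 * n" "int_encode (- int (Suc n)) = Suc (2 * n)"
  by (simp_all add: int_encode_def sum_encode_def)

lemma rf1_div2: assumes f: "rf1 f" shows "rf1 (\<lambda>x. f x div 2)"
proof -
  have "rf1 (\<lambda>x. \<Sum>k<x. of_bool (2 * Suc k \<le> x) :: nat)"
    by (intro rf1_intros)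
  moreover have "(\<Sum>k<x. of_bool (2 * Suc k \<le> x)) = x div 2" for x :: nat
  proof -
    have "{..<x} \<inter> {k. 2 * Suc k \<le> x} = {..<x div 2}" by auto
    then show ?thesis by (simp del: mult_Suc_right)
  qed
  ultimately show ?thesis using rf1_comp[OF _ f] by simp
qed

lemma dec1_even: assumes f: "rf1 f" shows "dec1 (\<lambda>x. even (f x))"
proof -
  have "dec1 (\<lambda>x. 2 * (f x div 2) = f x)"
    by (intro rf1_intros rf1_div2 f)
  moreover have "2 * (n div 2) = n \<longleftrightarrow> even n" for n :: nat
    by presburger
  ultimately show ?thesis by simp
qed

text \<open>The second number is kept positive so that its divisors are bounded and the test is a
  bounded search.\<close>

lemma dec1_coprime: assumes "rf1 f" "rf1 g" shows "dec1 (\<lambda>x. coprime (f x) (Suc (g x)))"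
proof -
  have dvd: "dec1 (\<lambda>x. F x dvd (G x :: nat))" if "rf1 F" "rf1 G" for F G
  proof -
    have "dec1 (\<lambda>x. \<exists>k<Suc (G x). G x = F x * k)"
      by (intro rf1_intros rf1_comp[OF that(1)] rf1_comp[OF that(2)])
    moreover have "(\<exists>k<Suc b. b = a * k) \<longleftrightarrow> a dvd b" for a b :: nat
    proof
      assume "a dvd b"
      then obtain k where k: "b = a * k" ..
      show "\<exists>k<Suc b. b = a * k"
      proof (cases "a = 0")
        case False
        then have "k \<le> b" using k by (cases a) auto
        then show ?thesis using k less_Suc_eq_le by blast
      qed (use k in auto)
    qed auto
    ultimately show ?thesis by simp
  qed
  have "dec1 (\<lambda>x. \<forall>d<Suc (Suc (g x)). d dvd f x \<and> d dvd Suc (g x) \<longrightarrow> d = 1)"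
    by (intro rf1_intros dvd rf1_comp[OF assms(1)] rf1_comp[OF assms(2)])
  moreover have "(\<forall>d<Suc (Suc b). d dvd a \<and> d dvd Suc b \<longrightarrow> d = 1) \<longleftrightarrow> coprime a (Suc b)" for a b
  proof
    assume *: "\<forall>d<Suc (Suc b). d dvd a \<and> d dvd Suc b \<longrightarrow> d = 1"
    show "coprime a (Suc b)"
      by (rule coprimeI) (metis * dvd_imp_le is_unit_gcd_iff less_Suc_eq_le nat_dvd_1_iff_1 zero_less_Suc)
  qed (auto dest: coprime_common_divisor_nat)
  ultimately show ?thesis by simp
qed

text \<open>\<open>int_encode\<close> sends n to 2n and -n-1 to 2n+1, so \<open>Suc c div 2\<close>
  is the absolute value of the integer coded by c. An even nonzero code is that of a positive
  denominator, and the remaining condition says that the fraction is in lowest terms.\<close>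

lemma rat_code_range:
  "n \<in> range rat_code \<longleftrightarrow> even (psnd n) \<and> 0 < psnd n \<and>
     coprime (Suc (pfst n) div 2) (Suc (psnd n div 2 - 1))"
proof -
  define a where "a = int_decode (pfst n)"
  define b where "b = int_decode (psnd n)"
  have n: "n = prod_encode (int_encode a, int_encode b)"
    by (simp add: a_def b_def)
  have enc_a: "Suc (int_encode a) div 2 = nat \<bar>a\<bar>"
    by (cases "0 \<le> a") (auto simp: int_encode_def sum_encode_def Suc_nat_eq_nat_zadd1)
  have "n \<in> range rat_code \<longleftrightarrow> b > 0 \<and> coprime a b"
  proof
    assume "n \<in> range rat_code"
    then obtain r where "(a, b) = quotient_of r"
      by (auto simp: rat_code_def pair_code_def n int_encode_eq prod_eq_iff)
    then show "b > 0 \<and> coprime a b"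
      by (metis quotient_of_coprime quotient_of_denom_pos)
  next
    assume "b > 0 \<and> coprime a b"
    then have "n = rat_code (Fract a b)"
      by (simp add: rat_code_def pair_code_def n quotient_of_Fract)
    then show "n \<in> range rat_code" by blast
  qed
  also have "\<dots> \<longleftrightarrow> even (int_encode b) \<and> 0 < int_encode b \<and>
      coprime (Suc (int_encode a) div 2) (Suc (int_encode b div 2 - 1))"
  proof (cases "b > 0")
    case True
    then have "int_encode b = 2 * nat b" using int_encode_eqs(1)[of "nat b"] by simp
    moreover have "coprime (nat \<bar>a\<bar>) (nat b) \<longleftrightarrow> coprime a b"
      using True by (simp flip: coprime_int_iff)
    ultimately show ?thesis using True enc_a by simp
  next
    case False
    then show ?thesis by (auto simp: int_encode_def sum_encode_def)
  qed
  finally show ?thesis by (simp add: n)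
qed

lemma effective_code_rat: "effective_code rat_code"
proof -
  have "inj rat_code"
    by (auto intro!: injI simp: rat_code_def pair_code_def int_encode_eq prod_eq_iff
        dest!: quotient_of_inject[OF prod_eqI])
  moreover have "dec1 (\<lambda>n. n \<in> range rat_code)"
    unfolding rat_code_range by (intro rf1_intros dec1_coprime rf1_div2 dec1_even)
  ultimately show ?thesis by (simp add: effective_code_def)
qed

text \<open>Negative numerators become 0, which is harmless for lower bounds on
  probabilities.\<close>

definition rat_num :: "rat \<Rightarrow> nat" where "rat_num r = nat (fst (quotient_of r))"
definition rat_den :: "rat \<Rightarrow> nat" where "rat_den r = nat (snd (quotient_of r))"

lemma computable_rat_num:
  assumes f: "computable ca rat_code f" shows "computable ca id (\<lambda>x. rat_num (f x))"
proof -
  have "rf1 (\<lambda>n. if even (pfst n) then pfst n div 2 else 0)"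
    by (intro rf1_intros dec1_even rf1_div2)
  moreover have "(if even (pfst (rat_code r)) then pfst (rat_code r) div 2 else 0) = rat_num r" for r
    by (simp add: rat_code_def pair_code_def rat_num_def int_encode_def sum_encode_def)
  ultimately have "computable rat_code id rat_num"
    unfolding computable_iff_rf1 id_def by fast
  then show ?thesis using f by (rule computable_comp)
qed

lemma computable_rat_den:
  assumes f: "computable ca rat_code f" shows "computable ca id (\<lambda>x. rat_den (f x))"
proof -
  have "rf1 (\<lambda>n. psnd n div 2)"
    by (intro rf1_intros rf1_div2)
  moreover have "psnd (rat_code r) div 2 = rat_den r" for r
    using quotient_of_denom_pos'[of r]
    by (simp add: rat_code_def pair_code_def rat_den_def int_encode_def sum_encode_def)
  ultimately have "computable rat_code id rat_den"
    unfolding computable_iff_rf1 id_def by fast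
  then show ?thesis using f by (rule computable_comp)
qed

section \<open>Cantor space and measurable selections\<close>

text \<open>Second countability of the factor identifies the product sigma-algebra on Cantor space
  with its Borel sets.\<close>

instance bool :: second_countable_topology
proof
  show "\<exists>B :: bool set set. countable B \<and> open = generate_topology B"
    by (intro exI[of _ "range lessThan \<union> range greaterThan"]) (auto simp: open_bool_def)
qed

definition prefix_of :: "cantor \<Rightarrow> nat \<Rightarrow> bool list" where
  "prefix_of \<omega> n = map \<omega> [0..<n]"

lemma length_prefix_of [simp]: "length (prefix_of \<omega> n) = n"
  by (simp add: prefix_of_def)

lemma nth_prefix_of [simp]: "i < n \<Longrightarrow> prefix_of \<omega> n ! i = \<omega> i"
  by (simp add: prefix_of_def)

lemma starts_with_prefix_of [simp]: "starts_with \<omega> (prefix_of \<omega> n)"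
  by (simp add: starts_with_def)

lemma prefix_of_length: "starts_with \<omega> x \<Longrightarrow> prefix_of \<omega> (length x) = x"
  by (auto simp: starts_with_def intro: nth_equalityI)

lemma starts_with_Nil [simp]: "starts_with \<omega> []"
  by (simp add: starts_with_def)

lemma cyl_disjoint: "length x = length y \<Longrightarrow> x \<noteq> y \<Longrightarrow> cyl x \<inter> cyl y = {}"
  by (auto simp: cyl_def) (metis prefix_of_length)

lemma cyl_INT: "cyl x = (\<Inter>i<length x. {\<omega>. \<omega> i = x ! i})"
  by (auto simp: cyl_def starts_with_def)

lemma continuous_on_coordinate: "continuous_on UNIV (\<lambda>\<omega> :: cantor. \<omega> i)"
  by (rule continuous_on_product_coordinates)

lemma open_cyl: "open (cyl x)"
proof -
  have "open ((\<lambda>\<omega> :: cantor. \<omega> i) -` {b})" for i b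
    by (rule open_vimage[OF discrete_topology_class.open_discrete continuous_on_coordinate])
  then show ?thesis
    unfolding cyl_INT by (intro open_INT) (auto simp: vimage_def)
qed

lemma closed_cyl: "closed (cyl x)"
proof -
  have "closed ((\<lambda>\<omega> :: cantor. \<omega> i) -` {b})" for i b
    by (rule closed_vimage[OF _ continuous_on_coordinate]) (simp add: closed_def discrete_topology_class.open_discrete)
  then show ?thesis
    unfolding cyl_INT by (intro closed_INT) (auto simp: vimage_def)
qed

lemma open_contains_cyl:
  assumes "open U" "\<omega> \<in> U"
  shows "\<exists>n. cyl (prefix_of \<omega> n) \<subseteq> U"
proof -
  have "openin (product_topology (\<lambda>i. euclidean) UNIV) U"
    using assms(1) by (simp add: open_fun_def)
  from product_topology_open_contains_basis[OF this assms(2)]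
  obtain X where X: "\<omega> \<in> (\<Pi>\<^sub>E i\<in>UNIV. X i)" "finite {i. X i \<noteq> UNIV}" "(\<Pi>\<^sub>E i\<in>UNIV. X i) \<subseteq> U"
    by auto
  obtain n where n: "\<And>i. X i \<noteq> UNIV \<Longrightarrow> i < n"
    using X(2) unfolding finite_nat_iff_bounded by blast
  have "\<omega>' \<in> U" if "\<omega>' \<in> cyl (prefix_of \<omega> n)" for \<omega>'
  proof -
    have "\<omega>' i \<in> X i" for i
    proof (cases "i < n")
      case True
      then have "\<omega>' i = \<omega> i" using that by (simp add: cyl_def starts_with_def)
      then show ?thesis using X(1) by auto
    next
      case False
      then show ?thesis using n by blast
    qed
    then show ?thesis using X(3) by auto
  qed
  then show ?thesis by blast
qed

lemma cyl_prefix_of_mono: "m \<le> n \<Longrightarrow> cyl (prefix_of \<omega> n) \<subseteq> cyl (prefix_of \<omega> m)"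
  by (auto simp: cyl_def starts_with_def)

lemma mem_cyl_prefix_of: "\<omega> \<in> cyl (prefix_of \<omega> n)"
  by (simp add: cyl_def)

lemma open_contains_cyl_Times:
  assumes "open W" "(\<alpha>, \<beta>) \<in> W"
  shows "\<exists>n. cyl (prefix_of \<alpha> n) \<times> cyl (prefix_of \<beta> n) \<subseteq> W"
proof -
  obtain A B where "open A" "open B" "\<alpha> \<in> A" "\<beta> \<in> B" "A \<times> B \<subseteq> W"
    using open_prod_elim[OF assms] by (metis mem_Times_iff fst_conv snd_conv)
  moreover obtain m n where "cyl (prefix_of \<alpha> m) \<subseteq> A" "cyl (prefix_of \<beta> n) \<subseteq> B"
    using calculation by (meson open_contains_cyl)
  ultimately have "cyl (prefix_of \<alpha> (max m n)) \<times> cyl (prefix_of \<beta> (max m n)) \<subseteq> W"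
    using cyl_prefix_of_mono[of m "max m n" \<alpha>] cyl_prefix_of_mono[of n "max m n" \<beta>] by fastforce
  then show ?thesis by blast
qed

lemma compact_cantor: "compact (UNIV :: cantor set)"
proof -
  have "compact_space (product_topology (\<lambda>i::nat. euclidean :: bool topology) UNIV)"
    by (subst compact_space_product_topology) (simp add: compact_space_def finite_imp_compact)
  then show ?thesis
    by (simp add: euclidean_product_topology compact_space_def)
qed

lemma compact_cantor_Times: "compact (UNIV :: (cantor \<times> cantor) set)"
  using compact_Times[OF compact_cantor compact_cantor] by simp

lemma sets_cantor_algebra: "sets cantor_algebra = sets borel"
proof -
  have "sets (borel :: bool measure) = sets (count_space UNIV)"
    by (simp add: sets_borel_eq_count_space)
  then have "sets cantor_algebra = sets (PiM UNIV (\<lambda>_. borel :: bool measure))"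
    unfolding cantor_algebra_def by (intro sets_PiM_cong) auto
  then show ?thesis
    by (simp add: sets_PiM_equal_borel)
qed

lemma sets_cantor_algebra_pair: "sets (cantor_algebra \<Otimes>\<^sub>M cantor_algebra) = sets borel"
  unfolding sets_pair_measure_cong[OF sets_cantor_algebra sets_cantor_algebra]
  by (subst borel_prod) (rule refl)

lemma distributionsD:
  assumes "Q \<in> distributions"
  shows "prob_space Q" "sets Q = sets borel" "space Q = UNIV"
  using assms sets_cantor_algebra sets_eq_imp_space_eq[of Q borel]
  by (auto simp: distributions_def)

lemma unif_effectively_open_imp_open:
  assumes "unif_effectively_open ci I U" "i \<in> I" shows "open (U i)"
  using assms unfolding unif_effectively_open_def by (auto intro!: open_UN open_cyl)

lemma effectively_closed_imp_closed:
  assumes "effectively_closed F" shows "closed F"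
proof -
  obtain A where "- F = (\<Union>(x, y)\<in>A. cyl x \<times> cyl y)"
    using assms unfolding effectively_closed_def by blast
  then have "open (- F)"
    by (auto intro!: open_UN open_Times open_cyl)
  then show ?thesis by (simp add: closed_def)
qed

lemma lower_semicomputable_open:
  assumes "lower_semicomputable t" shows "open {\<omega>. r < t \<omega>}"
proof -
  have *: "ereal (of_rat q) < enn2ereal s \<longleftrightarrow> ennreal (of_rat q) < s" if "0 \<le> q" for q s
    using that by (simp add: less_ennreal.rep_eq enn2ereal_ennreal)
  \<comment> \<open>Only nonnegative q may appear, since \<open>ennreal\<close> sends negative
    rationals to 0.\<close>
  have "{\<omega>. r < t \<omega>} = (\<Union>q\<in>{q. 0 \<le> q \<and> r \<le> ennreal (of_rat q)}. {\<omega>. ereal (of_rat q) < enn2ereal (t \<omega>)})"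
  proof (intro equalityI subsetI)
    fix \<omega> assume "\<omega> \<in> {\<omega>. r < t \<omega>}"
    then obtain q where q: "r < ennreal (of_rat q)" "ennreal (of_rat q) < t \<omega>"
      using ennreal_rat_dense by blast
    then have "0 \<le> q" by (metis ennreal_neg less_le_not_le linear not_less_zero of_rat_less_eq of_rat_0)
    then show "\<omega> \<in> (\<Union>q\<in>{q. 0 \<le> q \<and> r \<le> ennreal (of_rat q)}. {\<omega>. ereal (of_rat q) < enn2ereal (t \<omega>)})"
      using q * by (auto intro!: exI[of _ q])
  qed (auto simp: *)
  moreover have "open {\<omega>. ereal (of_rat q) < enn2ereal (t \<omega>)}" for q
    using assms unfolding lower_semicomputable_def by (rule unif_effectively_open_imp_open) simp
  ultimately show ?thesis by auto
qed

lemma open_superlevel_imp_borel_measurable: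
  fixes t :: "'a :: topological_space \<Rightarrow> 'b :: {linorder_topology, second_countable_topology}"
  assumes "\<And>r. open {\<omega>. r < t \<omega>}" shows "t \<in> borel_measurable borel"
  by (rule borel_measurableI_greater) (use assms in auto)

text \<open>The topological content of the hypotheses. Selections, integral bounds and Strassen's
  theorem rest on it alone; computability enters later through \<open>computable_clopen proj\<close>
  and \<open>effectively_closed F\<close>.\<close>

locale clopen_relation =
  fixes F :: "(cantor \<times> cantor) set"
  assumes closed_rel: "closed F"
    and total: "\<exists>\<beta>. (\<alpha>, \<beta>) \<in> F"
    and open_proj_Collect: "open {\<alpha>. \<exists>\<beta>. (\<alpha>, \<beta>) \<in> F \<and> starts_with \<beta> y}"
begin

section \<open>Leftmost selections from a closed relation\<close>

definition proj :: "bool list \<Rightarrow> cantor set" where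
  "proj y = {\<alpha>. \<exists>\<beta>. (\<alpha>, \<beta>) \<in> F \<and> starts_with \<beta> y}"

lemma open_proj: "open (proj y)"
  unfolding proj_def by (rule open_proj_Collect)

lemma proj_measurable [measurable]: "proj y \<in> sets borel"
  using open_proj by simp

text \<open>For \<alpha> in \<open>proj y\<close> this follows the lexicographically least branch of
  the fibre inside \<open>cyl y\<close>: a bit is \<open>False\<close> whenever the fibre still
  meets the shorter cylinder so obtained. Every bit is decided by membership in an open set, which
  makes the selection measurable.\<close>

fun sel_prefix :: "bool list \<Rightarrow> nat \<Rightarrow> cantor \<Rightarrow> bool list" where
  "sel_prefix y 0 \<alpha> = y"
| "sel_prefix y (Suc n) \<alpha> = (let z = sel_prefix y n \<alpha> in z @ [\<alpha> \<notin> proj (z @ [False])])"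

definition sel :: "bool list \<Rightarrow> cantor \<Rightarrow> cantor" where
  "sel y \<alpha> i = sel_prefix y (Suc i) \<alpha> ! i"

lemma length_sel_prefix [simp]: "length (sel_prefix y n \<alpha>) = length y + n"
  by (induction n) (auto simp: Let_def)

lemma sel_prefix_nth: "n \<le> m \<Longrightarrow> i < length y + n \<Longrightarrow> sel_prefix y m \<alpha> ! i = sel_prefix y n \<alpha> ! i"
  by (induction m rule: dec_induct) (auto simp: Let_def nth_append)

lemma starts_with_sel_prefix: "starts_with (sel y \<alpha>) (sel_prefix y n \<alpha>)"
proof -
  have "sel y \<alpha> i = sel_prefix y n \<alpha> ! i" if "i < length y + n" for i
    using sel_prefix_nth[of n "max n (Suc i)" i y \<alpha>] sel_prefix_nth[of "Suc i" "max n (Suc i)" i y \<alpha>] that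
    by (simp add: sel_def)
  then show ?thesis by (simp add: starts_with_def)
qed

lemma starts_with_snoc: "starts_with \<omega> (x @ [b]) \<longleftrightarrow> starts_with \<omega> x \<and> \<omega> (length x) = b"
  by (auto simp: starts_with_def nth_append less_Suc_eq)

lemma sel_prefix_proj: "\<alpha> \<in> proj y \<Longrightarrow> \<alpha> \<in> proj (sel_prefix y n \<alpha>)"
  by (induction n) (auto simp: Let_def proj_def starts_with_snoc)

text \<open>Every finite part of the branch is shared with some point of the fibre, and F is closed:
  a pair outside F would be separated from F by a box that depends on finitely many bits.\<close>

lemma sel_in: assumes "\<alpha> \<in> proj y" shows "(\<alpha>, sel y \<alpha>) \<in> F"
proof (rule ccontr)
  assume "(\<alpha>, sel y \<alpha>) \<notin> F"
  then obtain n where n: "cyl (prefix_of \<alpha> n) \<times> cyl (prefix_of (sel y \<alpha>) n) \<subseteq> - F"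
    using open_contains_cyl_Times[of "- F" \<alpha> "sel y \<alpha>"] closed_rel by (auto simp: closed_def)
  obtain \<beta> where \<beta>: "(\<alpha>, \<beta>) \<in> F" "starts_with \<beta> (sel_prefix y n \<alpha>)"
    using sel_prefix_proj[OF assms, of n] by (auto simp: proj_def)
  have "starts_with \<beta> (prefix_of (sel y \<alpha>) n)"
    using \<beta>(2) starts_with_sel_prefix[of y \<alpha> n] by (auto simp: starts_with_def)
  then show False
    using n \<beta>(1) mem_cyl_prefix_of[of \<alpha> n] by (auto simp: cyl_def subset_iff)
qed

lemma starts_with_sel: "starts_with (sel y \<alpha>) y"
  using starts_with_sel_prefix[of y \<alpha> 0] by simp

lemma sel_prefix_measurable: "sel_prefix y n \<in> borel \<rightarrow>\<^sub>M count_space UNIV"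
proof (induction n)
  case (Suc n)
  have "(\<lambda>\<alpha>. sel_prefix y n \<alpha> @ [\<alpha> \<notin> proj (sel_prefix y n \<alpha> @ [False])]) \<in> borel \<rightarrow>\<^sub>M count_space UNIV"
    by (rule measurable_compose_countable[OF _ Suc]) measurable
  then show ?case by (simp add: Let_def)
qed simp

lemma sel_measurable [measurable]: "sel y \<in> borel \<rightarrow>\<^sub>M borel"
proof (rule measurable_coordinatewise_then_product)
  fix i
  have "(\<lambda>\<alpha>. sel_prefix y (Suc i) \<alpha> ! i) \<in> borel \<rightarrow>\<^sub>M borel"
    by (rule measurable_compose[OF sel_prefix_measurable]) simp
  then show "(\<lambda>\<alpha>. sel y \<alpha> i) \<in> borel \<rightarrow>\<^sub>M borel"
    by (simp only: sel_def)
qed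

lemma proj_Nil: "proj [] = UNIV"
  using total by (auto simp: proj_def)

section \<open>Open sets, suprema over fibres and couplings\<close>

definition hits :: "cantor set \<Rightarrow> cantor set" where
  "hits U = {\<alpha>. \<exists>\<beta>. (\<alpha>, \<beta>) \<in> F \<and> \<beta> \<in> U}"

lemma hits_UN: "hits (\<Union>i\<in>I. A i) = (\<Union>i\<in>I. hits (A i))"
  by (auto simp: hits_def)

lemma hits_cyl: "hits (cyl y) = proj y"
  by (simp add: hits_def proj_def cyl_def)

lemma open_hits: assumes "open U" shows "open (hits U)"
proof -
  have "hits U = (\<Union>y\<in>{y. cyl y \<subseteq> U}. proj y)"
    using open_contains_cyl[OF assms] unfolding hits_def proj_def cyl_def
    by (auto; metis (mono_tags) mem_Collect_eq starts_with_prefix_of)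
  then show ?thesis by (auto intro: open_proj)
qed

definition fibre_Sup :: "(cantor \<Rightarrow> ennreal) \<Rightarrow> cantor \<Rightarrow> ennreal" where
  "fibre_Sup t \<alpha> = (SUP \<beta>\<in>{\<beta>. (\<alpha>, \<beta>) \<in> F}. t \<beta>)"

lemma fibre_Sup_less_iff: "r < fibre_Sup t \<alpha> \<longleftrightarrow> \<alpha> \<in> hits {\<beta>. r < t \<beta>}"
  by (auto simp: fibre_Sup_def less_SUP_iff hits_def)

text \<open>A near-optimal measurable selection is obtained by running through all pairs of a rational
  \<open>q\<close> and a cylinder on which \<open>t > q\<close>, switching to the selection through that cylinder whenever
  this improves the current value of \<open>t\<close>.\<close>

lemma nn_integral_fibre_Sup_le:
  assumes P: "sets P = sets borel" and t: "\<And>r. open {\<omega>. r < t \<omega>}"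
    and K: "\<And>s. s \<in> borel \<rightarrow>\<^sub>M borel \<Longrightarrow> (\<And>\<alpha>. (\<alpha>, s \<alpha>) \<in> F) \<Longrightarrow> (\<integral>\<^sup>+\<alpha>. t (s \<alpha>) \<partial>P) \<le> K"
  shows "(\<integral>\<^sup>+\<alpha>. fibre_Sup t \<alpha> \<partial>P) \<le> K"
proof -
  note [measurable_cong] = P
  have [measurable]: "t \<in> borel_measurable borel"
    using t by (rule open_superlevel_imp_borel_measurable)
  define good where "good p \<longleftrightarrow> cyl (snd p) \<subseteq> {\<omega>. ennreal (of_rat (fst p)) < t \<omega>}"
    for p :: "rat \<times> bool list"
  \<comment> \<open>A switch happens only while the current value is at most q, and
    \<open>good p\<close> makes the new value exceed q; hence t along the selections never
    decreases.\<close>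
  define step where "step p s \<alpha> = (if good p \<and> \<alpha> \<in> proj (snd p) \<and> t (s \<alpha>) \<le> ennreal (of_rat (fst p))
     then sel (snd p) \<alpha> else s \<alpha>)" for p :: "rat \<times> bool list" and s and \<alpha>
  define s where "s n = rec_nat (sel []) (\<lambda>n. step (from_nat n)) n" for n :: nat
  have s_Suc: "s (Suc n) = step (from_nat n) (s n)" for n
    by (simp add: s_def)
  have s_meas [measurable]: "s n \<in> borel \<rightarrow>\<^sub>M borel" for n
  proof (induction n)
    case (Suc n)
    note Suc [measurable]
    show ?case unfolding s_Suc step_def by measurable
  qed (simp add: s_def)
  have s_in: "(\<alpha>, s n \<alpha>) \<in> F" for n \<alpha>
  proof (induction n)
    case 0
    show ?case using sel_in[of \<alpha> "[]"] by (simp add: s_def proj_Nil)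
  next
    case (Suc n)
    then show ?case by (auto simp: s_Suc step_def intro: sel_in)
  qed
  have good: "ennreal (of_rat (fst p)) < t (sel (snd p) \<alpha>)" if "good p" for p \<alpha>
    using that starts_with_sel[of "snd p" \<alpha>] by (auto simp: good_def cyl_def)
  have "incseq (\<lambda>n \<alpha>. t (s n \<alpha>))"
    by (intro incseq_SucI)
      (auto simp: le_fun_def s_Suc step_def dest: good intro: less_imp_le[OF le_less_trans])
  have "fibre_Sup t \<alpha> = (SUP n. t (s n \<alpha>))" for \<alpha>
  proof (rule antisym)
    show "(SUP n. t (s n \<alpha>)) \<le> fibre_Sup t \<alpha>"
      unfolding fibre_Sup_def by (rule SUP_least) (auto intro!: SUP_upper s_in)
    show "fibre_Sup t \<alpha> \<le> (SUP n. t (s n \<alpha>))"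
      unfolding fibre_Sup_def
    proof (rule SUP_least, rule ccontr)
      fix \<beta> assume \<beta>: "\<beta> \<in> {\<beta>. (\<alpha>, \<beta>) \<in> F}" and "\<not> t \<beta> \<le> (SUP n. t (s n \<alpha>))"
      then obtain q where q: "(SUP n. t (s n \<alpha>)) < ennreal (of_rat q)" "ennreal (of_rat q) < t \<beta>"
        using ennreal_rat_dense by (meson not_le)
      then obtain m where m: "cyl (prefix_of \<beta> m) \<subseteq> {\<omega>. ennreal (of_rat q) < t \<omega>}"
        using open_contains_cyl[OF t, of \<beta>] by auto
      define p where "p = (q, prefix_of \<beta> m)"
      have p: "good p" "\<alpha> \<in> proj (snd p)" "fst p = q"
        using m \<beta> by (auto simp: good_def p_def proj_def)
      \<comment> \<open>Stage \<open>to_nat p\<close> examines exactly the pair p: either the value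
        already exceeded q or the switch is made there.\<close>
      have "ennreal (of_rat q) \<le> t (s (Suc (to_nat p)) \<alpha>)"
        using p good[OF p(1), of \<alpha>] by (auto simp: s_Suc step_def)
      also have "\<dots> \<le> (SUP n. t (s n \<alpha>))"
        by (rule SUP_upper) simp
      finally show False using q(1) by simp
    qed
  qed
  then have "(\<integral>\<^sup>+\<alpha>. fibre_Sup t \<alpha> \<partial>P) = (\<integral>\<^sup>+\<alpha>. (SUP n. t (s n \<alpha>)) \<partial>P)"
    by simp
  also have "\<dots> = (SUP n. \<integral>\<^sup>+\<alpha>. t (s n \<alpha>) \<partial>P)"
    by (rule nn_integral_monotone_convergence_SUP[OF \<open>incseq _\<close>]) measurable
  also have "\<dots> \<le> K"
    by (intro SUP_least K s_meas s_in)
  finally show ?thesis .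
qed

text \<open>The coupling is P transported to the graph of s, which is contained in F.\<close>

lemma distr_couplable:
  assumes P: "P \<in> distributions" and s [measurable]: "s \<in> borel \<rightarrow>\<^sub>M borel" and F: "\<And>\<alpha>. (\<alpha>, s \<alpha>) \<in> F"
  shows "distr P cantor_algebra s \<in> couplable_class F P"
proof -
  interpret prob_space P using distributionsD[OF P] by simp
  have [measurable_cong]: "sets P = sets borel" using distributionsD[OF P] by simp
  note [measurable_cong] = sets_cantor_algebra
  have ms [measurable]: "s \<in> P \<rightarrow>\<^sub>M cantor_algebra" by measurable
  have m: "(\<lambda>\<alpha>. (\<alpha>, s \<alpha>)) \<in> P \<rightarrow>\<^sub>M cantor_algebra \<Otimes>\<^sub>M cantor_algebra" by measurable
  define S where "S = distr P (cantor_algebra \<Otimes>\<^sub>M cantor_algebra) (\<lambda>\<alpha>. (\<alpha>, s \<alpha>))"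
  have "prob_space S"
    unfolding S_def by (rule prob_space_distr[OF m])
  moreover have "sets S = sets (cantor_algebra \<Otimes>\<^sub>M cantor_algebra)"
    by (simp add: S_def)
  moreover have "- F \<in> null_sets S"
  proof (rule null_setsI)
    have "- F \<in> sets (cantor_algebra \<Otimes>\<^sub>M cantor_algebra)"
      using closed_rel unfolding sets_cantor_algebra_pair by (intro borel_open) (simp add: closed_def)
    then show "- F \<in> sets S" by (simp add: S_def)
    have "(\<lambda>\<alpha>. (\<alpha>, s \<alpha>)) -` (- F) \<inter> space P = {}"
      using F by auto
    then show "emeasure S (- F) = 0"
      using \<open>- F \<in> sets (cantor_algebra \<Otimes>\<^sub>M cantor_algebra)\<close> by (simp add: S_def emeasure_distr[OF m])
  qed
  moreover have "distr S cantor_algebra fst = P"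
  proof -
    have "distr S cantor_algebra fst = distr P cantor_algebra (\<lambda>\<alpha>. \<alpha>)"
      unfolding S_def by (subst distr_distr[OF _ m]) (auto simp: comp_def)
    also have "\<dots> = P"
      using distributionsD(2)[OF P] by (intro distr_id2) (simp add: sets_cantor_algebra)
    finally show ?thesis .
  qed
  moreover have "distr S cantor_algebra snd = distr P cantor_algebra s"
    unfolding S_def by (subst distr_distr[OF _ m]) (auto simp: comp_def)
  moreover have "distr P cantor_algebra s \<in> distributions"
    using prob_space_distr[OF ms] by (simp add: distributions_def)
  ultimately show ?thesis
    unfolding couplable_class_def couplable_def by blast
qed

end

text \<open>Both integrals are pulled back to the coupling, where the pointwise inequality can fail
  only on the null complement of F. Applied to indicators it also yields the bounds for
  \<open>hits\<close> and \<open>core\<close>.\<close>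

lemma coupling_nn_integral_le:
  assumes Q: "Q \<in> couplable_class F P" and fg: "\<And>\<alpha> \<beta>. (\<alpha>, \<beta>) \<in> F \<Longrightarrow> g \<beta> \<le> f \<alpha>"
    and [measurable]: "f \<in> borel_measurable borel" "g \<in> borel_measurable borel"
  shows "(\<integral>\<^sup>+\<beta>. g \<beta> \<partial>Q) \<le> (\<integral>\<^sup>+\<alpha>. f \<alpha> \<partial>P)"
proof -
  obtain S where S: "sets S = sets (cantor_algebra \<Otimes>\<^sub>M cantor_algebra)" "- F \<in> null_sets S"
    "distr S cantor_algebra fst = P" "distr S cantor_algebra snd = Q"
    using Q by (auto simp: couplable_class_def couplable_def)
  note [measurable_cong] = S(1) sets_cantor_algebra
  have "(\<integral>\<^sup>+\<beta>. g \<beta> \<partial>Q) = (\<integral>\<^sup>+\<omega>. g (snd \<omega>) \<partial>S)"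
    unfolding S(4)[symmetric] by (rule nn_integral_distr) measurable
  also have "\<dots> \<le> (\<integral>\<^sup>+\<omega>. f (fst \<omega>) \<partial>S)"
    by (rule nn_integral_mono_AE, rule AE_I'[OF S(2)]) (use fg in \<open>auto simp: not_le[symmetric]\<close>)
  also have "\<dots> = (\<integral>\<^sup>+\<alpha>. f \<alpha> \<partial>P)"
    unfolding S(3)[symmetric] by (rule nn_integral_distr[symmetric]) measurable
  finally show ?thesis .
qed

section \<open>The Hahn-Banach theorem and a Strassen theorem\<close>

text \<open>Only an inequality for c > 0 is demanded, which is easy to check for infima and
  integrals; equality and the value 0 at 0 follow.\<close>

definition sublinear :: "('a::real_vector \<Rightarrow> real) \<Rightarrow> bool" where
  "sublinear p \<longleftrightarrow> (\<forall>x y. p (x + y) \<le> p x + p y) \<and> (\<forall>c>0. \<forall>x. p (c *\<^sub>R x) \<le> c * p x)"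

lemma sublinear_add: "sublinear p \<Longrightarrow> p (x + y) \<le> p x + p y"
  by (simp add: sublinear_def)

lemma sublinear_scale:
  assumes p: "sublinear p" and "0 < c" shows "p (c *\<^sub>R x) = c * p x"
proof (rule antisym)
  show "p (c *\<^sub>R x) \<le> c * p x"
    using assms by (simp add: sublinear_def)
  have "p ((1 / c) *\<^sub>R (c *\<^sub>R x)) \<le> (1 / c) * p (c *\<^sub>R x)"
    using assms unfolding sublinear_def by (meson zero_less_divide_1_iff)
  then show "c * p x \<le> p (c *\<^sub>R x)"
    using \<open>0 < c\<close> by (simp add: field_simps)
qed

lemma sublinear_0: assumes "sublinear p" shows "p 0 = 0"
  using sublinear_scale[OF assms, of 2 0] by simp

lemma sublinear_ge: assumes "sublinear p" shows "- p (- x) \<le> p x"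
  using sublinear_add[OF assms, of x "- x"] sublinear_0[OF assms] by simp

text \<open>The two conditions let the index vary with the operation: an infimum is subadditive once
  any two indices can be merged into a third. This serves lowering in a direction, infima of chains
  and the infimal convolution in the extension theorem.\<close>

lemma sublinear_INF:
  fixes f :: "'i \<Rightarrow> 'a::real_vector \<Rightarrow> real"
  assumes ne: "I \<noteq> {}" and bdd: "\<And>x. bdd_below ((\<lambda>i. f i x) ` I)"
    and add: "\<And>i j x y. i \<in> I \<Longrightarrow> j \<in> I \<Longrightarrow> \<exists>k\<in>I. f k (x + y) \<le> f i x + f j y"
    and scale: "\<And>i c x. i \<in> I \<Longrightarrow> 0 < c \<Longrightarrow> \<exists>k\<in>I. f k (c *\<^sub>R x) \<le> c * f i x"
  shows "sublinear (\<lambda>x. INF i\<in>I. f i x)"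
  unfolding sublinear_def
proof (intro conjI allI impI)
  fix x y
  have "(INF i\<in>I. f i (x + y)) - f j y \<le> f i x" if "i \<in> I" "j \<in> I" for i j
    using add[OF that, of x y] cINF_lower[OF bdd, of _ "x + y"] by fastforce
  then have "(INF i\<in>I. f i (x + y)) - f j y \<le> (INF i\<in>I. f i x)" if "j \<in> I" for j
    using that by (intro cINF_greatest[OF ne])
  then have "(INF i\<in>I. f i (x + y)) - (INF i\<in>I. f i x) \<le> (INF i\<in>I. f i y)"
    by (intro cINF_greatest[OF ne]) (simp add: algebra_simps)
  then show "(INF i\<in>I. f i (x + y)) \<le> (INF i\<in>I. f i x) + (INF i\<in>I. f i y)"
    by simp
next
  fix c :: real and x assume c: "0 < c"
  have "(INF i\<in>I. f i (c *\<^sub>R x)) / c \<le> f i x" if i: "i \<in> I" for i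
  proof -
    obtain k where k: "k \<in> I" "f k (c *\<^sub>R x) \<le> c * f i x"
      using scale[OF i c] by blast
    then have "(INF i\<in>I. f i (c *\<^sub>R x)) \<le> c * f i x"
      using cINF_lower[OF bdd k(1)] by (meson order_trans)
    then show ?thesis using c by (simp add: field_simps)
  qed
  then have "(INF i\<in>I. f i (c *\<^sub>R x)) / c \<le> (INF i\<in>I. f i x)"
    by (rule cINF_greatest[OF ne])
  then show "(INF i\<in>I. f i (c *\<^sub>R x)) \<le> c * (INF i\<in>I. f i x)"
    using c by (simp add: field_simps)
qed

text \<open>A minimal sublinear functional is linear: otherwise it could be lowered in some direction \<open>v\<close>.\<close>

lemma minimal_sublinear_linear:
  assumes m: "sublinear m" and minimal: "\<And>q. sublinear q \<Longrightarrow> (\<And>x. q x \<le> m x) \<Longrightarrow> q = m"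
  shows "linear m"
proof -
  have neg: "m (- v) = - m v" for v
  proof -
    \<comment> \<open>The value at -v is forced down: t = 0 gives q \<le> m, and t = 1 at the point
      -v gives q(-v) \<le> -m(v). Minimality then makes this bound hold for m itself.\<close>
    define q where "q x = (INF t\<in>{0..}. m (x + t *\<^sub>R v) - t * m v)" for x
    have scale: "m (t *\<^sub>R x) = t * m x" if "0 \<le> t" for t x
      using that sublinear_scale[OF m] sublinear_0[OF m] by (cases "t = 0") auto
    have bdd: "bdd_below ((\<lambda>t. m (x + t *\<^sub>R v) - t * m v) ` {0..})" for x
    proof (rule bdd_belowI2)
      fix t :: real assume "t \<in> {0..}"
      then show "- m (- x) \<le> m (x + t *\<^sub>R v) - t * m v"
        using sublinear_add[OF m, of "x + t *\<^sub>R v" "- x"] scale by simp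
    qed
    have "sublinear q"
      unfolding q_def
    proof (rule sublinear_INF[OF _ bdd])
      fix s t :: real and x y assume st: "s \<in> {0..}" "t \<in> {0..}"
      have "m (x + y + (s + t) *\<^sub>R v) \<le> m (x + s *\<^sub>R v) + m (y + t *\<^sub>R v)"
        using sublinear_add[OF m, of "x + s *\<^sub>R v" "y + t *\<^sub>R v"] by (simp add: algebra_simps)
      then show "\<exists>k\<in>{0..}. m (x + y + k *\<^sub>R v) - k * m v \<le> (m (x + s *\<^sub>R v) - s * m v) + (m (y + t *\<^sub>R v) - t * m v)"
        using st by (intro bexI[of _ "s + t"]) (auto simp: algebra_simps)
    next
      fix s c :: real and x assume "s \<in> {0..}" "0 < c"
      then show "\<exists>k\<in>{0..}. m (c *\<^sub>R x + k *\<^sub>R v) - k * m v \<le> c * (m (x + s *\<^sub>R v) - s * m v)"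
        using sublinear_scale[OF m, of c "x + s *\<^sub>R v"]
        by (intro bexI[of _ "c * s"]) (auto simp: algebra_simps)
    qed auto
    moreover have q_le: "q x \<le> m (x + t *\<^sub>R v) - t * m v" if "0 \<le> t" for x t
      unfolding q_def using that by (intro cINF_lower[OF bdd]) auto
    ultimately have "q = m"
      using q_le[of 0] by (intro minimal) auto
    then have "m (- v) \<le> - m v"
      using q_le[of 1 "- v"] sublinear_0[OF m] by simp
    then show ?thesis using sublinear_ge[OF m, of v] by simp
  qed
  show ?thesis
  proof (rule linearI)
    fix x y
    show "m (x + y) = m x + m y"
      using sublinear_add[OF m, of x y] sublinear_add[OF m, of "- x" "- y"] neg[of x] neg[of y] neg[of "x + y"]
      by simp
  next
    fix c :: real and x
    show "m (c *\<^sub>R x) = c *\<^sub>R m x"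
      using sublinear_scale[OF m, of c x] sublinear_scale[OF m, of "- c" x] neg[of "c *\<^sub>R x"] sublinear_0[OF m]
      by (cases c "0 :: real" rule: linorder_cases) auto
  qed
qed

lemma exists_linear_le_sublinear:
  fixes p :: "'a::real_vector \<Rightarrow> real"
  assumes p: "sublinear p"
  shows "\<exists>l. linear l \<and> (\<forall>x. l x \<le> p x)"
proof -
  define A where "A = {q. sublinear q \<and> (\<forall>x. q x \<le> p x)}"
  \<comment> \<open>The order is reversed, so that the bound required by Zorn's lemma is the
    pointwise infimum of a chain; it is finite because every q in A satisfies q(x) \<ge>
    -p(-x).\<close>
  have po: "partial_order_on A (relation_of (\<lambda>q r. r \<le> q) A)"
    by (rule partial_order_on_relation_ofI) auto
  have "\<exists>m\<in>A. \<forall>a\<in>A. a \<le> m \<longrightarrow> a = m"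
  proof (rule predicate_Zorn[OF po])
    fix C assume C: "C \<in> Chains (relation_of (\<lambda>q r. r \<le> q) A)"
    then have CA: "C \<subseteq> A" and chain: "\<And>q r. q \<in> C \<Longrightarrow> r \<in> C \<Longrightarrow> q \<le> r \<or> r \<le> q"
      unfolding Chains_def relation_of_def by blast+
    show "\<exists>u\<in>A. \<forall>a\<in>C. u \<le> a"
    proof (cases "C = {}")
      case True
      then show ?thesis using p by (auto simp: A_def)
    next
      case False
      define u where "u x = (INF q\<in>C. q x)" for x
      have sub: "sublinear q" and le: "q x \<le> p x" if "q \<in> C" for q x
        using that CA by (auto simp: A_def)
      have bdd: "bdd_below ((\<lambda>q. q x) ` C)" for x
      proof (rule bdd_belowI2)
        fix q assume "q \<in> C"
        then show "- p (- x) \<le> q x"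
          using le[of q "- x"] sublinear_ge[OF sub, of q x] by simp
      qed
      have "sublinear u"
        unfolding u_def
      proof (rule sublinear_INF[OF False bdd])
        fix q r x y assume qr: "q \<in> C" "r \<in> C"
        show "\<exists>k\<in>C. k (x + y) \<le> q x + r y"
          using chain[OF qr]
        proof
          assume "q \<le> r"
          then have "q y \<le> r y" by (rule le_funD)
          then show ?thesis using qr sublinear_add[OF sub[OF qr(1)], of x y] by (intro bexI[of _ q]) auto
        next
          assume "r \<le> q"
          then have "r x \<le> q x" by (rule le_funD)
          then show ?thesis using qr sublinear_add[OF sub[OF qr(2)], of x y] by (intro bexI[of _ r]) auto
        qed
      next
        fix q c x assume "q \<in> C" "(0 :: real) < c"
        then show "\<exists>k\<in>C. k (c *\<^sub>R x) \<le> c * q x"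
          using sublinear_scale[OF sub, of q c x] by (intro bexI[of _ q]) auto
      qed
      moreover have u_le: "u x \<le> q x" if "q \<in> C" for q x
        unfolding u_def using that by (rule cINF_lower[OF bdd])
      moreover obtain q where "q \<in> C" using False by blast
      ultimately have "u \<in> A"
        using le[of q] by (auto simp: A_def intro: order_trans)
      then show ?thesis using u_le by (auto simp: le_fun_def)
    qed
  qed
  then obtain m where m: "m \<in> A" "\<And>a. a \<in> A \<Longrightarrow> a \<le> m \<Longrightarrow> a = m" by blast
  have "linear m"
  proof (rule minimal_sublinear_linear)
    show "sublinear m" using m(1) by (simp add: A_def)
    show "q = m" if "sublinear q" "\<And>x. q x \<le> m x" for q
    proof (rule m(2))
      show "q \<in> A" using that m(1) by (auto simp: A_def intro: order_trans)
      show "q \<le> m" using that(2) by (simp add: le_fun_def)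
    qed
  qed
  then show ?thesis using m(1) by (auto simp: A_def)
qed

lemma hahn_banach_extension:
  fixes p :: "'a::real_vector \<Rightarrow> real" and T :: "'b::real_vector \<Rightarrow> 'a"
  assumes p: "sublinear p" and T: "linear T" and q: "linear q" and le: "\<And>g. q g \<le> p (T g)"
  shows "\<exists>l. linear l \<and> (\<forall>x. l x \<le> p x) \<and> (\<forall>g. l (T g) = q g)"
proof -
  \<comment> \<open>Domination by r encodes everything wanted: g = 0 gives domination by p, and x =
    T g gives l(T g) \<le> q(g), which linearity turns into an equality by passing to -g.\<close>
  define r where "r x = (INF g. p (x - T g) + q g)" for x
  have bdd: "bdd_below (range (\<lambda>g. p (x - T g) + q g))" for x
  proof (rule bdd_belowI2)
    fix g
    show "- p (- x) \<le> p (x - T g) + q g"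
      using sublinear_add[OF p, of "x - T g" "- x"] le[of "- g"]
      by (simp add: linear_neg[OF T] linear_neg[OF q])
  qed
  have "sublinear r"
    unfolding r_def
  proof (rule sublinear_INF[OF _ bdd])
    fix g h x y
    show "\<exists>k\<in>UNIV. p (x + y - T k) + q k \<le> p (x - T g) + q g + (p (y - T h) + q h)"
      using sublinear_add[OF p, of "x - T g" "y - T h"]
      by (intro bexI[of _ "g + h"]) (auto simp: linear_add[OF T] linear_add[OF q] algebra_simps)
  next
    fix g x and c :: real assume "0 < c"
    then show "\<exists>k\<in>UNIV. p (c *\<^sub>R x - T k) + q k \<le> c * (p (x - T g) + q g)"
      using sublinear_scale[OF p, of c "x - T g"]
      by (intro bexI[of _ "c *\<^sub>R g"]) (auto simp: linear_scale[OF T] linear_scale[OF q] algebra_simps)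
  qed simp
  from exists_linear_le_sublinear[OF this]
  obtain l where l: "linear l" "\<And>x. l x \<le> r x" by blast
  have r_le: "r x \<le> p (x - T g) + q g" for x g
    unfolding r_def by (rule cINF_lower[OF bdd]) simp
  have "l x \<le> p x" for x
    using l(2)[of x] r_le[of x 0] by (simp add: linear_0[OF T] linear_0[OF q])
  moreover have l_le: "l (T g) \<le> q g" for g
    using l(2)[of "T g"] r_le[of "T g" g] sublinear_0[OF p] by simp
  have "l (T g) = q g" for g
    using l_le[of g] l_le[of "- g"] by (simp add: linear_neg[OF T] linear_neg[OF q] linear_neg[OF l(1)])
  ultimately show ?thesis using l(1) by blast
qed

section \<open>Measures from functionals, and comparison of integrals by tails\<close>

lemma sigma_sets_clopen:
  fixes B :: "'a::topological_space set set"
  assumes B: "countable B" "\<And>b. b \<in> B \<Longrightarrow> open b \<and> closed b"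
    and basis: "\<And>W x. open W \<Longrightarrow> x \<in> W \<Longrightarrow> \<exists>b\<in>B. x \<in> b \<and> b \<subseteq> W"
  shows "sigma_sets UNIV {A :: 'a set. open A \<and> closed A} = sets borel"
proof
  show "sigma_sets UNIV {A :: 'a set. open A \<and> closed A} \<subseteq> sets borel"
    using sets.sigma_sets_subset[of "{A :: 'a set. open A \<and> closed A}" borel] by (simp add: subset_iff)
  have "W \<in> sigma_sets UNIV {A. open A \<and> closed A}" if W: "open W" for W :: "'a set"
  proof -
    have "W = \<Union>{b \<in> B. b \<subseteq> W}"
      using basis[OF W] by blast
    moreover have "\<Union>{b \<in> B. b \<subseteq> W} \<in> sigma_sets UNIV {A. open A \<and> closed A}"
      using B by (intro sigma_sets_UNION) (auto intro: countable_subset)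
    ultimately show ?thesis by simp
  qed
  then have "sigma_sets UNIV {W :: 'a set. open W} \<subseteq> sigma_sets UNIV {A. open A \<and> closed A}"
    by (intro sigma_sets_mono) auto
  then show "sets borel \<subseteq> sigma_sets UNIV {A :: 'a set. open A \<and> closed A}"
    by (simp add: borel_def)
qed

lemma sigma_sets_clopen_cantor: "sigma_sets UNIV {A :: cantor set. open A \<and> closed A} = sets borel"
proof (rule sigma_sets_clopen[of "range cyl"])
  show "\<exists>b\<in>range cyl. \<omega> \<in> b \<and> b \<subseteq> W" if "open W" "\<omega> \<in> W" for W \<omega>
    using open_contains_cyl[OF that] mem_cyl_prefix_of by blast
qed (auto simp: open_cyl closed_cyl)

lemma sigma_sets_clopen_cantor_pair:
  "sigma_sets UNIV {A :: (cantor \<times> cantor) set. open A \<and> closed A} = sets borel"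
proof (rule sigma_sets_clopen[of "range (\<lambda>(x, y). cyl x \<times> cyl y)"])
  show "\<exists>b\<in>range (\<lambda>(x, y). cyl x \<times> cyl y). \<omega> \<in> b \<and> b \<subseteq> W" if "open W" "\<omega> \<in> W" for W \<omega>
  proof -
    obtain \<alpha> \<beta> where \<omega>: "\<omega> = (\<alpha>, \<beta>)" by fastforce
    obtain n where "cyl (prefix_of \<alpha> n) \<times> cyl (prefix_of \<beta> n) \<subseteq> W"
      using open_contains_cyl_Times[of W \<alpha> \<beta>] \<open>open W\<close> \<open>\<omega> \<in> W\<close> unfolding \<omega> by blast
    then show ?thesis
      by (intro bexI[of _ "cyl (prefix_of \<alpha> n) \<times> cyl (prefix_of \<beta> n)"])
        (auto simp: \<omega> mem_cyl_prefix_of)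
  qed
qed (auto simp: open_cyl closed_cyl open_Times closed_Times)

lemma distributions_eqI:
  assumes "P \<in> distributions" "Q \<in> distributions"
    and "\<And>A. open A \<Longrightarrow> closed A \<Longrightarrow> emeasure P A = emeasure Q A"
  shows "P = Q"
proof (rule measure_eqI_generator_eq[where \<Omega> = UNIV and E = "{A. open A \<and> closed A}" and A = "\<lambda>_. UNIV"])
  interpret prob_space P using distributionsD[OF assms(1)] by simp
  show "emeasure P UNIV \<noteq> \<infinity>" by simp
  show "Int_stable {A :: cantor set. open A \<and> closed A}"
    by (auto simp: Int_stable_def)
qed (use assms in \<open>auto simp: sigma_sets_clopen_cantor distributionsD(2)\<close>)

text \<open>For clopen A the indicator is continuous, so a functional on continuous functions can be
  evaluated at it directly; this replaces the approximation argument of the general Riesz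
  theorem.\<close>

definition clopen_ind :: "'a::topological_space set \<Rightarrow> 'a \<Rightarrow>\<^sub>C real" where
  "clopen_ind A = Bcontfun (indicator A)"

lemma clopen_ind:
  assumes "open A" "closed A" shows "apply_bcontfun (clopen_ind A) = indicator A"
proof -
  have "continuous_on UNIV (indicator A :: 'a \<Rightarrow> real)"
    unfolding continuous_on_open_vimage[OF open_UNIV]
  proof (intro allI impI)
    fix B :: "real set"
    have "indicator A -` B \<inter> UNIV = (if 1 \<in> B then A else {}) \<union> (if 0 \<in> B then - A else {})"
      by (auto simp: indicator_def of_bool_def split: if_splits)
    also have "open \<dots>"
      using assms by (auto intro!: open_Un)
    finally show "open (indicator A -` B \<inter> UNIV)" .
  qed
  moreover have "bounded (range (indicator A :: 'a \<Rightarrow> real))"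
    by (auto simp: bounded_iff indicator_def intro!: exI[of _ 1])
  ultimately show ?thesis
    unfolding clopen_ind_def by (intro Bcontfun_inverse) (simp add: bcontfun_def)
qed

text \<open>Compactness makes any finitely additive function on the clopen sets countably additive.\<close>

lemma riesz_clopen:
  fixes l :: "('a::topological_space \<Rightarrow>\<^sub>C real) \<Rightarrow> real"
  assumes compact: "compact (UNIV :: 'a set)" and l: "linear l"
    and nonneg: "\<And>f. (\<And>x. 0 \<le> apply_bcontfun f x) \<Longrightarrow> 0 \<le> l f"
  shows "\<exists>S. sets S = sigma_sets UNIV {A. open A \<and> closed A} \<and> space S = UNIV \<and>
     (\<forall>A. open A \<longrightarrow> closed A \<longrightarrow> emeasure S A = ennreal (l (clopen_ind A)))"
proof -
  let ?M = "{A :: 'a set. open A \<and> closed A}"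
  interpret algebra UNIV ?M
    by (auto simp: algebra_iff_Un open_closed intro: open_Un closed_Un)
  have ind: "apply_bcontfun (clopen_ind A) = indicator A" if "A \<in> ?M" for A
    using that by (simp add: clopen_ind)
  have empty: "l (clopen_ind {}) = 0"
  proof -
    have "clopen_ind {} = (0 :: 'a \<Rightarrow>\<^sub>C real)"
      by (rule bcontfun_eqI) (simp add: ind)
    then show ?thesis by (simp add: linear_0[OF l])
  qed
  have "\<exists>\<mu>. (\<forall>A\<in>?M. \<mu> A = ennreal (l (clopen_ind A))) \<and> measure_space UNIV (sigma_sets UNIV ?M) \<mu>"
  proof (rule caratheodory_empty_continuous)
    show "positive ?M (\<lambda>A. ennreal (l (clopen_ind A)))"
      by (simp add: positive_def empty)
    show "additive ?M (\<lambda>A. ennreal (l (clopen_ind A)))"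
      unfolding additive_def
    proof (intro ballI impI)
      fix A B assume AB: "A \<in> ?M" "B \<in> ?M" "A \<inter> B = {}"
      have "clopen_ind (A \<union> B) = clopen_ind A + clopen_ind B"
        using AB by (intro bcontfun_eqI) (auto simp: clopen_ind open_Un closed_Un indicator_def)
      moreover have "0 \<le> l (clopen_ind A)" "0 \<le> l (clopen_ind B)"
        using AB by (auto intro!: nonneg simp: ind)
      ultimately show "ennreal (l (clopen_ind (A \<union> B))) = ennreal (l (clopen_ind A)) + ennreal (l (clopen_ind B))"
        by (simp add: linear_add[OF l] ennreal_plus)
    qed
    fix A :: "nat \<Rightarrow> 'a set" assume A: "range A \<subseteq> ?M" "decseq A" "(\<Inter>i. A i) = {}"
    have cover: "UNIV \<subseteq> (\<Union>i. - A i)" using A(3) by auto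
    have "\<And>i. open (- A i)" using A(1) by (auto simp: closed_def)
    then obtain I where I: "finite I" "UNIV \<subseteq> (\<Union>i\<in>I. - A i)"
      by (rule compactE_image[OF compact _ cover]) auto
    \<comment> \<open>Finitely many complements already cover the space, so a decreasing sequence of
      clopen sets with empty intersection is empty from some index on. Continuity at the empty set
      is then immediate.\<close>
    have "A n = {}" if "Max (insert 0 I) \<le> n" for n
    proof (rule ccontr)
      assume "A n \<noteq> {}"
      then obtain x i where "x \<in> A n" "i \<in> I" "x \<notin> A i" using I(2) by blast
      moreover have "i \<le> n" using that \<open>i \<in> I\<close> I(1) by simp
      ultimately show False using decseqD[OF A(2)] by blast
    qed
    then have "eventually (\<lambda>n. ennreal (l (clopen_ind (A n))) = 0) sequentially"
      by (auto simp: eventually_sequentially empty intro!: exI[of _ "Max (insert 0 I)"])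
    then show "(\<lambda>n. ennreal (l (clopen_ind (A n)))) \<longlonglongrightarrow> 0"
      by (rule tendsto_eventually)
  qed simp
  then obtain \<mu> where \<mu>: "\<And>A. A \<in> ?M \<Longrightarrow> \<mu> A = ennreal (l (clopen_ind A))"
    "measure_space UNIV (sigma_sets UNIV ?M) \<mu>" by blast
  define S where "S = measure_of UNIV ?M \<mu>"
  have "emeasure S A = \<mu> A" if "A \<in> ?M" for A
    using \<mu>(2) that
    by (intro emeasure_measure_of[OF S_def]) (auto simp: S_def measure_space_def)
  then show ?thesis
    by (intro exI[of _ S]) (auto simp: S_def \<mu>)
qed

lemma nn_integral_layer_cake:
  assumes M: "sigma_finite_measure M" and [measurable]: "X \<in> borel_measurable M"
  shows "(\<integral>\<^sup>+\<omega>. ennreal (X \<omega>) \<partial>M) = (\<integral>\<^sup>+s. indicator {0..} s * emeasure M {\<omega>\<in>space M. s < X \<omega>} \<partial>lborel)"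
proof -
  interpret M: sigma_finite_measure M by fact
  interpret pair_sigma_finite M lborel ..
  have "(\<integral>\<^sup>+\<omega>. ennreal (X \<omega>) \<partial>M) = (\<integral>\<^sup>+\<omega>. (\<integral>\<^sup>+s. indicator {0..} s * indicator {\<omega>\<in>space M. s < X \<omega>} \<omega> \<partial>lborel) \<partial>M)"
  proof (rule nn_integral_cong)
    fix \<omega> assume \<omega>: "\<omega> \<in> space M"
    have "(\<integral>\<^sup>+s. indicator {0..} s * indicator {\<omega>\<in>space M. s < X \<omega>} \<omega> \<partial>lborel) = (\<integral>\<^sup>+s. indicator {0..<X \<omega>} s \<partial>lborel)"
      using \<omega> by (intro nn_integral_cong) (auto simp: indicator_def)
    also have "\<dots> = ennreal (X \<omega>)"
      by (cases "0 \<le> X \<omega>") (auto simp: ennreal_neg)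
    finally show "ennreal (X \<omega>) = (\<integral>\<^sup>+s. indicator {0..} s * indicator {\<omega>\<in>space M. s < X \<omega>} \<omega> \<partial>lborel)" ..
  qed
  also have "\<dots> = (\<integral>\<^sup>+s. (\<integral>\<^sup>+\<omega>. indicator {0..} s * indicator {\<omega>\<in>space M. s < X \<omega>} \<omega> \<partial>M) \<partial>lborel)"
    by (rule Fubini'[symmetric]) measurable
  also have "\<dots> = (\<integral>\<^sup>+s. indicator {0..} s * emeasure M {\<omega>\<in>space M. s < X \<omega>} \<partial>lborel)"
    by (intro nn_integral_cong) (simp add: nn_integral_cmult)
  finally show ?thesis .
qed

text \<open>Stochastic dominance between variables on different spaces. Adding the common bound B
  makes both nonnegative, and the layer-cake formula then compares them level by level.\<close>

lemma integral_le_of_tail_le: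
  fixes X :: "'a \<Rightarrow> real" and Y :: "'b \<Rightarrow> real"
  assumes M: "prob_space M" and N: "prob_space N"
    and X [measurable]: "X \<in> borel_measurable M" and Y [measurable]: "Y \<in> borel_measurable N"
    and bound: "\<And>x. \<bar>X x\<bar> \<le> B" "\<And>y. \<bar>Y y\<bar> \<le> B"
    and tail: "\<And>s. emeasure M {x\<in>space M. s < X x} \<le> emeasure N {y\<in>space N. s < Y y}"
  shows "(\<integral>x. X x \<partial>M) \<le> (\<integral>y. Y y \<partial>N)"
proof -
  interpret M: prob_space M by fact
  interpret N: prob_space N by fact
  have int [simp]: "integrable M X" "integrable N Y"
    using bound by (auto intro!: M.integrable_const_bound[of _ B] N.integrable_const_bound[of _ B])
  have nonneg: "0 \<le> X x + B" "0 \<le> Y y + B" for x y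
    using bound(1)[of x] bound(2)[of y] by auto
  have "emeasure M {x\<in>space M. s < X x + B} \<le> emeasure N {y\<in>space N. s < Y y + B}" for s
    using tail[of "s - B"] by (simp add: less_diff_eq diff_less_eq)
  then have "(\<integral>\<^sup>+x. ennreal (X x + B) \<partial>M) \<le> (\<integral>\<^sup>+y. ennreal (Y y + B) \<partial>N)"
    by (subst (1 2) nn_integral_layer_cake)
      (auto intro!: nn_integral_mono mult_left_mono M.sigma_finite_measure_axioms N.sigma_finite_measure_axioms)
  then have "ennreal (\<integral>x. X x + B \<partial>M) \<le> ennreal (\<integral>y. Y y + B \<partial>N)"
    by (subst (asm) (1 2) nn_integral_eq_integral) (auto simp: nonneg)
  then have "(\<integral>x. X x + B \<partial>M) \<le> (\<integral>y. Y y + B \<partial>N)"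
    by (subst (asm) ennreal_le_iff) (auto intro!: integral_nonneg_AE simp: nonneg simp del: Bochner_Integration.integral_add)
  then show ?thesis
    by (simp add: M.prob_space N.prob_space)
qed

section \<open>Strassen's theorem for the relation F\<close>

context clopen_relation
begin

definition fibre_max :: "((cantor \<times> cantor) \<Rightarrow>\<^sub>C real) \<Rightarrow> cantor \<Rightarrow> real" where
  "fibre_max f \<alpha> = (SUP \<beta>\<in>{\<beta>. (\<alpha>, \<beta>) \<in> F}. apply_bcontfun f (\<alpha>, \<beta>))"

lemma fibre_nonempty: "{\<beta>. (\<alpha>, \<beta>) \<in> F} \<noteq> {}"
  using total by auto

lemma bcontfun_abs_le: "\<bar>apply_bcontfun f x\<bar> \<le> norm (f :: 'c::topological_space \<Rightarrow>\<^sub>C real)"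
  using norm_bounded[of f x] by simp

lemma bdd_above_fibre: "bdd_above ((\<lambda>\<beta>. apply_bcontfun (f :: (cantor \<times> cantor) \<Rightarrow>\<^sub>C real) (\<alpha>, \<beta>)) ` {\<beta>. (\<alpha>, \<beta>) \<in> F})"
  by (rule bdd_aboveI2[of _ _ "norm f"]) (use bcontfun_abs_le[of f] in \<open>auto simp: abs_le_iff\<close>)

lemma fibre_max_upper: "(\<alpha>, \<beta>) \<in> F \<Longrightarrow> apply_bcontfun f (\<alpha>, \<beta>) \<le> fibre_max f \<alpha>"
  unfolding fibre_max_def by (rule cSUP_upper[OF _ bdd_above_fibre]) simp

lemma fibre_max_least: "(\<And>\<beta>. (\<alpha>, \<beta>) \<in> F \<Longrightarrow> apply_bcontfun f (\<alpha>, \<beta>) \<le> c) \<Longrightarrow> fibre_max f \<alpha> \<le> c"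
  unfolding fibre_max_def by (rule cSUP_least[OF fibre_nonempty]) simp

lemma less_fibre_max_iff: "r < fibre_max f \<alpha> \<longleftrightarrow> (\<exists>\<beta>. (\<alpha>, \<beta>) \<in> F \<and> r < apply_bcontfun f (\<alpha>, \<beta>))"
  unfolding fibre_max_def by (subst less_cSUP_iff[OF fibre_nonempty bdd_above_fibre]) auto

lemma abs_fibre_max_le: "\<bar>fibre_max f \<alpha>\<bar> \<le> norm f"
proof -
  obtain \<beta> where "(\<alpha>, \<beta>) \<in> F" using total by blast
  then have "- norm f \<le> fibre_max f \<alpha>"
    using fibre_max_upper[of \<alpha> \<beta> f] bcontfun_abs_le[of f "(\<alpha>, \<beta>)"] by linarith
  moreover have "fibre_max f \<alpha> \<le> norm f"
    using bcontfun_abs_le[of f] by (intro fibre_max_least) (simp add: abs_le_iff)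
  ultimately show ?thesis by simp
qed

text \<open>Openness of projections makes the fibre maximum lower semicontinuous: if f > r on a box
  around (\<alpha>, \<beta>), every point near \<alpha> still has a fibre point in that box.\<close>

lemma open_less_fibre_max: "open {\<alpha>. r < fibre_max f \<alpha>}"
proof (subst open_subopen, rule ballI)
  fix \<alpha> assume "\<alpha> \<in> {\<alpha>. r < fibre_max f \<alpha>}"
  then obtain \<beta> where \<beta>: "(\<alpha>, \<beta>) \<in> F" "r < apply_bcontfun f (\<alpha>, \<beta>)"
    by (auto simp: less_fibre_max_iff)
  have "open {\<omega>. r < apply_bcontfun f \<omega>}"
    by (intro open_Collect_less continuous_on_const continuous_on_apply_bcontfun)
  then obtain n where n: "cyl (prefix_of \<alpha> n) \<times> cyl (prefix_of \<beta> n) \<subseteq> {\<omega>. r < apply_bcontfun f \<omega>}"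
    using open_contains_cyl_Times[of _ \<alpha> \<beta>] \<beta>(2) by blast
  define T where "T = cyl (prefix_of \<alpha> n) \<inter> proj (prefix_of \<beta> n)"
  have "open T"
    unfolding T_def by (intro open_Int open_cyl open_proj)
  moreover have "\<alpha> \<in> T"
    using \<beta>(1) by (auto simp: T_def mem_cyl_prefix_of proj_def)
  moreover have "T \<subseteq> {\<alpha>. r < fibre_max f \<alpha>}"
    using n by (auto simp: T_def proj_def cyl_def less_fibre_max_iff)
  ultimately show "\<exists>T. open T \<and> \<alpha> \<in> T \<and> T \<subseteq> {\<alpha>. r < fibre_max f \<alpha>}" by blast
qed

lemma fibre_max_measurable [measurable]: "fibre_max f \<in> borel_measurable borel"
  by (rule open_superlevel_imp_borel_measurable[OF open_less_fibre_max])

text \<open>Strassen's theorem. The Hahn-Banach theorem extends integration against \<open>Q\<close> to a functional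
  on \<open>C(\<Omega> \<times> \<Omega>)\<close> below \<open>f \<mapsto> \<integral> max over the fibre of f dP\<close>; this bound encodes
  both the first marginal and the support condition.\<close>

theorem couplable_of_hits:
  assumes P: "P \<in> distributions" and Q: "Q \<in> distributions"
    and hits: "\<And>U. open U \<Longrightarrow> emeasure Q U \<le> emeasure P (hits U)"
  shows "Q \<in> couplable_class F P"
proof -
  interpret P: prob_space P using distributionsD[OF P] by simp
  interpret Q: prob_space Q using distributionsD[OF Q] by simp
  note sets [measurable_cong, simp] = distributionsD(2)[OF P] distributionsD(2)[OF Q]
  note space [simp] = distributionsD(3)[OF P] distributionsD(3)[OF Q]
  define p where "p f = (\<integral>\<alpha>. fibre_max f \<alpha> \<partial>P)" for f
  have int_max [simp]: "integrable P (fibre_max f)" for f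
    by (rule P.integrable_const_bound[of _ "norm f"]) (auto simp: abs_fibre_max_le)
  have meas: "apply_bcontfun (g :: cantor \<Rightarrow>\<^sub>C real) \<in> borel_measurable borel" for g
    by (intro borel_measurable_continuous_onI) simp
  note meas [measurable]
  have int_P [simp]: "integrable P (apply_bcontfun (g :: cantor \<Rightarrow>\<^sub>C real))"
    and int_Q [simp]: "integrable Q (apply_bcontfun (g :: cantor \<Rightarrow>\<^sub>C real))" for g
    using bcontfun_abs_le[of g]
    by (auto intro!: P.integrable_const_bound[of _ "norm g"] Q.integrable_const_bound[of _ "norm g"])
  have p: "sublinear p"
    unfolding sublinear_def
  proof (intro conjI allI impI)
    fix f g
    have "fibre_max (f + g) \<alpha> \<le> fibre_max f \<alpha> + fibre_max g \<alpha>" for \<alpha>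
      by (rule fibre_max_least) (auto intro!: add_mono fibre_max_upper)
    then have "p (f + g) \<le> (\<integral>\<alpha>. fibre_max f \<alpha> + fibre_max g \<alpha> \<partial>P)"
      unfolding p_def by (intro integral_mono) auto
    then show "p (f + g) \<le> p f + p g"
      by (simp add: p_def)
  next
    fix c :: real and f assume c: "0 < c"
    have "fibre_max (c *\<^sub>R f) \<alpha> \<le> c * fibre_max f \<alpha>" for \<alpha>
      using c by (intro fibre_max_least) (auto intro!: mult_left_mono fibre_max_upper)
    then have "p (c *\<^sub>R f) \<le> (\<integral>\<alpha>. c * fibre_max f \<alpha> \<partial>P)"
      unfolding p_def by (intro integral_mono) auto
    then show "p (c *\<^sub>R f) \<le> c * p f"
      by (simp add: p_def)
  qed
  define pull where "pull h g = Bcontfun (\<lambda>\<omega>. apply_bcontfun g (h \<omega>))"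
    for h :: "cantor \<times> cantor \<Rightarrow> cantor" and g :: "cantor \<Rightarrow>\<^sub>C real"
  have pull: "apply_bcontfun (pull h g) = (\<lambda>\<omega>. apply_bcontfun g (h \<omega>))"
    if "continuous_on UNIV h" for h g
    unfolding pull_def
  proof (rule Bcontfun_inverse)
    have "bounded (range (\<lambda>\<omega>. apply_bcontfun g (h \<omega>)))"
      by (rule bounded_subset[OF bounded_apply_bcontfun[of g]]) auto
    then show "(\<lambda>\<omega>. apply_bcontfun g (h \<omega>)) \<in> bcontfun"
      using continuous_on_compose2[OF continuous_on_apply_bcontfun[of UNIV g] that] by (simp add: bcontfun_def)
  qed
  have pull_fst: "apply_bcontfun (pull fst g) \<omega> = apply_bcontfun g (fst \<omega>)"
    and pull_snd: "apply_bcontfun (pull snd g) \<omega> = apply_bcontfun g (snd \<omega>)" for g \<omega>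
    by (simp_all add: pull continuous_on_fst continuous_on_snd)
  have T: "linear (pull snd)"
    by (rule linearI) (auto intro!: bcontfun_eqI simp: pull_snd)
  have q: "linear (\<lambda>g :: cantor \<Rightarrow>\<^sub>C real. \<integral>\<beta>. apply_bcontfun g \<beta> \<partial>Q)"
    by (rule linearI) simp_all
  have q_le_p: "(\<integral>\<beta>. apply_bcontfun g \<beta> \<partial>Q) \<le> p (pull snd g)" for g
    unfolding p_def
  proof (rule integral_le_of_tail_le[OF Q.prob_space_axioms P.prob_space_axioms, of _ _ "max (norm g) (norm (pull snd g))"])
    fix s
    \<comment> \<open>For a function of \<beta> alone, a superlevel set of the fibre maximum is
      \<open>hits\<close> of the superlevel set of the function. The hypothesis on open sets is thus
      the comparison of tails.\<close>
    have "{\<alpha>. s < fibre_max (pull snd g) \<alpha>} = hits {\<beta>. s < apply_bcontfun g \<beta>}"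
      by (auto simp: less_fibre_max_iff pull_snd hits_def)
    moreover have "open {\<beta>. s < apply_bcontfun g \<beta>}"
      by (intro open_Collect_less continuous_on_const continuous_on_apply_bcontfun)
    ultimately show "emeasure Q {x\<in>space Q. s < apply_bcontfun g x} \<le> emeasure P {y\<in>space P. s < fibre_max (pull snd g) y}"
      using hits by simp
  qed (auto intro: max.coboundedI1[OF bcontfun_abs_le] max.coboundedI2[OF abs_fibre_max_le])
  from hahn_banach_extension[OF p T q q_le_p]
  obtain l where l: "linear l" and l_le: "\<And>f. l f \<le> p f"
    and l_snd: "\<And>g. l (pull snd g) = (\<integral>\<beta>. apply_bcontfun g \<beta> \<partial>Q)"
    by blast
  \<comment> \<open>Only the values on F matter. Applied to -f this yields positivity of l; applied
    to the indicator of a box outside F it yields the support condition.\<close>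
  have l_nonpos: "l f \<le> 0" if "\<And>\<alpha> \<beta>. (\<alpha>, \<beta>) \<in> F \<Longrightarrow> apply_bcontfun f (\<alpha>, \<beta>) \<le> 0" for f
  proof -
    have "p f \<le> (\<integral>\<alpha>. 0 \<partial>P)"
      unfolding p_def using that by (intro integral_mono fibre_max_least) auto
    then show ?thesis using l_le[of f] by simp
  qed
  have l_nonneg: "0 \<le> l f" if "\<And>\<omega>. 0 \<le> apply_bcontfun f \<omega>" for f
    using l_nonpos[of "- f"] that by (simp add: linear_neg[OF l])
  \<comment> \<open>A function of \<alpha> alone is constant on each fibre, so p reduces to its
    P-integral; the sign change below turns the bound into the first marginal.\<close>
  have l_fst_le: "l (pull fst g) \<le> (\<integral>\<alpha>. apply_bcontfun g \<alpha> \<partial>P)" for g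
  proof -
    have "p (pull fst g) \<le> (\<integral>\<alpha>. apply_bcontfun g \<alpha> \<partial>P)"
      unfolding p_def by (intro integral_mono fibre_max_least) (auto simp: pull_fst)
    then show ?thesis using l_le[of "pull fst g"] by simp
  qed
  have l_fst: "l (pull fst g) = (\<integral>\<alpha>. apply_bcontfun g \<alpha> \<partial>P)" for g
  proof -
    have "pull fst (- g) = - pull fst g"
      by (rule bcontfun_eqI) (simp add: pull_fst)
    then show ?thesis
      using l_fst_le[of g] l_fst_le[of "- g"] by (simp add: linear_neg[OF l])
  qed
  have "\<exists>S. sets S = sets borel \<and> space S = UNIV \<and>
      (\<forall>A. open A \<longrightarrow> closed A \<longrightarrow> emeasure S A = ennreal (l (clopen_ind A)))"
    by (rule riesz_clopen[OF compact_cantor_Times l, unfolded sigma_sets_clopen_cantor_pair])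
      (rule l_nonneg)
  then obtain S where S: "sets S = sets borel" "space S = UNIV"
    and S_eq: "\<And>A. open A \<Longrightarrow> closed A \<Longrightarrow> emeasure S A = ennreal (l (clopen_ind A))"
    by (elim exE conjE) (rule that, auto)
  note [measurable_cong] = S(1) sets_cantor_algebra
  have vimage: "open (h -` A)" "closed (h -` A)" "clopen_ind (h -` A) = pull h (clopen_ind A)"
    if "continuous_on UNIV h" "open A" "closed A" for h A
  proof -
    show *: "open (h -` A)" "closed (h -` A)"
      using open_vimage[OF that(2,1)] closed_vimage[OF that(3,1)] by auto
    show "clopen_ind (h -` A) = pull h (clopen_ind A)"
      by (rule bcontfun_eqI) (simp add: clopen_ind[OF *] clopen_ind[OF that(2,3)] pull[OF that(1)] indicator_def)
  qed
  have clopen_int: "(\<integral>x. apply_bcontfun (clopen_ind A) x \<partial>M) = measure M A"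
    if "open A" "closed A" "M \<in> {P, Q}" for A :: "cantor set" and M
    using that sets by (auto simp: clopen_ind)
  have S_fst: "emeasure S (fst -` A) = emeasure P A" and S_snd: "emeasure S (snd -` A) = emeasure Q A"
    if "open A" "closed A" for A
    using that vimage[of fst A] vimage[of snd A]
    by (simp_all add: S_eq continuous_on_fst continuous_on_snd l_fst l_snd clopen_int
        P.emeasure_eq_measure Q.emeasure_eq_measure)
  have "prob_space S"
    using S_fst[of UNIV] P.emeasure_space_1 by (intro prob_spaceI) (simp add: S(2))
  interpret S: prob_space S by fact
  have fst: "fst \<in> S \<rightarrow>\<^sub>M cantor_algebra" and snd: "snd \<in> S \<rightarrow>\<^sub>M cantor_algebra"
    by (auto simp: measurable_cong_sets[OF S(1) sets_cantor_algebra] intro!: borel_measurable_continuous_onI continuous_on_fst continuous_on_snd continuous_on_id)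
  have "distr S cantor_algebra fst = P"
  proof (rule distributions_eqI)
    show "distr S cantor_algebra fst \<in> distributions"
      using S.prob_space_distr[OF fst] by (simp add: distributions_def)
  qed (use P fst in \<open>auto simp: emeasure_distr sets_cantor_algebra S(2) S_fst\<close>)
  moreover have "distr S cantor_algebra snd = Q"
  proof (rule distributions_eqI)
    show "distr S cantor_algebra snd \<in> distributions"
      using S.prob_space_distr[OF snd] by (simp add: distributions_def)
  qed (use Q snd in \<open>auto simp: emeasure_distr sets_cantor_algebra S(2) S_snd\<close>)
  moreover have "- F \<in> null_sets S"
  proof -
    \<comment> \<open>The complement of F is a union of boxes indexed by pairs of strings, hence
      countable, and on each box \<open>l_nonpos\<close> forces measure 0.\<close>
    define I where "I = {(x, y). cyl x \<times> cyl y \<subseteq> - F}"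
    have "- F = (\<Union>(x, y)\<in>I. cyl x \<times> cyl y)"
    proof
      show "- F \<subseteq> (\<Union>(x, y)\<in>I. cyl x \<times> cyl y)"
      proof
        fix \<omega> assume "\<omega> \<in> - F"
        moreover obtain \<alpha> \<beta> where \<omega>: "\<omega> = (\<alpha>, \<beta>)" by fastforce
        ultimately obtain n where n: "cyl (prefix_of \<alpha> n) \<times> cyl (prefix_of \<beta> n) \<subseteq> - F"
          using open_contains_cyl_Times[of "- F" \<alpha> \<beta>] closed_rel by (auto simp: closed_def)
        show "\<omega> \<in> (\<Union>(x, y)\<in>I. cyl x \<times> cyl y)"
          using n by (intro UN_I[of "(prefix_of \<alpha> n, prefix_of \<beta> n)"]) (auto simp: I_def \<omega> mem_cyl_prefix_of)
      qed
    qed (auto simp: I_def)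
    also have "\<dots> \<in> null_sets S"
    proof (rule null_sets_UN')
      fix xy assume xy: "xy \<in> I"
      obtain x y where [simp]: "xy = (x, y)" by fastforce
      have clopen: "open (cyl x \<times> cyl y)" "closed (cyl x \<times> cyl y)"
        by (auto intro: open_Times closed_Times open_cyl closed_cyl)
      have "l (clopen_ind (cyl x \<times> cyl y)) \<le> 0"
        using xy by (intro l_nonpos) (auto simp: clopen_ind[OF clopen] I_def indicator_def)
      then have "emeasure S (cyl x \<times> cyl y) = 0"
        by (simp add: S_eq[OF clopen] ennreal_neg)
      then show "(case xy of (x, y) \<Rightarrow> cyl x \<times> cyl y) \<in> null_sets S"
        using clopen by (auto simp: null_sets_def S(1))
    qed simp
    finally show ?thesis .
  qed
  ultimately show ?thesis
    unfolding couplable_class_def couplable_def using Q \<open>prob_space S\<close> S(1) sets_cantor_algebra_pair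
    by (auto intro!: exI[of _ S])
qed

text \<open>A violating open U is exhausted by the cylinders of length n inside it, so Q already
  violates the bound at some n, while the projections stay inside \<open>hits U\<close>. A common
  length makes the cylinders disjoint and the Q-measure a plain sum.\<close>

lemma not_couplable_witness:
  assumes P: "P \<in> distributions" and Q: "Q \<in> distributions" and not: "Q \<notin> couplable_class F P"
  shows "\<exists>n Y. Y \<subseteq> {y. length y = n} \<and> measure P (\<Union>y\<in>Y. proj y) < (\<Sum>y\<in>Y. measure Q (cyl y))"
proof -
  interpret P: prob_space P using distributionsD[OF P] by simp
  interpret Q: prob_space Q using distributionsD[OF Q] by simp
  note sets [simp] = distributionsD(2)[OF P] distributionsD(2)[OF Q]
  obtain U where U: "open U" "measure P (hits U) < measure Q U"
    using couplable_of_hits[OF P Q] not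
    by (auto simp: P.emeasure_eq_measure Q.emeasure_eq_measure not_le[symmetric])
  define Y where "Y n = {y. length y = n \<and> cyl y \<subseteq> U}" for n
  define V where "V n = (\<Union>y\<in>Y n. cyl y)" for n
  have V_iff: "\<omega> \<in> V n \<longleftrightarrow> cyl (prefix_of \<omega> n) \<subseteq> U" for \<omega> n
  proof
    assume "\<omega> \<in> V n"
    then show "cyl (prefix_of \<omega> n) \<subseteq> U"
      by (auto simp: V_def Y_def cyl_def prefix_of_length)
  qed (auto simp: V_def Y_def intro!: exI[of _ "prefix_of \<omega> n"] mem_cyl_prefix_of)
  have "incseq V"
    unfolding incseq_def using cyl_prefix_of_mono by (intro allI impI subsetI) (simp add: V_iff, blast)
  moreover have "(\<Union>n. V n) = U"
  proof (rule set_eqI)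
    fix \<omega>
    show "\<omega> \<in> (\<Union>n. V n) \<longleftrightarrow> \<omega> \<in> U"
      using open_contains_cyl[OF U(1), of \<omega>] mem_cyl_prefix_of[of \<omega>] by (simp only: UN_iff V_iff) blast
  qed
  ultimately have V: "incseq V" "(\<Union>n. V n) = U" .
  have V_sets: "open (V n)" for n
    unfolding V_def by (auto intro: open_cyl)
  have "(\<lambda>n. measure Q (V n)) \<longlonglongrightarrow> measure Q U"
    using Q.finite_Lim_measure_incseq[of V] V V_sets by (simp add: image_subset_iff)
  then have "\<forall>\<^sub>F n in sequentially. measure P (hits U) < measure Q (V n)"
    using U(2) by (rule order_tendstoD(1))
  then obtain n where n: "measure P (hits U) < measure Q (V n)"
    by (auto simp: eventually_sequentially)
  have "finite (Y n)"
    by (rule finite_subset[OF _ finite_lists_length_eq[of UNIV n]]) (auto simp: Y_def)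
  then have "measure Q (V n) = (\<Sum>y\<in>Y n. measure Q (cyl y))"
    unfolding V_def by (intro Q.finite_measure_finite_Union)
      (auto simp: open_cyl disjoint_family_on_def Y_def dest: cyl_disjoint)
  moreover have "measure P (\<Union>y\<in>Y n. proj y) \<le> measure P (hits U)"
  proof (rule P.finite_measure_mono)
    show "(\<Union>y\<in>Y n. proj y) \<subseteq> hits U"
      unfolding hits_cyl[symmetric] by (auto simp: hits_def Y_def)
  qed (use open_hits[OF U(1)] in simp)
  ultimately show ?thesis
    using n by (intro exI[of _ n] exI[of _ "Y n"]) (auto simp: Y_def)
qed

text \<open>The easy converse of Strassen's criterion: under a coupling, almost all mass over U
  comes from points of \<open>hits U\<close>.\<close>

lemma couplable_hits:
  assumes "Q \<in> couplable_class F P" "P \<in> distributions" "open U"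
  shows "measure Q U \<le> measure P (hits U)"
proof -
  interpret P: prob_space P using distributionsD[OF assms(2)] by simp
  have Q: "Q \<in> distributions" using assms(1) by (simp add: couplable_class_def)
  interpret Q: prob_space Q using distributionsD[OF Q] by simp
  note sets [simp] = distributionsD(2)[OF assms(2)] distributionsD(2)[OF Q]
  have "(\<integral>\<^sup>+\<beta>. indicator U \<beta> \<partial>Q) \<le> (\<integral>\<^sup>+\<alpha>. indicator (hits U) \<alpha> \<partial>P)"
  proof (rule coupling_nn_integral_le[OF assms(1)])
    show "indicator U \<beta> \<le> (indicator (hits U) \<alpha> :: ennreal)" if "(\<alpha>, \<beta>) \<in> F" for \<alpha> \<beta>
      using that by (auto simp: indicator_def hits_def)
  qed (use assms(3) open_hits[OF assms(3)] in auto)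
  then show ?thesis
    using assms(3) open_hits[OF assms(3)]
    by (simp add: P.emeasure_eq_measure Q.emeasure_eq_measure)
qed

end

section \<open>Effectiveness of projections, fibres and the class\<close>

lemma starts_with_compatible:
  assumes "starts_with \<omega> x" "starts_with \<omega> y" shows "compatible x y"
  using assms unfolding starts_with_def compatible_def by (metis min_less_iff_conj)

lemma starts_with_shorter:
  assumes "starts_with \<omega> x" "compatible y x" "length y \<le> length x" shows "starts_with \<omega> y"
  using assms unfolding starts_with_def compatible_def by (metis min_absorb1 order_less_le_trans)

lemma exists_starts_with: "\<exists>\<omega>. starts_with \<omega> x"
  by (rule exI[of _ "\<lambda>i. x ! i"]) (simp add: starts_with_def)

context clopen_relation
begin

text \<open>\<open>hits\<close> commutes with unions, so an enumeration of cylinders is translated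
  string by string, each y being replaced by the finite list that describes
  \<open>proj y\<close>.\<close>

lemma unif_effectively_open_hits:
  assumes clopen: "computable_clopen proj" and U: "unif_effectively_open ci I U"
    and ci: "effective_code ci"
  shows "unif_effectively_open ci I (\<lambda>i. hits (U i))"
proof -
  obtain D where D: "computable string_code (list_code string_code) D"
    and proj_eq: "\<And>y. proj y = (\<Union>x\<in>set (D y). cyl x)"
    using clopen unfolding computable_clopen_def by blast
  obtain A where A: "comp_enumerable (pair_code ci string_code) A"
    and U_eq: "\<And>i. i \<in> I \<Longrightarrow> U i = (\<Union>x\<in>{x. (i, x) \<in> A}. cyl x)"
    using U unfolding unif_effectively_open_def by blast
  have code: "effective_code (pair_code ci string_code)"
    by (intro effective_code_pair ci effective_code_string)
  define B where "B = {p. \<exists>y. (fst p, y) \<in> A \<and> snd p \<in> set (D y)}"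
  have "comp_enumerable (pair_code ci string_code) B"
    unfolding B_def
    by (rule comp_enumerableI[OF code], unfold mem_Collect_eq)
      (intro semidecidable_ex[OF effective_code_string] semidecidable_conj
        semidecidable_mem[OF effective_code_inj[OF code] A] decidable_imp_semidecidable
        decidable_mem[OF inj_string_code] computable_comp[OF D] computable_Pair computable_fst
        computable_snd, (rule computable_ident)+)
  moreover have "hits (U i) = (\<Union>x\<in>{x. (i, x) \<in> B}. cyl x)" if "i \<in> I" for i
    unfolding U_eq[OF that] hits_UN hits_cyl proj_eq by (auto simp: B_def)
  ultimately show ?thesis
    unfolding unif_effectively_open_def by blast
qed

end

text \<open>A \<beta> with empty fibre lies in \<open>core F U\<close> for every U, in accordance
  with the infimum over the empty set being infinite.\<close>

definition core :: "(cantor \<times> cantor) set \<Rightarrow> cantor set \<Rightarrow> cantor set" where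
  "core F U = {\<beta>. \<forall>\<alpha>. (\<alpha>, \<beta>) \<in> F \<longrightarrow> \<alpha> \<in> U}"

text \<open>By compactness, the whole fibre over \<open>\<beta>\<close> lies in \<open>U\<close> as soon as some prefix length
  \<open>n\<close> suffices to place every string of length \<open>n\<close> in \<open>U\<close> or to exclude it from the fibre.\<close>

lemma unif_effectively_open_core:
  assumes F: "effectively_closed F" and U: "unif_effectively_open ci I U" and ci: "effective_code ci"
  shows "unif_effectively_open ci I (\<lambda>i. core F (U i))"
proof -
  obtain B where B: "comp_enumerable (pair_code string_code string_code) B"
    and F_eq: "- F = (\<Union>(x, y)\<in>B. cyl x \<times> cyl y)"
    using F unfolding effectively_closed_def by blast
  obtain A where A: "comp_enumerable (pair_code ci string_code) A"
    and U_eq: "\<And>i. i \<in> I \<Longrightarrow> U i = (\<Union>x\<in>{x. (i, x) \<in> A}. cyl x)"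
    using U unfolding unif_effectively_open_def by blast
  \<comment> \<open>With the length conditions, \<open>compatible\<close> means being a prefix:
    every point over x is then known to lie in U i, or the whole box of x and y is known to miss
    F.\<close>
  define covered where "covered i x y \<longleftrightarrow>
      (\<exists>u. (i, u) \<in> A \<and> length u \<le> length x \<and> compatible u x) \<or>
      (\<exists>u v. (u, v) \<in> B \<and> (length u \<le> length x \<and> compatible u x) \<and> length v \<le> length y \<and> compatible v y)"
    for i x y
  define C where "C = {p. \<forall>x. length x = length (snd p) \<longrightarrow> covered (fst p) x (snd p)}"
  have code: "effective_code (pair_code ci string_code)" "effective_code (pair_code string_code string_code)"
    by (intro effective_code_pair ci effective_code_string)+
  have "comp_enumerable (pair_code ci string_code) C"
    unfolding C_def covered_def
    by (rule comp_enumerableI[OF code(1)], unfold mem_Collect_eq)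
      (intro semidecidable_all_strings semidecidable_disj semidecidable_ex[OF effective_code_string] semidecidable_conj
        semidecidable_mem[OF effective_code_inj[OF code(1)] A]
        semidecidable_mem[OF effective_code_inj[OF code(2)] B] decidable_imp_semidecidable
        decidable_le decidable_compatible computable_length[of _ of_bool, folded string_code_def]
        computable_Pair computable_fst computable_snd, (rule computable_ident)+)
  moreover have "core F (U i) = (\<Union>y\<in>{y. (i, y) \<in> C}. cyl y)" if i: "i \<in> I" for i
  proof (intro equalityI subsetI)
    fix \<beta> assume "\<beta> \<in> (\<Union>y\<in>{y. (i, y) \<in> C}. cyl y)"
    then obtain y where y: "(i, y) \<in> C" "starts_with \<beta> y" by (auto simp: cyl_def)
    have "\<alpha> \<in> U i" if \<alpha>: "(\<alpha>, \<beta>) \<in> F" for \<alpha>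
    proof -
      let ?x = "prefix_of \<alpha> (length y)"
      have x: "starts_with \<alpha> ?x" by simp
      have "covered i ?x y" using y(1) by (simp add: C_def)
      then consider u where "(i, u) \<in> A" "length u \<le> length ?x" "compatible u ?x"
        | u v where "(u, v) \<in> B" "length u \<le> length ?x" "compatible u ?x" "length v \<le> length y" "compatible v y"
        unfolding covered_def by blast
      then show ?thesis
      proof cases
        case 1
        then show ?thesis using starts_with_shorter[OF x] by (auto simp: U_eq[OF i] cyl_def)
      next
        case 2
        then have "(\<alpha>, \<beta>) \<in> - F"
          using starts_with_shorter[OF x] starts_with_shorter[OF y(2)] unfolding F_eq
          by (intro UN_I[of "(u, v)"]) (auto simp: cyl_def)
        then show ?thesis using \<alpha> by simp
      qed
    qed
    then show "\<beta> \<in> core F (U i)" by (simp add: core_def)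
  next
    fix \<beta> assume \<beta>: "\<beta> \<in> core F (U i)"
    \<comment> \<open>These sets are open and increase with n, so compactness yields one n that
      serves all \<alpha> simultaneously.\<close>
    define good where "good n = {\<alpha>. covered i (prefix_of \<alpha> n) (prefix_of \<beta> n)}" for n
    have good_mono: "good m \<subseteq> good n" if "m \<le> n" for m n
    proof -
      have "compatible u (prefix_of \<omega> n)" if "compatible u (prefix_of \<omega> m)" "length u \<le> m" for u \<omega>
        using that \<open>m \<le> n\<close> by (auto simp: compatible_def)
      then show ?thesis
        using that by (auto simp: good_def covered_def) (meson order_trans)+
    qed
    have "\<alpha> \<in> (\<Union>n. good n)" for \<alpha>
    proof (cases "\<alpha> \<in> U i")
      case True
      then obtain u where u: "(i, u) \<in> A" "starts_with \<alpha> u"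
        by (auto simp: U_eq[OF i] cyl_def)
      then have "\<alpha> \<in> good (length u)"
        using starts_with_compatible[OF u(2) starts_with_prefix_of] by (auto simp: good_def covered_def)
      then show ?thesis by blast
    next
      case False
      then have "(\<alpha>, \<beta>) \<in> - F" using \<beta> by (auto simp: core_def)
      then obtain u v where uv: "(u, v) \<in> B" "starts_with \<alpha> u" "starts_with \<beta> v"
        unfolding F_eq by (auto simp: cyl_def)
      have "covered i (prefix_of \<alpha> (max (length u) (length v))) (prefix_of \<beta> (max (length u) (length v)))"
        unfolding covered_def
        using uv(1) starts_with_compatible[OF uv(2) starts_with_prefix_of]
          starts_with_compatible[OF uv(3) starts_with_prefix_of]
        by (intro disjI2 exI[of _ u] exI[of _ v]) simp
      then show ?thesis unfolding good_def by blast
    qed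
    then have cover: "UNIV \<subseteq> (\<Union>n. good n)" by blast
    have "open (good n)" for n
    proof -
      have "good n = (\<Union>x\<in>{x. length x = n \<and> covered i x (prefix_of \<beta> n)}. cyl x)"
        by (auto simp: good_def cyl_def prefix_of_length intro!: exI[of _ "prefix_of _ n"])
      then show ?thesis by (auto intro: open_cyl)
    qed
    then obtain N where N: "finite N" "UNIV \<subseteq> (\<Union>n\<in>N. good n)"
      by (rule compactE_image[OF compact_cantor _ cover]) auto
    define n where "n = Max (insert 0 N)"
    have "m \<le> n" if "m \<in> N" for m
      using that N(1) by (simp add: n_def)
    then have "UNIV \<subseteq> good n"
      using N(2) good_mono by blast
    have "covered i x (prefix_of \<beta> n)" if x: "length x = n" for x
    proof -
      obtain \<alpha> where "starts_with \<alpha> x" using exists_starts_with by blast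
      moreover have "\<alpha> \<in> good n" using \<open>UNIV \<subseteq> good n\<close> by blast
      ultimately show ?thesis
        using prefix_of_length[of \<alpha> x] x by (simp add: good_def)
    qed
    then have "(i, prefix_of \<beta> n) \<in> C"
      by (simp add: C_def)
    then show "\<beta> \<in> (\<Union>y\<in>{y. (i, y) \<in> C}. cyl y)"
      using mem_cyl_prefix_of by blast
  qed
  ultimately show ?thesis
    unfolding unif_effectively_open_def by blast
qed

section \<open>Upper estimates for P and enumeration of the complement of the class\<close>

lemma computable_recursive2:
  assumes g: "recursive 2 g" and f: "computable ca cb f" and h: "computable ca id h"
  shows "computable ca id (\<lambda>x. g [cb (f x), h x])"
proof -
  have "rf1 (\<lambda>n. g [pfst n, psnd n])"
    by (rule rf1_comp2[OF rf2_recursive[OF g]]) (intro rf1_intros)+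
  from computable_rf1_pair[OF this computable_list_code[OF f] h] show ?thesis .
qed

text \<open>The \<open>Suc\<close> absorbs the error of the approximation \<open>g\<close> and \<open>compatible\<close> over-approximates
  \<open>D y\<close>, so that \<open>upper_count D g m k Y / 2 ^ k\<close> bounds a measure from above for all \<open>m\<close>.\<close>

definition upper_count :: "(bool list \<Rightarrow> bool list list) \<Rightarrow> (nat list \<Rightarrow> nat) \<Rightarrow> nat \<Rightarrow> nat \<Rightarrow> bool list set \<Rightarrow> nat" where
  "upper_count D g m k Y =
    (\<Sum>z | length z = m. of_bool (\<exists>y\<in>Y. \<exists>x\<in>set (D y). compatible x z) * Suc (g [string_code z, k]))"

context clopen_relation
begin

lemma measure_proj_le_upper_count:
  assumes P: "P \<in> distributions" and g: "\<And>x k. \<bar>measure P (cyl x) - real (g [string_code x, k]) / 2 ^ k\<bar> \<le> 1 / 2 ^ k"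
    and D: "\<And>y. proj y = (\<Union>x\<in>set (D y). cyl x)" and Y: "finite Y"
  shows "2 ^ k * measure P (\<Union>y\<in>Y. proj y) \<le> real (upper_count D g m k Y)"
proof -
  interpret P: prob_space P using distributionsD[OF P] by simp
  note sets [simp] = distributionsD(2)[OF P]
  define Z where "Z = {z. length z = m \<and> (\<exists>y\<in>Y. \<exists>x\<in>set (D y). compatible x z)}"
  have finZ: "finite Z"
    by (rule finite_subset[OF _ finite_strings[of m]]) (auto simp: Z_def)
  have "(\<Union>y\<in>Y. proj y) \<subseteq> (\<Union>z\<in>Z. cyl z)"
  proof
    fix \<alpha> assume "\<alpha> \<in> (\<Union>y\<in>Y. proj y)"
    then obtain y x where yx: "y \<in> Y" "x \<in> set (D y)" "starts_with \<alpha> x"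
      unfolding D by (auto simp: cyl_def)
    then have "prefix_of \<alpha> m \<in> Z"
      using starts_with_compatible[OF yx(3) starts_with_prefix_of] by (auto simp: Z_def)
    then show "\<alpha> \<in> (\<Union>z\<in>Z. cyl z)" using mem_cyl_prefix_of by blast
  qed
  then have "measure P (\<Union>y\<in>Y. proj y) \<le> measure P (\<Union>z\<in>Z. cyl z)"
    using finZ by (intro P.finite_measure_mono) (auto intro: borel_open open_cyl)
  also have "\<dots> \<le> (\<Sum>z\<in>Z. measure P (cyl z))"
    by (intro P.finite_measure_subadditive_finite finZ) (auto intro: borel_open open_cyl)
  finally have "2 ^ k * measure P (\<Union>y\<in>Y. proj y) \<le> (\<Sum>z\<in>Z. 2 ^ k * measure P (cyl z))"
    by (simp flip: sum_distrib_left)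
  also have "\<dots> \<le> (\<Sum>z\<in>Z. real (Suc (g [string_code z, k])))"
    using g by (intro sum_mono) (simp add: abs_le_iff field_simps)
  also have "\<dots> = real (\<Sum>z\<in>Z. Suc (g [string_code z, k]))"
    by simp
  also have "(\<Sum>z\<in>Z. Suc (g [string_code z, k])) = upper_count D g m k Y"
    unfolding upper_count_def using finite_strings[of m]
    by (intro sum.mono_neutral_cong_left) (auto simp: Z_def)
  finally show ?thesis .
qed

text \<open>Once m reaches all listed lengths, compatible strings lie inside the projections. What
  remains is the error of g: at most 2 for each of at most 2^m strings, a quantity independent of
  k.\<close>

lemma upper_count_le:
  assumes P: "P \<in> distributions" and g: "\<And>x k. \<bar>measure P (cyl x) - real (g [string_code x, k]) / 2 ^ k\<bar> \<le> 1 / 2 ^ k"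
    and D: "\<And>y. proj y = (\<Union>x\<in>set (D y). cyl x)"
    and m: "\<And>y x. y \<in> Y \<Longrightarrow> x \<in> set (D y) \<Longrightarrow> length x \<le> m"
  shows "real (upper_count D g m k Y) \<le> 2 ^ k * measure P (\<Union>y\<in>Y. proj y) + 2 * 2 ^ m"
proof -
  interpret P: prob_space P using distributionsD[OF P] by simp
  note sets [simp] = distributionsD(2)[OF P]
  define Z where "Z = {z. length z = m \<and> (\<exists>y\<in>Y. \<exists>x\<in>set (D y). compatible x z)}"
  have finZ: "finite Z"
    by (rule finite_subset[OF _ finite_strings[of m]]) (auto simp: Z_def)
  have "card {z :: bool list. length z = m} = 2 ^ m"
    using card_lists_length_eq[of "UNIV :: bool set" m] by simp
  then have cardZ: "card Z \<le> 2 ^ m"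
    using card_mono[OF finite_strings[of m], of Z] by (auto simp: Z_def)
  have "(\<Union>z\<in>Z. cyl z) \<subseteq> (\<Union>y\<in>Y. proj y)"
  proof
    fix \<alpha> assume "\<alpha> \<in> (\<Union>z\<in>Z. cyl z)"
    then obtain z y x where z: "starts_with \<alpha> z" "length z = m" "y \<in> Y" "x \<in> set (D y)" "compatible x z"
      by (auto simp: Z_def cyl_def)
    then have "starts_with \<alpha> x"
      using starts_with_shorter[OF z(1,5)] m by simp
    then show "\<alpha> \<in> (\<Union>y\<in>Y. proj y)"
      using z unfolding D by (auto simp: cyl_def)
  qed
  then have "measure P (\<Union>z\<in>Z. cyl z) \<le> measure P (\<Union>y\<in>Y. proj y)"
    by (intro P.finite_measure_mono) (auto intro!: borel_open open_UN open_proj)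
  moreover have "measure P (\<Union>z\<in>Z. cyl z) = (\<Sum>z\<in>Z. measure P (cyl z))"
    by (intro P.finite_measure_finite_Union finZ)
      (auto simp: Z_def disjoint_family_on_def dest: cyl_disjoint intro: borel_open open_cyl)
  moreover have "real (upper_count D g m k Y) = (\<Sum>z\<in>Z. real (Suc (g [string_code z, k])))"
  proof -
    have "upper_count D g m k Y = (\<Sum>z\<in>Z. Suc (g [string_code z, k]))"
      unfolding upper_count_def using finite_strings[of m]
      by (intro sum.mono_neutral_cong_right) (auto simp: Z_def)
    then show ?thesis by simp
  qed
  moreover have "\<dots> \<le> (\<Sum>z\<in>Z. 2 ^ k * measure P (cyl z) + 2)"
    using g by (intro sum_mono) (simp add: abs_le_iff field_simps)
  moreover have "\<dots> = 2 ^ k * (\<Sum>z\<in>Z. measure P (cyl z)) + 2 * real (card Z)"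
    by (simp add: sum.distrib sum_distrib_left)
  moreover have "real (card Z) \<le> 2 ^ m"
    using cardZ by (metis of_nat_le_iff of_nat_numeral of_nat_power)
  ultimately show ?thesis
    by (smt (verit) mult_left_mono zero_le_power)
qed

text \<open>A certificate, stated in natural numbers, that the lower bounds in l already exceed an
  upper estimate of the P-measure of the projections. The common denominator N permits
  cross-multiplication; equal lengths and the absence of two entries for one string make the sum of
  lower bounds a sum over disjoint cylinders.\<close>

definition excluding :: "(bool list \<Rightarrow> bool list list) \<Rightarrow> (nat list \<Rightarrow> nat) \<Rightarrow> (bool list \<times> rat \<times> rat) list \<Rightarrow> nat \<Rightarrow> nat \<Rightarrow> nat \<Rightarrow> nat \<Rightarrow> bool" where
  "excluding D g l n N m k \<longleftrightarrow>
     (\<forall>e\<in>set l. length (fst e) = n) \<and> (\<forall>e\<in>set l. \<forall>e'\<in>set l. fst e = fst e' \<longrightarrow> e = e') \<and>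
     (\<forall>e\<in>set l. rat_den (fst (snd e)) = N) \<and>
     N * upper_count D g m k (fst ` set l) < 2 ^ k * (\<Sum>e\<in>set l. rat_num (fst (snd e)))"

lemma of_rat_num_den: "real_of_rat r = real_of_int (fst (quotient_of r)) / real (rat_den r)"
proof -
  have "of_rat (Fract (fst (quotient_of r)) (snd (quotient_of r))) =
      real_of_int (fst (quotient_of r)) / real_of_int (snd (quotient_of r))"
    using quotient_of_denom_pos'[of r] by (simp add: of_rat_rat del: Fract_quotient_of)
  then show ?thesis
    using quotient_of_denom_pos'[of r] by (simp add: rat_den_def)
qed

lemma rat_den_pos: "0 < rat_den r"
  using quotient_of_denom_pos'[of r] by (simp add: rat_den_def)

lemma excluding_sound:
  assumes P: "P \<in> distributions" and g: "\<And>x k. \<bar>measure P (cyl x) - real (g [string_code x, k]) / 2 ^ k\<bar> \<le> 1 / 2 ^ k"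
    and D: "\<And>y. proj y = (\<Union>x\<in>set (D y). cyl x)"
    and ex: "excluding D g l n N m k" and Q: "Q \<in> basic_open l"
  shows "Q \<notin> couplable_class F P"
proof
  assume coup: "Q \<in> couplable_class F P"
  have Qd: "Q \<in> distributions" using Q by (simp add: basic_open_def)
  interpret Q: prob_space Q using distributionsD[OF Qd] by simp
  interpret P: prob_space P using distributionsD[OF P] by simp
  note sets [simp] = distributionsD(2)[OF Qd] distributionsD(2)[OF P]
  let ?Y = "fst ` set l"
  have len: "\<And>e. e \<in> set l \<Longrightarrow> length (fst e) = n" and inj: "inj_on fst (set l)"
    and den: "\<And>e. e \<in> set l \<Longrightarrow> rat_den (fst (snd e)) = N"
    and less: "N * upper_count D g m k ?Y < 2 ^ k * (\<Sum>e\<in>set l. rat_num (fst (snd e)))"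
    using ex unfolding excluding_def inj_on_def by blast+
  \<comment> \<open>An empty list has right-hand side 0 in the strict inequality; an entry of l
    supplies the positivity of N.\<close>
  have "set l \<noteq> {}" using less by auto
  then have N: "0 < N" using den rat_den_pos by (metis all_not_in_conv)
  have num: "real (rat_num (fst (snd e))) \<le> N * measure Q (cyl (fst e))" if e: "e \<in> set l" for e
  proof -
    have "of_rat (fst (snd e)) < measure Q (cyl (fst e))"
      using Q e by (cases e) (fastforce simp: basic_open_def)
    then have "real_of_int (fst (quotient_of (fst (snd e)))) < N * measure Q (cyl (fst e))"
      using N den[OF e] by (simp add: of_rat_num_den field_simps)
    then show ?thesis
      using N by (cases "0 \<le> fst (quotient_of (fst (snd e)))") (auto simp: rat_num_def)
  qed
  have "measure Q (\<Union>y\<in>?Y. cyl y) = (\<Sum>y\<in>?Y. measure Q (cyl y))"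
  proof (intro Q.finite_measure_finite_Union)
    show "disjoint_family_on cyl ?Y"
      unfolding disjoint_family_on_def by (intro ballI impI cyl_disjoint) (auto dest!: len)
  qed (auto intro: borel_open open_cyl)
  also have "\<dots> = (\<Sum>e\<in>set l. measure Q (cyl (fst e)))"
    by (rule sum.reindex_cong[OF inj]) auto
  finally have Q_eq: "measure Q (\<Union>y\<in>?Y. cyl y) = (\<Sum>e\<in>set l. measure Q (cyl (fst e)))" .
  have "real (2 ^ k * (\<Sum>e\<in>set l. rat_num (fst (snd e)))) \<le> 2 ^ k * (N * measure Q (\<Union>y\<in>?Y. cyl y))"
  proof -
    have "(\<Sum>e\<in>set l. real (rat_num (fst (snd e)))) \<le> N * measure Q (\<Union>y\<in>?Y. cyl y)"
      unfolding Q_eq sum_distrib_left by (rule sum_mono[OF num])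
    then show ?thesis by simp
  qed
  also have "measure Q (\<Union>y\<in>?Y. cyl y) \<le> measure P (\<Union>y\<in>?Y. proj y)"
  proof -
    have "open (\<Union>y\<in>?Y. cyl y)"
      by (intro open_UN ballI open_cyl)
    from couplable_hits[OF coup P this] show ?thesis
      by (simp only: hits_UN hits_cyl)
  qed
  also have "2 ^ k * (N * measure P (\<Union>y\<in>?Y. proj y)) \<le> N * real (upper_count D g m k ?Y)"
    using mult_left_mono[OF measure_proj_le_upper_count[OF P g D, of ?Y k m], of "real N"]
    by (simp add: ac_simps)
  finally have "real (2 ^ k * (\<Sum>e\<in>set l. rat_num (fst (snd e)))) \<le> real (N * upper_count D g m k ?Y)"
    by (simp add: mult_left_mono)
  then show False
    using less by (simp only: of_nat_le_iff)
qed

lemma excluding_complete: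
  assumes P: "P \<in> distributions" and g: "\<And>x k. \<bar>measure P (cyl x) - real (g [string_code x, k]) / 2 ^ k\<bar> \<le> 1 / 2 ^ k"
    and D: "\<And>y. proj y = (\<Union>x\<in>set (D y). cyl x)"
    and Qd: "Q \<in> distributions" and Q: "Q \<notin> couplable_class F P"
  shows "\<exists>l n N m k. excluding D g l n N m k \<and> Q \<in> basic_open l"
proof -
  interpret Q: prob_space Q using distributionsD[OF Qd] by simp
  interpret P: prob_space P using distributionsD[OF P] by simp
  note sets [simp] = distributionsD(2)[OF Qd] distributionsD(2)[OF P]
  obtain n Y0 where Y0: "Y0 \<subseteq> {y. length y = n}" "measure P (\<Union>y\<in>Y0. proj y) < (\<Sum>y\<in>Y0. measure Q (cyl y))"
    using not_couplable_witness[OF P Qd Q] by blast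
  \<comment> \<open>A strict lower bound for a cylinder of measure 0 would have to be negative.
    Dropping such cylinders keeps the Q-sum and can only shrink the projections.\<close>
  define Y where "Y = {y \<in> Y0. 0 < measure Q (cyl y)}"
  have fin0: "finite Y0" using finite_subset[OF Y0(1) finite_strings] .
  then have fin: "finite Y" by (simp add: Y_def)
  have "measure P (\<Union>y\<in>Y. proj y) \<le> measure P (\<Union>y\<in>Y0. proj y)"
    by (intro P.finite_measure_mono) (auto simp: Y_def intro!: borel_open open_UN open_proj)
  also note Y0(2)
  also have "(\<Sum>y\<in>Y0. measure Q (cyl y)) = (\<Sum>y\<in>Y. measure Q (cyl y))"
    unfolding Y_def by (intro sum.mono_neutral_right fin0) (auto simp: not_less measure_le_0_iff)
  finally have gap: "measure P (\<Union>y\<in>Y. proj y) < (\<Sum>y\<in>Y. measure Q (cyl y))" .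
  define \<delta> where "\<delta> = (\<Sum>y\<in>Y. measure Q (cyl y)) - measure P (\<Union>y\<in>Y. proj y)"
  have "0 < \<delta>" using gap by (simp add: \<delta>_def)
  \<comment> \<open>For N > R, the first summand makes every N Q(y) exceed 1, and the second makes
    the total rounding loss, at most \<open>card Y\<close>, smaller than N \<delta>.\<close>
  define R where "R = (\<Sum>y\<in>Y. 1 / measure Q (cyl y)) + card Y / \<delta>"
  \<comment> \<open>A prime \<open>N\<close> keeps the fractions \<open>M y / N\<close> below in lowest terms.\<close>
  obtain N where N: "prime N" "nat \<lceil>R\<rceil> < N"
    using bigger_prime by blast
  then have "R < real N" by linarith
  have N_pos: "0 < N" using prime_gt_0_nat[OF N(1)] .
  have Q_pos: "0 < measure Q (cyl y)" if "y \<in> Y" for y using that by (simp add: Y_def)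
  have NQ: "1 < N * measure Q (cyl y)" if y: "y \<in> Y" for y
  proof -
    have "1 / measure Q (cyl y) \<le> (\<Sum>y\<in>Y. 1 / measure Q (cyl y))"
      by (rule member_le_sum[OF y _ fin]) (simp add: less_imp_le Q_pos)
    also have "\<dots> \<le> R" using \<open>0 < \<delta>\<close> by (simp add: R_def)
    also note \<open>R < real N\<close>
    finally show ?thesis using Q_pos[OF y] by (simp add: field_simps)
  qed
  have "card Y / \<delta> \<le> R"
    unfolding R_def using Q_pos by (simp add: sum_nonneg less_imp_le)
  then have "card Y \<le> R * \<delta>"
    using \<open>0 < \<delta>\<close> by (simp add: field_simps)
  also have "R * \<delta> < N * \<delta>"
    using \<open>R < real N\<close> \<open>0 < \<delta>\<close> by (rule mult_strict_right_mono)
  finally have N\<delta>: "card Y < N * \<delta>" .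
  \<comment> \<open>The largest integer strictly below N Q(y): the conditions of
    \<open>basic_open\<close> are strict, and at most 1 is lost per string.\<close>
  define M where "M y = nat (\<lceil>N * measure Q (cyl y)\<rceil> - 1)" for y
  have M: "0 < M y" "M y < N" "real (M y) < N * measure Q (cyl y)" "N * measure Q (cyl y) \<le> real (M y) + 1" if y: "y \<in> Y" for y
  proof -
    have *: "1 < \<lceil>N * measure Q (cyl y)\<rceil>" using NQ[OF y] by simp
    then show "0 < M y" by (simp add: M_def)
    have eq: "real (M y) = \<lceil>N * measure Q (cyl y)\<rceil> - 1" using * by (simp add: M_def)
    show "N * measure Q (cyl y) \<le> real (M y) + 1"
      unfolding eq by simp
    show "real (M y) < N * measure Q (cyl y)"
      unfolding eq by linarith
    also have "N * measure Q (cyl y) \<le> N"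
      by (simp add: mult_left_le)
    finally show "M y < N" by simp
  qed
  \<comment> \<open>The upper bound 2 is larger than any probability.\<close>
  define entry where "entry y = (y, Fract (int (M y)) (int N), 2 :: rat)" for y
  have entry: "quotient_of (Fract (int (M y)) (int N)) = (int (M y), int N)" if y: "y \<in> Y" for y
  proof -
    have "coprime (M y) N"
      using M[OF y] N(1) by (metis coprime_commute nat_dvd_not_less prime_imp_coprime)
    then show ?thesis using N_pos by (simp add: quotient_of_Fract)
  qed
  obtain l where l: "set l = entry ` Y"
    using finite_list[of "entry ` Y"] fin by auto
  have fst_l: "fst ` set l = Y" unfolding l by (force simp: entry_def image_image)
  obtain m where m: "\<And>y x. y \<in> Y \<Longrightarrow> x \<in> set (D y) \<Longrightarrow> length x \<le> m"
  proof (rule that)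
    fix y x assume "y \<in> Y" "x \<in> set (D y)"
    then show "length x \<le> Max (insert 0 (length ` (\<Union>y\<in>Y. set (D y))))"
      using fin by (intro Max_ge) auto
  qed
  have num_sum: "(\<Sum>e\<in>set l. rat_num (fst (snd e))) = (\<Sum>y\<in>Y. M y)"
    unfolding l by (subst sum.reindex) (auto simp: inj_on_def entry_def rat_num_def entry)
  have "N * (\<Sum>y\<in>Y. measure Q (cyl y)) \<le> (\<Sum>y\<in>Y. real (M y) + 1)"
    unfolding sum_distrib_left by (intro sum_mono M)
  then have num_ge: "N * (\<Sum>y\<in>Y. measure Q (cyl y)) - card Y \<le> real (\<Sum>y\<in>Y. M y)"
    by (simp add: sum.distrib)
  \<comment> \<open>The gap left after rounding, N \<delta> minus \<open>card Y\<close>, is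
    multiplied by 2^k until it outweighs the fixed error from \<open>upper_count_le\<close>.\<close>
  obtain k where k: "N * (2 * 2 ^ m) / (N * \<delta> - card Y) < 2 ^ k"
    using real_arch_pow[of 2] by auto
  then have "N * (2 * 2 ^ m) < 2 ^ k * (N * \<delta> - card Y)"
    using N\<delta> by (simp add: field_simps)
  then have "N * (2 ^ k * measure P (\<Union>y\<in>Y. proj y) + 2 * 2 ^ m) < 2 ^ k * (N * (\<Sum>y\<in>Y. measure Q (cyl y)) - card Y)"
    by (simp add: \<delta>_def algebra_simps)
  also have "\<dots> \<le> 2 ^ k * real (\<Sum>y\<in>Y. M y)"
    using num_ge by (intro mult_left_mono) auto
  finally have "N * (2 ^ k * measure P (\<Union>y\<in>Y. proj y) + 2 * 2 ^ m) < 2 ^ k * real (\<Sum>y\<in>Y. M y)" .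
  moreover have "N * real (upper_count D g m k Y) \<le> N * (2 ^ k * measure P (\<Union>y\<in>Y. proj y) + 2 * 2 ^ m)"
    by (intro mult_left_mono upper_count_le[OF P g D m]) auto
  ultimately have "real (N * upper_count D g m k Y) < real (2 ^ k * (\<Sum>y\<in>Y. M y))"
    by simp
  then have "N * upper_count D g m k Y < 2 ^ k * (\<Sum>y\<in>Y. M y)"
    by (simp only: of_nat_less_iff)
  then have "excluding D g l n N m k"
    unfolding excluding_def fst_l num_sum
    using Y0(1) by (auto simp: l Y_def entry_def rat_den_def entry[unfolded Y_def])
  moreover have "Q \<in> basic_open l"
    unfolding basic_open_def
  proof (intro CollectI conjI Qd ballI)
    fix e assume "e \<in> set l"
    then obtain y where y: "y \<in> Y" "e = entry y" by (auto simp: l)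
    have "real_of_rat (Fract (int (M y)) (int N)) < measure Q (cyl y)"
      using M(3)[OF y(1)] N_pos by (simp add: of_rat_rat field_simps)
    moreover have "measure Q (cyl y) < 2"
      using Q.prob_le_1[of "cyl y"] by linarith
    ultimately show "case e of (x, a, b) \<Rightarrow> of_rat a < measure Q (cyl x) \<and> measure Q (cyl x) < of_rat b"
      by (simp add: y entry_def)
  qed
  ultimately show ?thesis by blast
qed

lemma effectively_closed_couplable_class:
  assumes P: "computable_distribution P" and clopen: "computable_clopen proj"
  shows "effectively_closed_class (couplable_class F P)"
proof -
  obtain g where Pd: "P \<in> distributions" and g: "recursive 2 g"
    "\<And>x k. \<bar>measure P (cyl x) - real (g [string_code x, k]) / 2 ^ k\<bar> \<le> 1 / 2 ^ k"
    using P unfolding computable_distribution_def by blast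
  obtain D where D: "computable string_code (list_code string_code) D"
    and proj_eq: "\<And>y. proj y = (\<Union>x\<in>set (D y). cyl x)"
    using clopen unfolding computable_clopen_def by blast
  let ?ce = "pair_code string_code (pair_code rat_code rat_code)"
  have code: "effective_code ?ce"
    by (intro effective_code_pair effective_code_string effective_code_rat)
  define A where "A = {l. \<exists>n N m k. excluding D g l n N m k}"
  \<comment> \<open>The quantifier over first components is moved to the entries of l, where the
    rule for quantification over a coded list applies.\<close>
  have bex_image: "(\<exists>y\<in>fst ` S. B y) \<longleftrightarrow> (\<exists>e\<in>S. B (fst e))" for S :: "('b \<times> 'c) set" and B
    by blast
  have upper: "computable ca id (\<lambda>x. upper_count D g (f x) (h x) (fst ` set (l x)))"
    if f: "computable ca id f" and h: "computable ca id h" and l: "computable ca (list_code ?ce) l"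
    for ca :: "'a \<Rightarrow> nat" and f h and l :: "'a \<Rightarrow> (bool list \<times> rat \<times> rat) list"
    unfolding upper_count_def bex_image
    by (intro computable_sum_strings computable_mult computable_of_bool computable_Suc
        computable_recursive2[OF g(1), of _ string_code] decidable_bex[OF code] decidable_bex[OF effective_code_string]
        decidable_compatible f computable_comp[OF D] computable_comp[OF h] computable_comp[OF l]
        computable_fst computable_snd) (rule computable_ident)+
  have "comp_enumerable (list_code ?ce) A"
    unfolding A_def excluding_def
    by (rule comp_enumerableI[OF effective_code_list[OF code]], unfold mem_Collect_eq,
        intro semidecidable_ex[OF effective_code_id] decidable_imp_semidecidable decidable_conj;
        intro decidable_ball[OF code] decidable_imp decidable_eq[OF inj_string_code]
          decidable_eq[OF effective_code_inj[OF code]] decidable_eq[of id] inj_on_id decidable_less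
          computable_mult upper computable_sum_set[OF code] computable_power computable_rat_num
          computable_rat_den computable_length[of _ of_bool, folded string_code_def]
          computable_fst computable_snd;
        rule computable_ident)
  moreover have "distributions - couplable_class F P = (\<Union>l\<in>A. basic_open l)"
  proof (intro equalityI subsetI)
    fix Q assume "Q \<in> distributions - couplable_class F P"
    then have Q: "Q \<in> distributions" "Q \<notin> couplable_class F P" by auto
    obtain l n N m k where "excluding D g l n N m k" "Q \<in> basic_open l"
      using excluding_complete[OF Pd g(2) proj_eq Q] by auto
    then show "Q \<in> (\<Union>l\<in>A. basic_open l)"
      unfolding A_def by blast
  next
    fix Q assume "Q \<in> (\<Union>l\<in>A. basic_open l)"
    then obtain l n N m k where l: "excluding D g l n N m k" "Q \<in> basic_open l"
      by (auto simp: A_def)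
    then have "Q \<notin> couplable_class F P"
      by (rule excluding_sound[OF Pd g(2) proj_eq])
    then show "Q \<in> distributions - couplable_class F P"
      using l(2) by (simp add: basic_open_def)
  qed
  ultimately show ?thesis
    unfolding effectively_closed_class_def by (auto simp: couplable_class_def)
qed

end

section \<open>Transfer of tests\<close>

lemma of_rat_less_enn2ereal_iff:
  "ereal (of_rat r) < enn2ereal s \<longleftrightarrow> r < 0 \<or> ennreal (of_rat r) < s"
proof (cases "r < 0")
  case True
  then have "ereal (of_rat r) < 0" by simp
  also have "0 \<le> enn2ereal s" by simp
  finally show ?thesis using True by simp
qed (simp add: less_ennreal.rep_eq enn2ereal_ennreal)

lemma ml_test_deficiency_less_iff:
  "x < ml_test_deficiency U \<omega> \<longleftrightarrow> x < 0 \<or> (\<exists>i\<ge>1. \<omega> \<in> U i \<and> x < ereal (real i))"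
  unfolding ml_test_deficiency_def less_SUP_iff by (auto simp: zero_ereal_def)

lemma ml_test_deficiency_mono:
  assumes "\<And>i. 1 \<le> i \<Longrightarrow> \<omega> \<in> U i \<Longrightarrow> \<omega>' \<in> V i"
  shows "ml_test_deficiency U \<omega> \<le> ml_test_deficiency V \<omega>'"
  unfolding ml_test_deficiency_def using assms by (intro SUP_subset_mono) auto

lemma ml_test_antimono:
  assumes "ml_test \<L> U" "1 \<le> i" "i \<le> j" shows "U j \<subseteq> U i"
  using assms(3)
proof (induction j rule: dec_induct)
  case (step j)
  then show ?case using assms(1,2) unfolding ml_test_def by (meson order_trans)
qed simp

lemma ml_test_open: "ml_test \<L> U \<Longrightarrow> 1 \<le> i \<Longrightarrow> open (U i)"
  unfolding ml_test_def by (meson atLeast_iff unif_effectively_open_imp_open)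

lemma log_ennreal_le:
  assumes "x \<le> ennreal c * y" "0 < c"
  shows "log_ennreal x \<le> log_ennreal y + ereal (log 2 c)"
proof (cases "x = 0 \<or> y = \<infinity>")
  case False
  then have y: "y \<noteq> 0" "y \<noteq> \<infinity>" and "x \<noteq> \<infinity>"
    using assms(1) by (auto simp: ennreal_mult_eq_top_iff top_unique)
  obtain a where a: "x = ennreal a" "0 < a"
    using False \<open>x \<noteq> \<infinity>\<close> by (cases x) (auto simp: less_le)
  obtain b where b: "y = ennreal b" "0 < b"
    using y by (cases y) (auto simp: less_le)
  have "a \<le> c * b"
    using assms a b by (simp flip: ennreal_mult')
  then have "log 2 a \<le> log 2 (c * b)"
    using a by simp
  then show ?thesis
    using a b assms(2) by (simp add: log_ennreal_def log_mult add.commute)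
qed (auto simp: log_ennreal_def)

text \<open>The strict inequality survives because the infimum over the compact fibre is attained.\<close>

lemma less_fibre_INF_iff:
  fixes t :: "cantor \<Rightarrow> ennreal"
  assumes F: "closed F" and t: "\<And>r. open {\<omega>. r < t \<omega>}" and r: "r < top"
  shows "r < (INF \<alpha>\<in>{\<alpha>. (\<alpha>, \<beta>) \<in> F}. t \<alpha>) \<longleftrightarrow> (\<forall>\<alpha>. (\<alpha>, \<beta>) \<in> F \<longrightarrow> r < t \<alpha>)"
proof
  assume *: "\<forall>\<alpha>. (\<alpha>, \<beta>) \<in> F \<longrightarrow> r < t \<alpha>"
  have "closed ((\<lambda>\<alpha>. (\<alpha>, \<beta>)) -` F)"
    by (intro closed_vimage F continuous_intros)
  then have "compact {\<alpha>. (\<alpha>, \<beta>) \<in> F}"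
    using compact_Int_closed[OF compact_cantor] by (simp add: vimage_def)
  \<comment> \<open>Intermediate levels q > r give an open cover of the fibre, and the least level
    of a finite subcover still exceeds r. Inserting \<open>top\<close> below provides for an empty
    fibre.\<close>
  moreover have "{\<alpha>. (\<alpha>, \<beta>) \<in> F} \<subseteq> (\<Union>q\<in>{q. r < q}. {\<omega>. q < t \<omega>})"
    using * dense by fastforce
  ultimately obtain I where I: "I \<subseteq> {q. r < q}" "finite I" "{\<alpha>. (\<alpha>, \<beta>) \<in> F} \<subseteq> (\<Union>q\<in>I. {\<omega>. q < t \<omega>})"
    using t by (elim compactE_image) auto
  have "r < Min (insert top I)"
    using I r by (auto simp: top.not_eq_extremum)
  also have "\<dots> \<le> (INF \<alpha>\<in>{\<alpha>. (\<alpha>, \<beta>) \<in> F}. t \<alpha>)"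
  proof (rule INF_greatest)
    fix \<alpha> assume "\<alpha> \<in> {\<alpha>. (\<alpha>, \<beta>) \<in> F}"
    then obtain q where "q \<in> I" "q < t \<alpha>" using I(3) by auto
    then show "Min (insert top I) \<le> t \<alpha>"
      using I(2) by (meson Min_le finite_insert insertI2 less_imp_le order_trans)
  qed
  finally show "r < (INF \<alpha>\<in>{\<alpha>. (\<alpha>, \<beta>) \<in> F}. t \<alpha>)" .
qed (auto intro: less_le_trans INF_lower)

lemma equal_up_to_constI:
  assumes "\<And>x. f x \<le> g x + ereal c" "\<And>x. g x \<le> f x + ereal c'"
  shows "equal_up_to_const f g"
proof -
  have "f x \<le> g x + ereal (max c c')" "g x \<le> f x + ereal (max c c')" for x
    using assms[of x] by (auto elim!: order_trans intro!: add_left_mono)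
  then show ?thesis unfolding equal_up_to_const_def by blast
qed

lemma equal_up_to_const_less_top_iff:
  assumes "equal_up_to_const f g" shows "f x < \<infinity> \<longleftrightarrow> g x < \<infinity>"
proof -
  obtain c where "f x \<le> g x + ereal c" "g x \<le> f x + ereal c"
    using assms unfolding equal_up_to_const_def by blast
  then show ?thesis by (cases "f x"; cases "g x") auto
qed

text \<open>The constant of a maximal test is enlarged to at least 1 so that it has a
  logarithm.\<close>

lemma maximal_expectation_test_bound:
  assumes "maximal_expectation_test \<L> t" "expectation_test \<L> t'"
  shows "\<exists>c>0. \<forall>\<omega>. t' \<omega> \<le> ennreal c * t \<omega>"
proof -
  obtain c where c: "\<And>\<omega>. t' \<omega> \<le> ennreal c * t \<omega>"
    using assms unfolding maximal_expectation_test_def by blast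
  have "ennreal c * t \<omega> \<le> ennreal (max c 1) * t \<omega>" for \<omega>
    by (intro mult_right_mono ennreal_leI) auto
  then have "\<forall>\<omega>. t' \<omega> \<le> ennreal (max c 1) * t \<omega>"
    using c order_trans by blast
  then show ?thesis by (intro exI[of _ "max c 1"]) auto
qed

context clopen_relation
begin

lemma expectation_test_fibre_Sup:
  assumes P: "P \<in> distributions" and clopen: "computable_clopen proj"
    and t: "expectation_test (couplable_class F P) t"
  shows "expectation_test {P} (fibre_Sup t)"
proof -
  have lsc: "lower_semicomputable t" and le: "\<And>Q. Q \<in> couplable_class F P \<Longrightarrow> (\<integral>\<^sup>+\<omega>. t \<omega> \<partial>Q) \<le> 1"
    using t by (auto simp: expectation_test_def)
  have [measurable]: "t \<in> borel_measurable borel"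
    by (rule open_superlevel_imp_borel_measurable[OF lower_semicomputable_open[OF lsc]])
  \<comment> \<open>For negative r both sides are the whole space, on the left because F is
    total.\<close>
  have "hits {\<omega>. ereal (of_rat r) < enn2ereal (t \<omega>)} = {\<alpha>. ereal (of_rat r) < enn2ereal (fibre_Sup t \<alpha>)}" for r
    using total by (auto simp: of_rat_less_enn2ereal_iff fibre_Sup_less_iff hits_def)
  then have "lower_semicomputable (fibre_Sup t)"
    using unif_effectively_open_hits[OF clopen lsc[unfolded lower_semicomputable_def] effective_code_rat]
    by (simp add: lower_semicomputable_def)
  moreover have "(\<integral>\<^sup>+\<alpha>. fibre_Sup t \<alpha> \<partial>P) \<le> 1"
  proof (rule nn_integral_fibre_Sup_le[OF distributionsD(2)[OF P] lower_semicomputable_open[OF lsc]])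
    fix s assume s: "s \<in> borel \<rightarrow>\<^sub>M borel" "\<And>\<alpha>. (\<alpha>, s \<alpha>) \<in> F"
    have "s \<in> P \<rightarrow>\<^sub>M cantor_algebra" "t \<in> borel_measurable cantor_algebra"
      using s(1) distributionsD(2)[OF P] sets_cantor_algebra
      by (auto cong: measurable_cong_sets)
    then have "(\<integral>\<^sup>+\<alpha>. t (s \<alpha>) \<partial>P) = (\<integral>\<^sup>+\<omega>. t \<omega> \<partial>distr P cantor_algebra s)"
      by (simp add: nn_integral_distr)
    also have "\<dots> \<le> 1"
      by (intro le distr_couplable P s)
    finally show "(\<integral>\<^sup>+\<alpha>. t (s \<alpha>) \<partial>P) \<le> 1" .
  qed
  ultimately show ?thesis by (simp add: expectation_test_def)
qed

lemma expectation_test_fibre_INF: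
  assumes F: "effectively_closed F" and t: "expectation_test {P} t"
  shows "expectation_test (couplable_class F P) (\<lambda>\<beta>. INF \<alpha>\<in>{\<alpha>. (\<alpha>, \<beta>) \<in> F}. t \<alpha>)"
    (is "expectation_test _ ?t")
proof -
  have lsc: "lower_semicomputable t" and le: "(\<integral>\<^sup>+\<omega>. t \<omega> \<partial>P) \<le> 1"
    using t by (auto simp: expectation_test_def)
  have "core F {\<omega>. ereal (of_rat r) < enn2ereal (t \<omega>)} = {\<beta>. ereal (of_rat r) < enn2ereal (?t \<beta>)}" for r
    unfolding of_rat_less_enn2ereal_iff
    using less_fibre_INF_iff[OF closed_rel lower_semicomputable_open[OF lsc], of "ennreal (of_rat r)"]
    by (auto simp: core_def)
  then have lsc': "lower_semicomputable ?t"
    using unif_effectively_open_core[OF F lsc[unfolded lower_semicomputable_def] effective_code_rat]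
    by (simp add: lower_semicomputable_def)
  have "(\<integral>\<^sup>+\<beta>. ?t \<beta> \<partial>Q) \<le> 1" if "Q \<in> couplable_class F P" for Q
  proof -
    have "(\<integral>\<^sup>+\<beta>. ?t \<beta> \<partial>Q) \<le> (\<integral>\<^sup>+\<alpha>. t \<alpha> \<partial>P)"
    proof (rule coupling_nn_integral_le[OF that])
      show "t \<in> borel_measurable borel" "?t \<in> borel_measurable borel"
        by (rule open_superlevel_imp_borel_measurable, rule lower_semicomputable_open, fact)+
    qed (auto intro: INF_lower)
    then show ?thesis using le by (rule order_trans)
  qed
  then show ?thesis using lsc' by (simp add: expectation_test_def)
qed

lemma expectation_deficiency_equal:
  assumes P: "P \<in> distributions" and clopen: "computable_clopen proj" and F: "effectively_closed F"
    and dL: "expectation_deficiency (couplable_class F P) d\<^sub>L" and dP: "expectation_deficiency {P} d\<^sub>P"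
  shows "equal_up_to_const d\<^sub>L (\<lambda>\<beta>. INF \<alpha>\<in>{\<alpha>. (\<alpha>, \<beta>) \<in> F}. d\<^sub>P \<alpha>)"
proof -
  obtain tL tP where tL: "maximal_expectation_test (couplable_class F P) tL" "d\<^sub>L = (\<lambda>\<omega>. log_ennreal (tL \<omega>))"
    and tP: "maximal_expectation_test {P} tP" "d\<^sub>P = (\<lambda>\<omega>. log_ennreal (tP \<omega>))"
    using dL dP unfolding expectation_deficiency_def by blast
  have tests: "expectation_test (couplable_class F P) tL" "expectation_test {P} tP"
    using tL(1) tP(1) by (auto simp: maximal_expectation_test_def)
  obtain c where c: "0 < c" "\<And>\<alpha>. fibre_Sup tL \<alpha> \<le> ennreal c * tP \<alpha>"
    using maximal_expectation_test_bound[OF tP(1) expectation_test_fibre_Sup[OF P clopen tests(1)]] by blast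
  obtain c' where c': "0 < c'" "\<And>\<beta>. (INF \<alpha>\<in>{\<alpha>. (\<alpha>, \<beta>) \<in> F}. tP \<alpha>) \<le> ennreal c' * tL \<beta>"
    using maximal_expectation_test_bound[OF tL(1) expectation_test_fibre_INF[OF F tests(2)]] by blast
  show ?thesis
  proof (rule equal_up_to_constI)
    fix \<beta>
    have "d\<^sub>L \<beta> - ereal (log 2 c) \<le> d\<^sub>P \<alpha>" if "(\<alpha>, \<beta>) \<in> F" for \<alpha>
    proof -
      have "tL \<beta> \<le> fibre_Sup tL \<alpha>"
        unfolding fibre_Sup_def using that by (intro SUP_upper) simp
      then have "d\<^sub>L \<beta> \<le> d\<^sub>P \<alpha> + ereal (log 2 c)"
        unfolding tL(2) tP(2) using c by (intro log_ennreal_le) (auto intro: order_trans)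
      then show ?thesis by (simp add: ereal_minus_le)
    qed
    then have "d\<^sub>L \<beta> - ereal (log 2 c) \<le> (INF \<alpha>\<in>{\<alpha>. (\<alpha>, \<beta>) \<in> F}. d\<^sub>P \<alpha>)"
      by (intro INF_greatest) simp
    then show "d\<^sub>L \<beta> \<le> (INF \<alpha>\<in>{\<alpha>. (\<alpha>, \<beta>) \<in> F}. d\<^sub>P \<alpha>) + ereal (log 2 c)"
      by (simp add: ereal_minus_le)
  next
    fix \<beta>
    let ?m = "INF \<alpha>\<in>{\<alpha>. (\<alpha>, \<beta>) \<in> F}. tP \<alpha>"
    have le: "log_ennreal ?m \<le> d\<^sub>L \<beta> + ereal (log 2 c')"
      unfolding tL(2) using c' by (intro log_ennreal_le) auto
    show "(INF \<alpha>\<in>{\<alpha>. (\<alpha>, \<beta>) \<in> F}. d\<^sub>P \<alpha>) \<le> d\<^sub>L \<beta> + ereal (log 2 c')"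
    \<comment> \<open>The logarithm has to be exchanged with the infimum. An infinite infimum makes
      the class deficiency infinite as well; a finite one is attained on the compact fibre, and the
      logarithm is taken at a minimizer.\<close>
    proof (cases "?m = top")
      case True
      then show ?thesis using le by (simp add: log_ennreal_def)
    next
      case False
      have "lower_semicomputable tP"
        using tests(2) by (simp add: expectation_test_def)
      moreover have "?m < top"
        using False by (rule top.not_eq_extremum[THEN iffD1])
      ultimately have "\<not> (\<forall>\<alpha>. (\<alpha>, \<beta>) \<in> F \<longrightarrow> ?m < tP \<alpha>)"
        using less_fibre_INF_iff[OF closed_rel lower_semicomputable_open, of tP ?m \<beta>] by blast
      then obtain \<alpha> where \<alpha>: "(\<alpha>, \<beta>) \<in> F" "tP \<alpha> \<le> ?m"
        unfolding not_all not_imp not_less by blast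
      then have "tP \<alpha> = ?m"
        by (intro antisym INF_lower) auto
      then have "(INF \<alpha>\<in>{\<alpha>. (\<alpha>, \<beta>) \<in> F}. d\<^sub>P \<alpha>) \<le> log_ennreal ?m"
        using \<alpha>(1) unfolding tP(2) by (metis (no_types, lifting) INF_lower mem_Collect_eq)
      then show ?thesis using le by (rule order_trans)
    qed
  qed
qed

section \<open>Probability-bounded tests\<close>

lemma fibre_Sup_indicator: "fibre_Sup (indicator U) = indicator (hits U)"
proof
  fix \<alpha>
  obtain \<beta> where \<beta>: "(\<alpha>, \<beta>) \<in> F" using total by blast
  show "fibre_Sup (indicator U) \<alpha> = indicator (hits U) \<alpha>"
  proof (cases "\<alpha> \<in> hits U")
    case True
    then obtain \<beta>' where "(\<alpha>, \<beta>') \<in> F" "\<beta>' \<in> U" by (auto simp: hits_def)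
    then have "1 \<le> fibre_Sup (indicator U) \<alpha>"
      unfolding fibre_Sup_def by (intro SUP_upper2[of \<beta>']) auto
    moreover have "fibre_Sup (indicator U) \<alpha> \<le> 1"
      unfolding fibre_Sup_def by (intro SUP_least) (simp add: indicator_def)
    ultimately show ?thesis using True by simp
  next
    case False
    then have "fibre_Sup (indicator U) \<alpha> \<le> 0"
      unfolding fibre_Sup_def by (intro SUP_least) (auto simp: hits_def)
    then show ?thesis using False by simp
  qed
qed

text \<open>The integral bound for fibre suprema, applied to an indicator, so that sets need no
  selection argument of their own.\<close>

lemma measure_hits_le:
  assumes P: "P \<in> distributions" and U: "open U" and K: "0 \<le> K"
    and le: "\<And>Q. Q \<in> couplable_class F P \<Longrightarrow> measure Q U \<le> K"
  shows "measure P (hits U) \<le> K"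
proof -
  interpret P: prob_space P using distributionsD[OF P] by simp
  note sets [simp] = distributionsD(2)[OF P]
  have "(\<integral>\<^sup>+\<alpha>. fibre_Sup (indicator U) \<alpha> \<partial>P) \<le> ennreal K"
  proof (rule nn_integral_fibre_Sup_le[OF sets])
    show "open {\<omega>. r < (indicator U \<omega> :: ennreal)}" for r
    proof -
      have "{\<omega>. r < (indicator U \<omega> :: ennreal)} = (if r < 1 then U else {}) \<union> (if r < 0 then UNIV else {})"
        by (auto simp: indicator_def)
      then show ?thesis using U by auto
    qed
    fix s assume s: "s \<in> borel \<rightarrow>\<^sub>M borel" "\<And>\<alpha>. (\<alpha>, s \<alpha>) \<in> F"
    define Q where "Q = distr P cantor_algebra s"
    have Q: "Q \<in> couplable_class F P"
      unfolding Q_def by (intro distr_couplable P s)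
    then have Qd: "Q \<in> distributions" by (simp add: couplable_class_def)
    interpret Q: prob_space Q using distributionsD[OF Qd] by simp
    have m: "s \<in> P \<rightarrow>\<^sub>M cantor_algebra" "U \<in> sets cantor_algebra"
      using s(1) U sets_cantor_algebra by (auto cong: measurable_cong_sets)
    have "(\<integral>\<^sup>+\<alpha>. indicator U (s \<alpha>) \<partial>P) = (\<integral>\<^sup>+\<omega>. indicator U \<omega> \<partial>Q)"
      unfolding Q_def using m by (subst nn_integral_distr) auto
    also have "\<dots> = emeasure Q U"
      using m by (simp add: Q_def)
    also have "\<dots> \<le> ennreal K"
      using le[OF Q] by (simp add: Q.emeasure_eq_measure K ennreal_leI)
    finally show "(\<integral>\<^sup>+\<alpha>. indicator U (s \<alpha>) \<partial>P) \<le> ennreal K" .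
  qed
  then show ?thesis
    using open_hits[OF U] K by (simp add: fibre_Sup_indicator P.emeasure_eq_measure ennreal_le_iff)
qed

lemma ml_test_hits:
  assumes P: "P \<in> distributions" and clopen: "computable_clopen proj"
    and U: "ml_test (couplable_class F P) U"
  shows "ml_test {P} (\<lambda>i. hits (U i))"
proof -
  have "unif_effectively_open id {1..} (\<lambda>i. hits (U i))"
    using U by (intro unif_effectively_open_hits clopen effective_code_id) (simp add: ml_test_def)
  moreover have "hits (U (Suc i)) \<subseteq> hits (U i)" if "1 \<le> i" for i
    using ml_test_antimono[OF U that, of "Suc i"] by (auto simp: hits_def)
  moreover have "measure P (hits (U i)) \<le> 1 / 2 ^ i" if "1 \<le> i" for i
    using U that by (intro measure_hits_le P ml_test_open[OF U]) (auto simp: ml_test_def)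
  ultimately show ?thesis by (simp add: ml_test_def)
qed

lemma ml_test_core:
  assumes P: "P \<in> distributions" and F: "effectively_closed F" and U: "ml_test {P} U"
  shows "ml_test (couplable_class F P) (\<lambda>i. core F (U i))"
proof -
  have eff: "unif_effectively_open id {1..} (\<lambda>i. core F (U i))"
    using U by (intro unif_effectively_open_core F effective_code_id) (simp add: ml_test_def)
  moreover have "core F (U (Suc i)) \<subseteq> core F (U i)" if "1 \<le> i" for i
    using ml_test_antimono[OF U that, of "Suc i"] by (auto simp: core_def)
  moreover have "measure Q (core F (U i)) \<le> 1 / 2 ^ i" if Q: "Q \<in> couplable_class F P" and i: "1 \<le> i" for Q i
  proof -
    have Qd: "Q \<in> distributions" using Q by (simp add: couplable_class_def)
    interpret Q: prob_space Q using distributionsD[OF Qd] by simp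
    interpret P: prob_space P using distributionsD[OF P] by simp
    note sets [simp] = distributionsD(2)[OF Qd] distributionsD(2)[OF P]
    have "open (core F (U i))"
      using unif_effectively_open_imp_open[OF eff] i by simp
    then have borel: "core F (U i) \<in> sets borel" "U i \<in> sets borel"
      using ml_test_open[OF U i] by auto
    have "(\<integral>\<^sup>+\<beta>. indicator (core F (U i)) \<beta> \<partial>Q) \<le> (\<integral>\<^sup>+\<alpha>. indicator (U i) \<alpha> \<partial>P)"
    proof (rule coupling_nn_integral_le[OF Q])
      show "indicator (core F (U i)) \<beta> \<le> (indicator (U i) \<alpha> :: ennreal)" if "(\<alpha>, \<beta>) \<in> F" for \<alpha> \<beta>
        using that by (auto simp: indicator_def core_def)
    qed (use borel in auto)
    then have "measure Q (core F (U i)) \<le> measure P (U i)"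
      using borel by (simp add: P.emeasure_eq_measure Q.emeasure_eq_measure)
    also have "\<dots> \<le> 1 / 2 ^ i"
      using U i by (simp add: ml_test_def)
    finally show ?thesis .
  qed
  ultimately show ?thesis by (simp add: ml_test_def)
qed

text \<open>Levels are integers and tests decrease: if all deficiencies on the fibre exceed x, the
  whole fibre lies in the level set with the first integer index above x. This replaces the attained
  infimum of the expectation-bounded case.\<close>

lemma INF_ml_test_deficiency_le:
  assumes U: "ml_test \<L> U"
  shows "(INF \<alpha>\<in>{\<alpha>. (\<alpha>, \<beta>) \<in> F}. ml_test_deficiency U \<alpha>) \<le> ml_test_deficiency (\<lambda>i. core F (U i)) \<beta>"
proof (rule ccontr)
  define x where "x = ml_test_deficiency (\<lambda>i. core F (U i)) \<beta>"
  assume "\<not> (INF \<alpha>\<in>{\<alpha>. (\<alpha>, \<beta>) \<in> F}. ml_test_deficiency U \<alpha>) \<le> ml_test_deficiency (\<lambda>i. core F (U i)) \<beta>"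
  then have less: "x < (INF \<alpha>\<in>{\<alpha>. (\<alpha>, \<beta>) \<in> F}. ml_test_deficiency U \<alpha>)"
    by (simp add: x_def)
  have "0 \<le> x"
    unfolding x_def ml_test_deficiency_def by (intro SUP_upper2[of 0]) (auto simp: zero_ereal_def)
  moreover have "x \<noteq> \<infinity>" using less by auto
  ultimately obtain y where y: "x = ereal y" "0 \<le> y" by (cases x) auto
  \<comment> \<open>The least integer strictly above y; it is at least 1, as required of a test
    index, and no larger than any j with y < j.\<close>
  define i where "i = Suc (nat \<lfloor>y\<rfloor>)"
  have i: "1 \<le> i" "y < real i" using y by (auto simp: i_def) linarith
  have "\<alpha> \<in> U i" if "(\<alpha>, \<beta>) \<in> F" for \<alpha>
  proof -
    have "x < ml_test_deficiency U \<alpha>"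
      using less that by (meson INF_lower less_le_trans mem_Collect_eq)
    then obtain j where j: "1 \<le> j" "\<alpha> \<in> U j" "y < real j"
      using y by (auto simp: ml_test_deficiency_less_iff)
    then have "i \<le> j" using y(2) by (simp add: i_def) linarith
    then show ?thesis using ml_test_antimono[OF U i(1)] j(2) by blast
  qed
  then have "\<beta> \<in> core F (U i)" by (simp add: core_def)
  then have "x < x"
    unfolding x_def ml_test_deficiency_less_iff using i y by (intro disjI2 exI[of _ i]) (simp add: x_def[symmetric])
  then show False by simp
qed

lemma probability_deficiency_equal:
  assumes P: "P \<in> distributions" and clopen: "computable_clopen proj" and F: "effectively_closed F"
    and dL: "probability_deficiency (couplable_class F P) d\<^sub>L" and dP: "probability_deficiency {P} d\<^sub>P"
  shows "equal_up_to_const d\<^sub>L (\<lambda>\<beta>. INF \<alpha>\<in>{\<alpha>. (\<alpha>, \<beta>) \<in> F}. d\<^sub>P \<alpha>)"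
proof -
  obtain U V where U: "universal_ml_test (couplable_class F P) U" "d\<^sub>L = ml_test_deficiency U"
    and V: "universal_ml_test {P} V" "d\<^sub>P = ml_test_deficiency V"
    using dL dP unfolding probability_deficiency_def by blast
  have tests: "ml_test (couplable_class F P) U" "ml_test {P} V"
    using U(1) V(1) by (auto simp: universal_ml_test_def)
  obtain c where c: "\<And>\<alpha>. ml_test_deficiency (\<lambda>i. hits (U i)) \<alpha> \<le> d\<^sub>P \<alpha> + ereal c"
    using V ml_test_hits[OF P clopen tests(1)] unfolding universal_ml_test_def by blast
  obtain c' where c': "\<And>\<beta>. ml_test_deficiency (\<lambda>i. core F (V i)) \<beta> \<le> d\<^sub>L \<beta> + ereal c'"
    using U ml_test_core[OF P F tests(2)] unfolding universal_ml_test_def by blast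
  show ?thesis
  proof (rule equal_up_to_constI)
    fix \<beta>
    have "d\<^sub>L \<beta> - ereal c \<le> d\<^sub>P \<alpha>" if "(\<alpha>, \<beta>) \<in> F" for \<alpha>
    proof -
      have "d\<^sub>L \<beta> \<le> ml_test_deficiency (\<lambda>i. hits (U i)) \<alpha>"
        unfolding U(2) using that by (intro ml_test_deficiency_mono) (auto simp: hits_def)
      also note c[of \<alpha>]
      finally show ?thesis by (simp add: ereal_minus_le)
    qed
    then have "d\<^sub>L \<beta> - ereal c \<le> (INF \<alpha>\<in>{\<alpha>. (\<alpha>, \<beta>) \<in> F}. d\<^sub>P \<alpha>)"
      by (intro INF_greatest) simp
    then show "d\<^sub>L \<beta> \<le> (INF \<alpha>\<in>{\<alpha>. (\<alpha>, \<beta>) \<in> F}. d\<^sub>P \<alpha>) + ereal c"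
      by (simp add: ereal_minus_le)
    show "(INF \<alpha>\<in>{\<alpha>. (\<alpha>, \<beta>) \<in> F}. d\<^sub>P \<alpha>) \<le> d\<^sub>L \<beta> + ereal c'"
      unfolding V(2) using INF_ml_test_deficiency_le[OF tests(2)] c' by (rule order_trans)
  qed
qed

end

theorem theorem3:
  fixes P :: "cantor measure" and F :: "(cantor \<times> cantor) set" and \<L> :: "cantor measure set"
  assumes P: "computable_distribution P"
    and F_closed: "effectively_closed F"
    and F_total: "\<forall>\<alpha>. \<exists>\<beta>. (\<alpha>, \<beta>) \<in> F"
    and F_clopen: "computable_clopen (\<lambda>y. {\<alpha>. \<exists>\<beta>. (\<alpha>, \<beta>) \<in> F \<and> starts_with \<beta> y})"
    and \<L>: "\<L> = couplable_class F P"
  shows "\<L> \<noteq> {} \<and> effectively_closed_class \<L> \<and>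
    (\<forall>deficiency \<in> {expectation_deficiency, probability_deficiency}.
      \<forall>d\<^sub>\<L> d\<^sub>P. deficiency \<L> d\<^sub>\<L> \<and> deficiency {P} d\<^sub>P \<longrightarrow>
        equal_up_to_const d\<^sub>\<L> (\<lambda>\<beta>. INF \<alpha>\<in>{\<alpha>. (\<alpha>, \<beta>) \<in> F}. d\<^sub>P \<alpha>) \<and>
        (\<forall>\<beta>. d\<^sub>\<L> \<beta> < \<infinity> \<longleftrightarrow> (\<exists>\<alpha>. (\<alpha>, \<beta>) \<in> F \<and> d\<^sub>P \<alpha> < \<infinity>)))"
proof -
  interpret clopen_relation F
  proof
    show "closed F" by (rule effectively_closed_imp_closed[OF F_closed])
    show "\<exists>\<beta>. (\<alpha>, \<beta>) \<in> F" for \<alpha> using F_total by blast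
    show "open {\<alpha>. \<exists>\<beta>. (\<alpha>, \<beta>) \<in> F \<and> starts_with \<beta> y}" for y
      using F_clopen unfolding computable_clopen_def by (auto intro!: open_UN open_cyl)
  qed
  have clopen: "computable_clopen proj"
    using F_clopen by (simp add: proj_def[abs_def])
  have Pd: "P \<in> distributions"
    using P by (simp add: computable_distribution_def)
  \<comment> \<open>The leftmost selection provides a member of the class.\<close>
  have "distr P cantor_algebra (sel []) \<in> \<L>"
    unfolding \<L> by (intro distr_couplable Pd sel_measurable sel_in) (simp add: proj_Nil)
  moreover have "effectively_closed_class \<L>"
    unfolding \<L> by (rule effectively_closed_couplable_class[OF P clopen])
  moreover have "equal_up_to_const d\<^sub>\<L> (\<lambda>\<beta>. INF \<alpha>\<in>{\<alpha>. (\<alpha>, \<beta>) \<in> F}. d\<^sub>P \<alpha>) \<and>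
      (\<forall>\<beta>. d\<^sub>\<L> \<beta> < \<infinity> \<longleftrightarrow> (\<exists>\<alpha>. (\<alpha>, \<beta>) \<in> F \<and> d\<^sub>P \<alpha> < \<infinity>))"
    if "deficiency \<in> {expectation_deficiency, probability_deficiency}"
      "deficiency \<L> d\<^sub>\<L>" "deficiency {P} d\<^sub>P" for deficiency d\<^sub>\<L> d\<^sub>P
  proof -
    have equal: "equal_up_to_const d\<^sub>\<L> (\<lambda>\<beta>. INF \<alpha>\<in>{\<alpha>. (\<alpha>, \<beta>) \<in> F}. d\<^sub>P \<alpha>)"
      using that expectation_deficiency_equal[OF Pd clopen F_closed]
        probability_deficiency_equal[OF Pd clopen F_closed] unfolding \<L> by blast
    \<comment> \<open>An additive constant preserves finiteness, and an infimum is below infinity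
      exactly if one of its members is; over an empty fibre both sides are false.\<close>
    moreover have "d\<^sub>\<L> \<beta> < \<infinity> \<longleftrightarrow> (\<exists>\<alpha>. (\<alpha>, \<beta>) \<in> F \<and> d\<^sub>P \<alpha> < \<infinity>)" for \<beta>
      unfolding equal_up_to_const_less_top_iff[OF equal] INF_less_iff by blast
    ultimately show ?thesis by blast
  qed
  ultimately show ?thesis by blast
qed

end
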